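(* For all $\nu\ge0$, $\beta>0$, $k=1,\ldots,N$, and all starting points $\tilde X_0\in C_N^B$ of the renormalized Bessel process $(\tilde X_t)_{t\ge0}$ of type $B_N$ with parameters $\nu,\beta$, the process $$\Biggl( e^N_k(\tilde X_{t}^2) + \sum_{l=1}^{k} (-2t)^l\binom{N-k+l}{l} \Bigl(N-k+\nu+\frac{1}{2\beta}\Bigr)_l \cdot e_{k-l}^N(\tilde X_{t}^2)\Biggr)_{t\ge0}$$ is a martingale, where $(x)_r:=x(x+1)\cdots(x+r-1)$ is the Pochhammer symbol.
   Context: Let $N\ge1$ and $C_N^B:=\{x\in \mathbb R^N: x_1\ge x_2\ge\ldots\ge x_N\ge0\}$. For $\nu\ge0,\beta>0$, the Bessel process $(X_t)_{t\ge0}$ of type $B_N$ with multiplicities $(k_1,k_2)=(\nu\beta,\beta)$ is the diffusion with values in $C_N^B$ with generator $$\frac12\Delta f+\beta\sum_{i=1}^N\sum_{j\ne i}\Bigl(\frac{1}{x_i-x_j}+\frac{1}{x_i+x_j}\Bigr)\frac{\partial f}{\partial x_i}+\nu\beta\sum_{i=1}^N\frac1{x_i}\frac{\partial f}{\partial x_i}$$ with reflecting boundaries (the domain being the restrictions to $C_N^B$ of $C^2$-functions on $\mathbb R^N$ invariant under all coordinate permutations and sign changes). It satisfies, with an $N$-dimensional Brownian motion $(B_t)_{t\ge0}$, $$dX_{t,i} = dB_{t,i}+ \beta \sum_{j\ne i} \Bigl(\frac{1}{X_{t,i}-X_{t,j}}+ \frac{1}{X_{t,i}+X_{t,j}}\Bigr)dt+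 \frac{\nu\beta}{X_{t,i}}dt\quad(i=1,\ldots,N),$$ with paths reflected at the boundary of $C_N^B$. For $\nu>0$ it is the (known to exist) unique strong solution of this SDE in $C_N^B$ for any deterministic start; for $\nu=0$ the last drift term is absent and reflection means that the equation for $i=N$ has an additional term $dL_t$ with $L$ continuous, adapted, nondecreasing, $L_0=0$, increasing only when $X_{t,N}=0$. The renormalized process is $\tilde X_t:=X_t/\sqrt\beta$. Martingales are understood with respect to the canonical filtration of the Brownian motion. $e_k^N$ denotes the $k$-th elementary symmetric polynomial in $N$ variables ($e_0^N=1$), and for $x\in\mathbb R^N$, $x^2:=(x_1^2,\ldots,x_N^2)$. *)

theory Defs
  imports "HOL-Probability.Probability"
begin

text \<open>
  Points of \<open>\<real>\<^sup>N\<close> are functions \<open>x :: nat \<Rightarrow> real\<close> of which only the values at the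
  indices \<open>1, \<dots>, N\<close> matter. Time is a real parameter of which only the values \<open>t \<ge> 0\<close> matter.
\<close>

definition elem_sym :: "nat \<Rightarrow> nat \<Rightarrow> (nat \<Rightarrow> real) \<Rightarrow> real" where
  "elem_sym N k x = (\<Sum>S | S \<subseteq> {1..N} \<and> card S = k. \<Prod>i\<in>S. x i)"

definition weyl_chamber_B :: "nat \<Rightarrow> (nat \<Rightarrow> real) set" where
  "weyl_chamber_B N = {x. (\<forall>i\<in>{1..<N}. x (Suc i) \<le> x i) \<and> 0 \<le> x N}"

definition martingale :: "'a measure \<Rightarrow> (real \<Rightarrow> 'a measure) \<Rightarrow> (real \<Rightarrow> 'a \<Rightarrow> real) \<Rightarrow> bool" where
  "martingale M F Y \<longleftrightarrow>
     prob_space M \<and> filtration (space M) F \<and> (\<forall>t\<ge>0. subalgebra M (F t)) \<and>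
     (\<forall>t\<ge>0. Y t \<in> borel_measurable (F t)) \<and>
     (\<forall>t\<ge>0. integrable M (Y t)) \<and>
     (\<forall>s t. 0 \<le> s \<and> s \<le> t \<longrightarrow> (AE \<omega> in M. real_cond_exp M (F s) (Y t) \<omega> = Y s \<omega>))"

definition standard_brownian_motion :: "'a measure \<Rightarrow> (real \<Rightarrow> 'a \<Rightarrow> real) \<Rightarrow> bool" where
  "standard_brownian_motion M W \<longleftrightarrow>
     prob_space M \<and>
     (\<forall>t\<ge>0. W t \<in> borel_measurable M) \<and>
     (AE \<omega> in M. W 0 \<omega> = 0) \<and>
     (AE \<omega> in M. continuous_on {0..} (\<lambda>t. W t \<omega>)) \<and>
     (\<forall>s t. 0 \<le> s \<and> s < t \<longrightarrow>
        distributed M lborel (\<lambda>\<omega>. W t \<omega> - W s \<omega>) (normal_density 0 (sqrt (t - s)))) \<and>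
     (\<forall>n (\<tau> :: nat \<Rightarrow> real). 0 \<le> \<tau> 0 \<and> (\<forall>j<n. \<tau> j \<le> \<tau> (Suc j)) \<longrightarrow>
        prob_space.indep_vars M (\<lambda>_. borel) (\<lambda>j \<omega>. W (\<tau> (Suc j)) \<omega> - W (\<tau> j) \<omega>) {..<n})"

text \<open>
  The components of an \<open>N\<close>-dimensional Brownian motion are independent as processes, i.e. as
  random elements of the product space \<open>\<real>\<^bsup>[0,\<infinity>)\<^esup>\<close>.
\<close>

definition brownian_motion :: "'a measure \<Rightarrow> nat \<Rightarrow> (real \<Rightarrow> 'a \<Rightarrow> nat \<Rightarrow> real) \<Rightarrow> bool" where
  "brownian_motion M N B \<longleftrightarrow>
     prob_space M \<and>
     (\<forall>i\<in>{1..N}. standard_brownian_motion M (\<lambda>t \<omega>. B t \<omega> i)) \<and>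
     prob_space.indep_vars M (\<lambda>_. PiM {0..} (\<lambda>_. borel)) (\<lambda>i \<omega>. \<lambda>t\<in>{0..}. B t \<omega> i) {1..N}"

text \<open>
  The canonical filtration is augmented by the null sets, since a strong solution is
  determined by the Brownian motion only almost surely.
\<close>

definition canonical_filtration ::
    "'a measure \<Rightarrow> nat \<Rightarrow> (real \<Rightarrow> 'a \<Rightarrow> nat \<Rightarrow> real) \<Rightarrow> real \<Rightarrow> 'a measure" where
  "canonical_filtration M N B t = sigma (space M)
     ({(\<lambda>\<omega>. B s \<omega> i) -` A \<inter> space M | s i A. 0 \<le> s \<and> s \<le> t \<and> i \<in> {1..N} \<and> A \<in> sets borel}
      \<union> null_sets M)"

definition bessel_drift_B :: "nat \<Rightarrow> real \<Rightarrow> real \<Rightarrow> (nat \<Rightarrow> real) \<Rightarrow> nat \<Rightarrow> real" where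
  "bessel_drift_B N \<nu> \<beta> x i =
     \<beta> * (\<Sum>j\<in>{1..N} - {i}. 1 / (x i - x j) + 1 / (x i + x j)) + \<nu> * \<beta> / x i"

text \<open>
  The points at which no denominator of the drift vanishes (for \<open>\<nu> = 0\<close> the term
  \<open>\<nu> * \<beta> / x i\<close> is absent). As division by zero is total in HOL, the requirement that the
  integrands of the stochastic differential equation be defined for almost all times, which is
  implicit in writing down these integrals, has to be stated explicitly.
\<close>

definition drift_defined_B :: "nat \<Rightarrow> real \<Rightarrow> (nat \<Rightarrow> real) \<Rightarrow> bool" where
  "drift_defined_B N \<nu> x \<longleftrightarrow>
     (\<forall>i\<in>{1..N}. \<forall>j\<in>{1..N} - {i}. x i - x j \<noteq> 0 \<and> x i + x j \<noteq> 0) \<and>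
     (\<nu> \<noteq> 0 \<longrightarrow> (\<forall>i\<in>{1..N}. x i \<noteq> 0))"

text \<open>
  The reflection term \<open>L\<close> for a nonnegative process \<open>Z\<close>: that \<open>L\<close> increases only when \<open>Z = 0\<close>
  is expressed by \<open>L\<close> being constant on every compact time interval on which \<open>Z > 0\<close>.
\<close>

definition reflection_term ::
    "'a measure \<Rightarrow> (real \<Rightarrow> 'a measure) \<Rightarrow> (real \<Rightarrow> 'a \<Rightarrow> real) \<Rightarrow> (real \<Rightarrow> 'a \<Rightarrow> real) \<Rightarrow> bool" where
  "reflection_term M F Z L \<longleftrightarrow>
     (\<forall>t\<ge>0. L t \<in> borel_measurable (F t)) \<and>
     (AE \<omega> in M.
        L 0 \<omega> = 0 \<and>
        continuous_on {0..} (\<lambda>t. L t \<omega>) \<and>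
        mono_on {0..} (\<lambda>t. L t \<omega>) \<and>
        (\<forall>s t. 0 \<le> s \<and> s \<le> t \<and> (\<forall>u\<in>{s..t}. Z u \<omega> > 0) \<longrightarrow> L t \<omega> = L s \<omega>))"

text \<open>
  \<open>X\<close> is the Bessel process of type \<open>B\<^sub>N\<close> with multiplicities \<open>(\<nu> * \<beta>, \<beta>)\<close> and start \<open>x\<close>,
  driven by \<open>B\<close>: the strong solution in the closed Weyl chamber of
  \<open>dX i = dB i + drift i dt\<close>, where for \<open>\<nu> = 0\<close> the equation for \<open>i = N\<close> carries an
  additional reflection term.
\<close>

definition bessel_process_B ::
    "'a measure \<Rightarrow> nat \<Rightarrow> real \<Rightarrow> real \<Rightarrow> (real \<Rightarrow> 'a \<Rightarrow> nat \<Rightarrow> real) \<Rightarrow> (nat \<Rightarrow> real) \<Rightarrow>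
     (real \<Rightarrow> 'a \<Rightarrow> nat \<Rightarrow> real) \<Rightarrow> bool" where
  "bessel_process_B M N \<nu> \<beta> B x X \<longleftrightarrow>
     brownian_motion M N B \<and>
     (\<forall>t\<ge>0. \<forall>i\<in>{1..N}. (\<lambda>\<omega>. X t \<omega> i) \<in> borel_measurable (canonical_filtration M N B t)) \<and>
     (AE \<omega> in M. \<forall>i\<in>{1..N}. continuous_on {0..} (\<lambda>t. X t \<omega> i)) \<and>
     (AE \<omega> in M. \<forall>t\<ge>0. X t \<omega> \<in> weyl_chamber_B N) \<and>
     (AE \<omega> in M. AE s in lborel. 0 \<le> s \<longrightarrow> drift_defined_B N \<nu> (X s \<omega>)) \<and>
     (\<exists>L. (if \<nu> = 0 then reflection_term M (canonical_filtration M N B) (\<lambda>t \<omega>. X t \<omega> N) L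
           else L = (\<lambda>_ _. 0)) \<and>
        (AE \<omega> in M. \<forall>t\<ge>0. \<forall>i\<in>{1..N}.
           set_integrable lborel {0..t} (\<lambda>s. bessel_drift_B N \<nu> \<beta> (X s \<omega>) i) \<and>
           X t \<omega> i = x i + B t \<omega> i + (LBINT s:{0..t}. bessel_drift_B N \<nu> \<beta> (X s \<omega>) i)
             + (if i = N then L t \<omega> else 0)))"

definition renormalized ::
    "real \<Rightarrow> (real \<Rightarrow> 'a \<Rightarrow> nat \<Rightarrow> real) \<Rightarrow> real \<Rightarrow> 'a \<Rightarrow> nat \<Rightarrow> real" where
  "renormalized \<beta> X t \<omega> i = X t \<omega> i / sqrt \<beta>"

end

theory Submission
  imports Defs
begin

text \<open>
  No stochastic integral is needed. Along a path write \<open>X = U + B\<close>, where \<open>U\<close> has bounded variation. Over a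
  step \<open>[v, w]\<close> of a grid compare \<open>e\<^sub>m(X\<^sub>w\<^sup>2)\<close> with \<open>e\<^sub>m((X\<^sub>v + \<Delta>B)\<^sup>2)\<close>. Given the past, the latter has
  conditional mean exactly \<open>e\<^sub>m(X\<^sub>v\<^sup>2 + (w - v))\<close>, because \<open>e\<^sub>m\<close> is affine in each variable and the components
  of \<open>\<Delta>B\<close> are independent. The difference of the two is a sum of weights times increments of \<open>U\<close>, so as the
  mesh shrinks the sum over the grid converges path by path to a Lebesgue integral; the reflection term drops
  out since its weight carries a factor \<open>X\<^sub>N\<close>. The drift maps \<open>e\<^sub>m(x\<^sup>2)\<close> to a multiple of \<open>e\<^bsub>m-1\<^esub>(x\<^sup>2)\<close>,
  and the coefficients in the theorem are those for which the limit vanishes.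

  Passing to the limit under the expectation needs a dominating function. As the partial sums of the drift
  components are nonnegative, the variation of \<open>U\<close> is at most linear in \<open>|U|\<close>; as \<open>x \<cdot> b(x)\<close> is constant,
  \<open>d|U|\<^sup>2 = 2 X \<cdot> dU - 2 B \<cdot> dU\<close> then bounds \<open>U\<close> quadratically by the running maximum of \<open>|B|\<close>, and that
  maximum has all moments by Doob's inequality.
\<close>

section \<open>Elementary symmetric polynomials and the generator\<close>

text \<open>The drift is only known to be integrable in time along each path: it is singular on the
  walls, and no moment of it is given. So the drift may enter only through its integrals over grid
  steps, with continuous weights, and all moments have to come from the Brownian motion. The
  comparison point X_v + \<Delta>B is chosen because X_w - (X_v + \<Delta>B) is exactly the
  increment of U. The Brownian part is then averaged without error and the rest has bounded
  variation, so no quadratic variation has to be computed. Origin of the coefficients: half the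
  Laplacian sends e_m(x^2) to (N-m+1) e_{m-1}(x^2), and the drift sends it to (N-m+1)(2\<nu>\<beta>
  + 2\<beta>(N-m)) e_{m-1}(x^2). Write the coefficient of e_{k-l} as d_l (-2t)^l and put n = N-k+l.
  Cancellation of the time derivative forces 2(l+1) d_{l+1} = (n+1)(2\<beta>n + 2\<nu>\<beta> + 1)
  d_l. The quotients (n+1)/(l+1) build the binomial coefficient. Divided by 2\<beta>, the other
  factor is n + \<nu> + 1/(2\<beta>), the next factor of the Pochhammer symbol; the powers of
  \<beta> are those of the renormalization.\<close>

definition esym :: "nat set \<Rightarrow> nat \<Rightarrow> (nat \<Rightarrow> real) \<Rightarrow> real" where
  "esym A k y = (\<Sum>S | S \<subseteq> A \<and> card S = k. \<Prod>i\<in>S. y i)"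

lemma elem_sym_eq_esym: "elem_sym N k y = esym {1..N} k y"
  by (simp add: elem_sym_def esym_def)

lemma esym_0 [simp]: "finite A \<Longrightarrow> esym A 0 y = 1"
proof -
  assume "finite A"
  then have "{S. S \<subseteq> A \<and> card S = 0} = {{}}"
    by (auto simp: finite_subset card_eq_0_iff)
  then show ?thesis by (simp add: esym_def)
qed

lemma esym_cong: "(\<And>i. i \<in> A \<Longrightarrow> y i = z i) \<Longrightarrow> esym A k y = esym A k z"
  unfolding esym_def by (intro sum.cong prod.cong) auto

text \<open>Splitting the subsets by whether they contain \<open>a\<close> shows that the dependence
  on \<open>y a\<close> is affine, with slope \<open>esym (A - {a}) k y\<close>. General index sets
  are allowed in \<open>esym\<close> because these slopes live on \<open>A - {a}\<close>.\<close>

lemma esym_remove: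
  assumes "finite A" "a \<in> A"
  shows "esym A (Suc k) y = esym (A - {a}) (Suc k) y + y a * esym (A - {a}) k y"
proof -
  let ?P = "{S. S \<subseteq> A - {a} \<and> card S = Suc k}" and ?Q = "{S. S \<subseteq> A - {a} \<and> card S = k}"
  have fin: "finite S" if "S \<subseteq> A - {a}" for S using that assms by (meson finite_Diff finite_subset)
  have split: "{S. S \<subseteq> A \<and> card S = Suc k} = ?P \<union> insert a ` ?Q"
  proof (intro equalityI subsetI)
    fix S assume S: "S \<in> {S. S \<subseteq> A \<and> card S = Suc k}"
    then have "finite S" using assms finite_subset by auto
    show "S \<in> ?P \<union> insert a ` ?Q"
    proof (cases "a \<in> S")
      case True
      then have "S = insert a (S - {a})" "S - {a} \<in> ?Q"
        using S \<open>finite S\<close> by auto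
      then show ?thesis by blast
    qed (use S in auto)
  next
    fix S assume "S \<in> ?P \<union> insert a ` ?Q"
    then show "S \<in> {S. S \<subseteq> A \<and> card S = Suc k}"
      using assms fin by (auto simp: card_insert_if)
  qed
  have inj: "inj_on (insert a) ?Q"
    by (rule inj_onI) (metis (no_types, lifting) Diff_insert_absorb insertI1 mem_Collect_eq subset_Diff_insert)
  have "esym A (Suc k) y = sum (prod y) ?P + sum (prod y) (insert a ` ?Q)"
    unfolding esym_def split by (rule sum.union_disjoint) (use assms in auto)
  also have "sum (prod y) (insert a ` ?Q) = (\<Sum>S\<in>?Q. y a * prod y S)"
    unfolding sum.reindex[OF inj] o_def
    by (intro sum.cong refl prod.insert) (use fin in auto)
  finally show ?thesis by (simp add: esym_def sum_distrib_left)
qed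

text \<open>Switch the coordinates one at a time, in increasing order. Each single switch is affine,
  so the formula is exact and has no second-order remainder; the mixed argument records that the
  coordinates below \<open>i\<close> have already been switched.\<close>

lemma esym_telescope:
  assumes "k > 0"
  shows "esym {1..N} k y' - esym {1..N} k y =
    (\<Sum>i=1..N. (y' i - y i) * esym ({1..N} - {i}) (k - 1) (\<lambda>l. if l < i then y' l else y l))"
proof -
  define w where "w r = (\<lambda>l. if l \<le> r then y' l else y l)" for r :: nat
  obtain m where k: "k = Suc m" using assms gr0_implies_Suc by auto
  have step: "esym {1..N} k (w i) - esym {1..N} k (w (i - 1)) =
      (y' i - y i) * esym ({1..N} - {i}) (k - 1) (\<lambda>l. if l < i then y' l else y l)"
    if i: "i \<in> {1..N}" for i
  proof -
    let ?v = "\<lambda>l. if l < i then y' l else y l"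
    have "esym ({1..N} - {i}) q (w i) = esym ({1..N} - {i}) q ?v"
      and "esym ({1..N} - {i}) q (w (i - 1)) = esym ({1..N} - {i}) q ?v" for q
      by (rule esym_cong; auto simp: w_def)+
    moreover have "w i i = y' i" "w (i - 1) i = y i" using i by (auto simp: w_def)
    moreover have "esym {1..N} k v = esym ({1..N} - {i}) k v + v i * esym ({1..N} - {i}) (k - 1) v" for v
      unfolding k by (simp only: diff_Suc_1, rule esym_remove) (use i in auto)
    ultimately show ?thesis
      by (simp add: algebra_simps)
  qed
  have tel: "(\<Sum>i=1..n. g i - g (i - 1)) = g n - (g 0 :: real)" for g and n :: nat
    by (induction n) auto
  have "(\<Sum>i=1..N. esym {1..N} k (w i) - esym {1..N} k (w (i - 1))) =
      esym {1..N} k (w N) - esym {1..N} k (w 0)"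
    using tel[of "\<lambda>r. esym {1..N} k (w r)" N] .
  moreover have "esym {1..N} k (w N) = esym {1..N} k y'" "esym {1..N} k (w 0) = esym {1..N} k y"
    by (rule esym_cong; auto simp: w_def)+
  ultimately show ?thesis using sum.cong[OF refl step, of "{1..N}"] by simp
qed

text \<open>Double counting: a subset of size \<open>k\<close> is counted once for every index
  outside it, that is \<open>card A - k\<close> times.\<close>

lemma sum_esym_remove:
  assumes "finite A"
  shows "(\<Sum>a\<in>A. esym (A - {a}) k y) = (real (card A) - real k) * esym A k y"
proof -
  let ?F = "{S. S \<subseteq> A \<and> card S = k}"
  have fin: "finite ?F" using assms by auto
  have "(\<Sum>a\<in>A. esym (A - {a}) k y) = (\<Sum>a\<in>A. \<Sum>S\<in>?F. if a \<notin> S then prod y S else 0)"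
  proof (intro sum.cong refl)
    fix a
    have "{S. S \<subseteq> A - {a} \<and> card S = k} = {S \<in> ?F. a \<notin> S}" by auto
    then show "esym (A - {a}) k y = (\<Sum>S\<in>?F. if a \<notin> S then prod y S else 0)"
      by (simp only: esym_def sum.inter_filter[OF fin])
  qed
  also have "\<dots> = (\<Sum>S\<in>?F. \<Sum>a\<in>A. if a \<notin> S then prod y S else 0)"
    by (rule sum.swap)
  also have "\<dots> = (\<Sum>S\<in>?F. (real (card A) - real k) * prod y S)"
  proof (intro sum.cong refl)
    fix S assume S: "S \<in> ?F"
    have "(\<Sum>a\<in>A. if a \<notin> S then prod y S else 0) = (\<Sum>a\<in>A - S. prod y S)"
      by (simp only: sum.inter_filter[OF assms, symmetric] set_diff_eq)
    also have "\<dots> = real (card (A - S)) * prod y S" by simp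
    also have "card (A - S) = card A - k"
      using S assms finite_subset[of S A] by (simp add: card_Diff_subset)
    also have "real (card A - k) = real (card A) - real k"
      using S assms by (auto intro: of_nat_diff card_mono)
    finally show "(\<Sum>a\<in>A. if a \<notin> S then prod y S else 0) = (real (card A) - real k) * prod y S" .
  qed
  finally show ?thesis by (simp add: esym_def sum_distrib_left)
qed

lemma abs_esym_le:
  assumes "finite A" "\<And>i. i \<in> A \<Longrightarrow> \<bar>y i\<bar> \<le> r" "1 \<le> r"
  shows "\<bar>esym A k y\<bar> \<le> 2 ^ card A * r ^ card A"
proof -
  let ?F = "{S. S \<subseteq> A \<and> card S = k}"
  have "\<bar>esym A k y\<bar> \<le> (\<Sum>S\<in>?F. \<bar>prod y S\<bar>)" unfolding esym_def by (rule sum_abs)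
  also have "\<dots> \<le> (\<Sum>S\<in>?F. r ^ card A)"
  proof (rule sum_mono)
    fix S assume S: "S \<in> ?F"
    have "\<bar>prod y S\<bar> \<le> (\<Prod>i\<in>S. r)"
      unfolding abs_prod by (rule prod_mono) (use S assms in auto)
    also have "\<dots> = r ^ card S" by simp
    also have "\<dots> \<le> r ^ card A"
      by (rule power_increasing) (use S assms in \<open>auto intro: card_mono\<close>)
    finally show "\<bar>prod y S\<bar> \<le> r ^ card A" .
  qed
  also have "\<dots> = real (card ?F) * r ^ card A" by simp
  also have "real (card ?F) \<le> 2 ^ card A"
  proof -
    have "card ?F \<le> card (Pow A)" by (rule card_mono) (use assms in auto)
    then show ?thesis using assms by (simp add: card_Pow)
  qed
  finally show ?thesis using assms by (simp add: mult_right_mono)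
qed

lemma continuous_on_esym [continuous_intros]:
  "(\<And>i. i \<in> A \<Longrightarrow> continuous_on S (\<lambda>z. f z i)) \<Longrightarrow> continuous_on S (\<lambda>z. esym A k (f z))"
  unfolding esym_def by (intro continuous_intros) auto

lemma borel_measurable_esym [measurable (raw)]:
  "(\<And>i. i \<in> A \<Longrightarrow> (\<lambda>z. f z i) \<in> borel_measurable M) \<Longrightarrow> (\<lambda>z. esym A k (f z)) \<in> borel_measurable M"
  unfolding esym_def by (intro borel_measurable_sum borel_measurable_prod) auto

text \<open>Symmetrization over the two orderings of a pair. With \<open>g = 0\<close> it cancels
  the mutual repulsion of the coordinates; in the generator it cancels the poles at
  collisions.\<close>

lemma sum_pairs_antisymmetric:
  fixes f :: "'b \<Rightarrow> 'b \<Rightarrow> real"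
  assumes "finite A" "\<And>i j. i \<in> A \<Longrightarrow> j \<in> A \<Longrightarrow> i \<noteq> j \<Longrightarrow> f i j + f j i = g i j"
  shows "2 * (\<Sum>i\<in>A. \<Sum>j\<in>A - {i}. f i j) = (\<Sum>i\<in>A. \<Sum>j\<in>A - {i}. g i j)"
proof -
  have off: "(\<Sum>i\<in>A. \<Sum>j\<in>A - {i}. h i j) = (\<Sum>i\<in>A. \<Sum>j\<in>A. if i \<noteq> j then h i j else 0)"
    for h :: "'b \<Rightarrow> 'b \<Rightarrow> real"
  proof (rule sum.cong[OF refl])
    fix i
    have "A - {i} = {j \<in> A. i \<noteq> j}" by auto
    then show "sum (h i) (A - {i}) = (\<Sum>j\<in>A. if i \<noteq> j then h i j else 0)"
      by (simp only: sum.inter_filter[OF assms(1)])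
  qed
  have "(\<Sum>i\<in>A. \<Sum>j\<in>A - {i}. f i j) = (\<Sum>i\<in>A. \<Sum>j\<in>A - {i}. f j i)"
    unfolding off by (subst sum.swap) (intro sum.cong refl; auto)
  then have "2 * (\<Sum>i\<in>A. \<Sum>j\<in>A - {i}. f i j) = (\<Sum>i\<in>A. \<Sum>j\<in>A - {i}. f i j + f j i)"
    by (simp add: sum.distrib)
  also have "\<dots> = (\<Sum>i\<in>A. \<Sum>j\<in>A - {i}. g i j)"
    by (intro sum.cong refl) (use assms in auto)
  finally show ?thesis .
qed

text \<open>The factor in front of the drift is the i-th partial derivative of e_m(x^2). With y =
  x^2, the two orderings of a pair contribute 4 (y_i E_i - y_j E_j) / (y_i - y_j), and the division
  comes out exactly with quotient \<open>E2 i j\<close>. Counting with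
  \<open>sum_esym_remove\<close> twice then yields the factors N-m and N-m+1.\<close>

lemma bessel_generator_esym:
  assumes x: "drift_defined_B N \<nu> x" and m: "m > 0"
  shows "(\<Sum>i=1..N. 2 * x i * esym ({1..N} - {i}) (m - 1) (\<lambda>l. (x l)\<^sup>2) * bessel_drift_B N \<nu> \<beta> x i)
     = (real N - real m + 1) * (2 * \<nu> * \<beta> + 2 * \<beta> * (real N - real m)) * esym {1..N} (m - 1) (\<lambda>l. (x l)\<^sup>2)"
proof -
  let ?A = "{1..N}" and ?y = "\<lambda>l. (x l)\<^sup>2"
  define E where "E i = esym (?A - {i}) (m - 1) ?y" for i
  define E2 where "E2 i j = esym (?A - {i} - {j}) (m - 1) ?y" for i j
  have pair: "2 * x i * E i * (1 / (x i - x j) + 1 / (x i + x j)) +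
      2 * x j * E j * (1 / (x j - x i) + 1 / (x j + x i)) = 4 * E2 i j"
    if ij: "i \<in> ?A" "j \<in> ?A" "i \<noteq> j" for i j
  proof -
    have nz: "x i - x j \<noteq> 0" "x i + x j \<noteq> 0" "x j - x i \<noteq> 0" "x j + x i \<noteq> 0"
      using x ij unfolding drift_defined_B_def by (auto simp: add.commute)
    have nz2: "?y i - ?y j \<noteq> 0" using nz by (simp add: power2_eq_square square_diff_square_factored)
    have "?A - {j} - {i} = ?A - {i} - {j}" by auto
    \<comment> \<open>\<open>e\<close> is the elementary symmetric polynomial of degree m-2 in the
      variables other than i and j, read as 0 for m = 1. The products y_i y_j e cancel in y_i E_i -
      y_j E_j.\<close>
    obtain e where e: "E i = E2 i j + ?y j * e" "E j = E2 i j + ?y i * e"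
    proof (cases "m = 1")
      case True
      then have "E i = E2 i j + ?y j * 0" "E j = E2 i j + ?y i * 0" by (auto simp: E_def E2_def)
      then show ?thesis by (rule that)
    next
      case False
      then obtain q where q: "m - 1 = Suc q" using m by (metis One_nat_def Suc_pred gr0I Suc_diff_1)
      have "E i = E2 i j + ?y j * esym (?A - {i} - {j}) q ?y"
        unfolding E_def E2_def q by (rule esym_remove) (use ij in auto)
      moreover have "E j = E2 i j + ?y i * esym (?A - {i} - {j}) q ?y"
        unfolding E_def E2_def q \<open>?A - {j} - {i} = ?A - {i} - {j}\<close>[symmetric]
        by (rule esym_remove) (use ij in auto)
      ultimately show ?thesis by (rule that)
    qed
    have 1: "2 * x i * E i * (1 / (x i - x j) + 1 / (x i + x j)) = 4 * (?y i * E i / (?y i - ?y j))"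
      using nz nz2 by (simp add: field_simps power2_eq_square)
    have 2: "2 * x j * E j * (1 / (x j - x i) + 1 / (x j + x i)) = - 4 * (?y j * E j / (?y i - ?y j))"
      using nz nz2 by (simp add: field_simps power2_eq_square)
    show ?thesis unfolding 1 2 unfolding e
      using nz2 by (simp add: divide_simps) (simp add: algebra_simps)
  qed
  have drift: "2 * x i * E i * bessel_drift_B N \<nu> \<beta> x i =
      \<beta> * (\<Sum>j\<in>?A - {i}. 2 * x i * E i * (1 / (x i - x j) + 1 / (x i + x j))) + 2 * \<nu> * \<beta> * E i"
    if "i \<in> ?A" for i
  proof -
    \<comment> \<open>For \<nu> = 0 the coordinate may vanish, but then both sides are 0.\<close>
    have *: "x i * (\<nu> * \<beta> / x i) = \<nu> * \<beta>"
      using x that unfolding drift_defined_B_def by (cases "\<nu> = 0") auto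
    have "2 * x i * E i * (\<nu> * \<beta> / x i) = 2 * E i * (x i * (\<nu> * \<beta> / x i))"
      by (simp only: ac_simps)
    also have "\<dots> = 2 * \<nu> * \<beta> * E i" unfolding * by simp
    finally have "2 * x i * E i * (\<nu> * \<beta> / x i) = 2 * \<nu> * \<beta> * E i" .
    then show ?thesis
      unfolding bessel_drift_B_def distrib_left by (simp add: sum_distrib_left algebra_simps)
  qed
  have "2 * (\<Sum>i\<in>?A. \<Sum>j\<in>?A - {i}. 2 * x i * E i * (1 / (x i - x j) + 1 / (x i + x j)))
      = (\<Sum>i\<in>?A. \<Sum>j\<in>?A - {i}. 4 * E2 i j)"
    by (rule sum_pairs_antisymmetric) (use pair in auto)
  also have "\<dots> = 4 * (\<Sum>i\<in>?A. (real (card (?A - {i})) - real (m - 1)) * E i)"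
    by (simp add: sum_distrib_left[symmetric] E2_def E_def sum_esym_remove)
  also have "(\<Sum>i\<in>?A. (real (card (?A - {i})) - real (m - 1)) * E i) = (\<Sum>i\<in>?A. (real N - real m) * E i)"
    by (intro sum.cong refl) (use m in \<open>auto simp: of_nat_diff\<close>)
  also have "\<dots> = (real N - real m) * ((real N - real m + 1) * esym ?A (m - 1) ?y)"
    using m by (simp add: sum_distrib_left[symmetric] E_def sum_esym_remove of_nat_diff)
  finally have S: "(\<Sum>i\<in>?A. \<Sum>j\<in>?A - {i}. 2 * x i * E i * (1 / (x i - x j) + 1 / (x i + x j)))
      = 2 * (real N - real m) * ((real N - real m + 1) * esym ?A (m - 1) ?y)" by simp
  have SE: "(\<Sum>i\<in>?A. E i) = (real N - real m + 1) * esym ?A (m - 1) ?y"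
    using m by (simp add: E_def sum_esym_remove of_nat_diff)
  have "(\<Sum>i\<in>?A. 2 * x i * E i * bessel_drift_B N \<nu> \<beta> x i) =
     \<beta> * (\<Sum>i\<in>?A. \<Sum>j\<in>?A - {i}. 2 * x i * E i * (1 / (x i - x j) + 1 / (x i + x j)))
     + 2 * \<nu> * \<beta> * (\<Sum>i\<in>?A. E i)"
    using drift by (simp add: sum.distrib sum_distrib_left)
  then show ?thesis unfolding S SE by (simp add: E_def algebra_simps)
qed

section \<open>The Weyl chamber and the sign of the drift\<close>

lemma weyl_chamber_B_antimono:
  assumes "x \<in> weyl_chamber_B N" "1 \<le> i" "i \<le> j" "j \<le> N"
  shows "x j \<le> x i"
  using assms(3,4)
proof (induction j rule: dec_induct)
  case (step j)
  then have "x (Suc j) \<le> x j" using assms by (auto simp: weyl_chamber_B_def)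
  with step show ?case by auto
qed simp

lemma weyl_chamber_B_nonneg:
  assumes "x \<in> weyl_chamber_B N" "i \<in> {1..N}"
  shows "0 \<le> x i"
  using weyl_chamber_B_antimono[of x N i N] assms by (auto simp: weyl_chamber_B_def)

text \<open>The mutual repulsion within \<open>{1..k}\<close> cancels; all other contributions point outwards.\<close>

lemma sum_bessel_drift_nonneg:
  assumes ch: "x \<in> weyl_chamber_B N" and k: "k \<le> N" and "\<nu> \<ge> 0" "\<beta> > 0"
  shows "0 \<le> (\<Sum>i=1..k. bessel_drift_B N \<nu> \<beta> x i)"
proof -
  let ?K = "{1..k}"
  note pos = weyl_chamber_B_nonneg[OF ch]
  have "2 * (\<Sum>i\<in>?K. \<Sum>j\<in>?K - {i}. 1 / (x i - x j)) = (\<Sum>i\<in>?K. \<Sum>j\<in>?K - {i}. 0)"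
    by (rule sum_pairs_antisymmetric) (auto simp: divide_simps)
  then have zero: "(\<Sum>i\<in>?K. \<Sum>j\<in>?K - {i}. 1 / (x i - x j)) = 0" by simp
  have eq: "bessel_drift_B N \<nu> \<beta> x i = \<beta> * (\<Sum>j\<in>?K - {i}. 1 / (x i - x j)) +
      (\<beta> * (\<Sum>j\<in>{k<..N}. 1 / (x i - x j)) + \<beta> * (\<Sum>j\<in>{1..N} - {i}. 1 / (x i + x j)) + \<nu> * \<beta> / x i)"
    if "i \<in> ?K" for i
  proof -
    have "{1..N} - {i} = (?K - {i}) \<union> {k<..N}" using that k by auto
    then have "(\<Sum>j\<in>{1..N} - {i}. 1 / (x i - x j)) =
       (\<Sum>j\<in>?K - {i}. 1 / (x i - x j)) + (\<Sum>j\<in>{k<..N}. 1 / (x i - x j))"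
      by (simp add: sum.union_disjoint disjoint_iff)
    then show ?thesis by (simp add: bessel_drift_B_def sum.distrib algebra_simps)
  qed
  have "(\<Sum>i\<in>?K. bessel_drift_B N \<nu> \<beta> x i) = \<beta> * (\<Sum>i\<in>?K. \<Sum>j\<in>?K - {i}. 1 / (x i - x j)) +
      (\<Sum>i\<in>?K. \<beta> * (\<Sum>j\<in>{k<..N}. 1 / (x i - x j)) + \<beta> * (\<Sum>j\<in>{1..N} - {i}. 1 / (x i + x j)) + \<nu> * \<beta> / x i)"
    using eq by (simp add: sum.distrib sum_distrib_left)
  also have "\<dots> \<ge> 0"
    unfolding zero mult_zero_right add_0
  proof (intro sum_nonneg add_nonneg_nonneg)
    fix i assume i: "i \<in> ?K"
    \<comment> \<open>If two coordinates coincide, the quotient is 0 in HOL, so the sign is right at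
      every point of the chamber and not merely at almost every time.\<close>
    have "0 \<le> 1 / (x i - x j)" if "j \<in> {k<..N}" for j
      using weyl_chamber_B_antimono[OF ch, of i j] i that by auto
    then show "0 \<le> \<beta> * (\<Sum>j\<in>{k<..N}. 1 / (x i - x j))"
      using \<open>\<beta> > 0\<close> by (intro mult_nonneg_nonneg sum_nonneg) auto
    have "0 \<le> 1 / (x i + x j)" if "j \<in> {1..N} - {i}" for j
      using pos[of i] pos[of j] i that k by auto
    then show "0 \<le> \<beta> * (\<Sum>j\<in>{1..N} - {i}. 1 / (x i + x j))"
      using \<open>\<beta> > 0\<close> by (intro mult_nonneg_nonneg sum_nonneg) auto
    show "0 \<le> \<nu> * \<beta> / x i"
      using pos[of i] i k assms by auto
  qed
  finally show ?thesis .
qed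

section \<open>Riemann sums over uniform grids\<close>

definition grid :: "real \<Rightarrow> real \<Rightarrow> nat \<Rightarrow> nat \<Rightarrow> real" where
  "grid s t n j = s + (t - s) * real j / real n"

lemma grid_0 [simp]: "grid s t n 0 = s"
  by (simp add: grid_def)

lemma grid_last [simp]: "n > 0 \<Longrightarrow> grid s t n n = t"
  by (simp add: grid_def)

lemma grid_Suc: "grid s t n (Suc j) = grid s t n j + (t - s) / real n"
  by (simp add: grid_def ring_distribs add_divide_distrib diff_divide_distrib)

lemma grid_mono: "s \<le> t \<Longrightarrow> i \<le> j \<Longrightarrow> grid s t n i \<le> grid s t n j"
  by (simp add: grid_def divide_right_mono mult_left_mono)

lemma grid_ge: "s \<le> t \<Longrightarrow> s \<le> grid s t n j"
  using grid_mono[of s t 0 j n] by simp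

lemma grid_le: "s \<le> t \<Longrightarrow> j \<le> n \<Longrightarrow> grid s t n j \<le> t"
  using grid_mono[of s t j n n] by (cases "n = 0") auto

lemma grid_step_mem:
  assumes "s \<le> t" "j < n" "u \<in> {grid s t n j..grid s t n (Suc j)}"
  shows "u \<in> {s..t}" "\<bar>grid s t n j - u\<bar> \<le> (t - s) / n" "\<bar>grid s t n (Suc j) - u\<bar> \<le> (t - s) / n"
  using grid_ge[of s t n j] grid_le[of s t "Suc j" n] assms grid_Suc[of s t n j] by auto

lemma integral_sum_grid:
  fixes b :: "real \<Rightarrow> real"
  assumes "s \<le> t" "b integrable_on {s..t}" "n > 0"
  shows "integral {s..t} b = (\<Sum>j<n. integral {grid s t n j..grid s t n (Suc j)} b)"
proof -
  have "integral {s..grid s t n m} b = (\<Sum>j<m. integral {grid s t n j..grid s t n (Suc j)} b)"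
    if "m \<le> n" for m
    using that
  proof (induction m)
    case (Suc m)
    have "b integrable_on {s..grid s t n (Suc m)}"
      by (rule integrable_on_subinterval[OF assms(2)]) (use grid_le Suc assms in auto)
    then have "integral {s..grid s t n (Suc m)} b =
        integral {s..grid s t n m} b + integral {grid s t n m..grid s t n (Suc m)} b"
      by (intro Henstock_Kurzweil_Integration.integral_combine[symmetric])
         (use assms in \<open>auto intro: grid_ge grid_mono\<close>)
    with Suc show ?case by simp
  qed simp
  from this[of n] show ?thesis using assms by simp
qed

text \<open>The weights below depend on both endpoints of a step. Uniform continuity on the compact
  square replaces them by their diagonal value at any intermediate time, simultaneously for all
  steps.\<close>

lemma grid_uniform:
  fixes P :: "real \<Rightarrow> real \<Rightarrow> real"
  assumes "s \<le> t" and cont: "continuous_on ({s..t} \<times> {s..t}) (\<lambda>z. P (fst z) (snd z))" and "\<epsilon> > 0"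
  shows "\<forall>\<^sub>F n in sequentially. \<forall>j<n. \<forall>u\<in>{grid s t n j..grid s t n (Suc j)}.
    \<bar>P (grid s t n j) (grid s t n (Suc j)) - P u u\<bar> \<le> \<epsilon>"
proof -
  have "uniformly_continuous_on ({s..t} \<times> {s..t}) (\<lambda>z. P (fst z) (snd z))"
    using cont by (intro compact_uniformly_continuous compact_Times) auto
  then obtain d where d: "d > 0" "\<And>z z'. z \<in> {s..t} \<times> {s..t} \<Longrightarrow> z' \<in> {s..t} \<times> {s..t} \<Longrightarrow>
      dist z' z < d \<Longrightarrow> dist (P (fst z') (snd z')) (P (fst z) (snd z)) < \<epsilon>"
    using \<open>\<epsilon> > 0\<close> unfolding uniformly_continuous_on_def by metis
  have "\<forall>\<^sub>F n in sequentially. 2 * ((t - s) / real n) < d"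
  proof -
    have "(\<lambda>n. 2 * ((t - s) / real n)) \<longlonglongrightarrow> 2 * 0"
      by (intro tendsto_intros lim_const_over_n)
    then show ?thesis using d(1) by (auto elim!: order_tendstoD(2))
  qed
  then show ?thesis
  proof eventually_elim
    case (elim n)
    show ?case
    proof (intro allI impI ballI)
      fix j u assume j: "j < n" and u: "u \<in> {grid s t n j..grid s t n (Suc j)}"
      note st = grid_step_mem[OF \<open>s \<le> t\<close> j u]
      have mem: "grid s t n j \<in> {s..t}" "grid s t n (Suc j) \<in> {s..t}"
        using grid_ge[of s t n] grid_le[of s t _ n] assms j by auto
      \<comment> \<open>The distance in the plane is at most the sum of the two coordinate
        distances, each at most one mesh width; hence the factor 2 above.\<close>
      have "dist (grid s t n j, grid s t n (Suc j)) (u, u) \<le> 2 * ((t - s) / real n)"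
        using st unfolding dist_Pair_Pair dist_real_def
        by (intro order_trans[OF sqrt_sum_squares_le_sum_abs]) linarith
      with elim d(2)[of "(u, u)" "(grid s t n j, grid s t n (Suc j))"] mem st
      show "\<bar>P (grid s t n j) (grid s t n (Suc j)) - P u u\<bar> \<le> \<epsilon>"
        by (force simp: dist_real_def)
    qed
  qed
qed

lemma continuous_on_diag:
  fixes P :: "real \<Rightarrow> real \<Rightarrow> real"
  assumes "continuous_on ({s..t} \<times> {s..t}) (\<lambda>z. P (fst z) (snd z))"
  shows "continuous_on {s..t} (\<lambda>u. P u u)"
proof -
  have "continuous_on {s..t} ((\<lambda>z. P (fst z) (snd z)) \<circ> (\<lambda>u. (u, u)))"
    by (intro continuous_on_compose continuous_intros continuous_on_subset[OF assms]) auto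
  then show ?thesis by (simp add: o_def)
qed

lemma absolutely_integrable_continuous_mult:
  fixes h b :: "real \<Rightarrow> real"
  assumes "continuous_on {s..t} h" "b absolutely_integrable_on {s..t}"
  shows "(\<lambda>u. h u * b u) absolutely_integrable_on {s..t}"
  using assms
  by (intro absolutely_integrable_bounded_measurable_product_real
      continuous_imp_measurable_on_sets_lebesgue compact_imp_bounded compact_continuous_image) auto

lemma absolutely_integrable_on_subcbox:
  fixes b :: "real \<Rightarrow> real"
  assumes "b absolutely_integrable_on {s..t}" "{u..v} \<subseteq> {s..t}"
  shows "b absolutely_integrable_on {u..v}"
  using set_integrable_subset[OF assms(1) _ assms(2)] by simp

text \<open>The indefinite integral of \<open>b\<close> has variation at most the integral of the
  absolute value of \<open>b\<close>. The bound does not depend on \<open>n\<close>, which is what a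
  dominating function requires.\<close>

lemma abs_grid_sum_le:
  fixes b :: "real \<Rightarrow> real"
  assumes "s \<le> t" "n > 0" and b: "b absolutely_integrable_on {s..t}"
    and le: "\<And>j. j < n \<Longrightarrow> \<bar>p j\<bar> \<le> Y"
  shows "\<bar>\<Sum>j<n. p j * integral {grid s t n j..grid s t n (Suc j)} b\<bar> \<le> Y * integral {s..t} (\<lambda>u. \<bar>b u\<bar>)"
proof -
  let ?I = "\<lambda>j. {grid s t n j..grid s t n (Suc j)}"
  have "\<bar>\<Sum>j<n. p j * integral (?I j) b\<bar> \<le> (\<Sum>j<n. \<bar>p j * integral (?I j) b\<bar>)" by (rule sum_abs)
  also have "\<dots> \<le> (\<Sum>j<n. Y * integral (?I j) (\<lambda>u. \<bar>b u\<bar>))"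
  proof (rule sum_mono)
    fix j assume j: "j \<in> {..<n}"
    have "?I j \<subseteq> {s..t}" using grid_step_mem(1)[OF assms(1)] j by blast
    then have ab: "b absolutely_integrable_on ?I j" using b by (rule absolutely_integrable_on_subcbox[rotated])
    have "\<bar>integral (?I j) b\<bar> \<le> integral (?I j) (\<lambda>u. \<bar>b u\<bar>)"
      using integral_norm_bound_integral[of b "?I j" "\<lambda>u. \<bar>b u\<bar>"] ab
      by (auto simp: absolutely_integrable_on_def)
    then show "\<bar>p j * integral (?I j) b\<bar> \<le> Y * integral (?I j) (\<lambda>u. \<bar>b u\<bar>)"
      unfolding abs_mult using le[of j] j by (intro mult_mono) auto
  qed
  also have "\<dots> = Y * integral {s..t} (\<lambda>u. \<bar>b u\<bar>)"
    unfolding sum_distrib_left[symmetric]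
    by (subst integral_sum_grid[OF assms(1) _ assms(2)])
       (use b in \<open>auto simp: absolutely_integrable_on_def\<close>)
  finally show ?thesis .
qed

text \<open>Riemann-Stieltjes sums against an absolutely continuous integrator: moving the weight
  inside the integral over a step costs at most \<epsilon> times the integral of the absolute value
  of \<open>b\<close> over that step.\<close>

lemma grid_sum_tendsto:
  fixes P :: "real \<Rightarrow> real \<Rightarrow> real" and b :: "real \<Rightarrow> real"
  assumes st: "s \<le> t" and cont: "continuous_on ({s..t} \<times> {s..t}) (\<lambda>z. P (fst z) (snd z))"
    and b: "b absolutely_integrable_on {s..t}"
  shows "(\<lambda>n. \<Sum>j<n. P (grid s t n j) (grid s t n (Suc j)) * integral {grid s t n j..grid s t n (Suc j)} b)
    \<longlonglongrightarrow> integral {s..t} (\<lambda>u. P u u * b u)"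
proof (rule LIMSEQ_I, goal_cases)
  case (1 e)
  define V where "V = integral {s..t} (\<lambda>u. \<bar>b u\<bar>)"
  have "V \<ge> 0" unfolding V_def by (rule integral_nonneg) (use b in \<open>auto simp: absolutely_integrable_on_def\<close>)
  \<comment> \<open>The added 1 keeps the quotient meaningful when \<open>b\<close> vanishes almost
    everywhere.\<close>
  define \<epsilon> where "\<epsilon> = e / (V + 1)"
  have \<epsilon>: "\<epsilon> > 0" "\<epsilon> * V < e" using \<open>V \<ge> 0\<close> 1 by (auto simp: \<epsilon>_def field_simps)
  have Pb: "(\<lambda>u. P u u * b u) absolutely_integrable_on {s..t}"
    using continuous_on_diag[OF cont] b by (rule absolutely_integrable_continuous_mult)
  have "\<forall>\<^sub>F n in sequentially. norm ((\<Sum>j<n. P (grid s t n j) (grid s t n (Suc j)) *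
      integral {grid s t n j..grid s t n (Suc j)} b) - integral {s..t} (\<lambda>u. P u u * b u)) < e"
    using grid_uniform[OF st cont \<open>\<epsilon> > 0\<close>] eventually_gt_at_top[of 0]
  proof eventually_elim
    case (elim n)
    let ?I = "\<lambda>j. {grid s t n j..grid s t n (Suc j)}" and ?p = "\<lambda>j. P (grid s t n j) (grid s t n (Suc j))"
    have sub: "?I j \<subseteq> {s..t}" if "j < n" for j using grid_step_mem(1)[OF st that] by blast
    have int: "b absolutely_integrable_on ?I j" "(\<lambda>u. P u u * b u) absolutely_integrable_on ?I j" if "j < n" for j
      using absolutely_integrable_on_subcbox[OF _ sub[OF that]] b Pb by auto
    have "\<bar>(\<Sum>j<n. ?p j * integral (?I j) b) - integral {s..t} (\<lambda>u. P u u * b u)\<bar>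
        = \<bar>\<Sum>j<n. ?p j * integral (?I j) b - integral (?I j) (\<lambda>u. P u u * b u)\<bar>"
      using integral_sum_grid[OF st _ elim(2), of "\<lambda>u. P u u * b u"] Pb
      by (simp add: sum_subtractf absolutely_integrable_on_def)
    also have "\<dots> \<le> (\<Sum>j<n. \<bar>?p j * integral (?I j) b - integral (?I j) (\<lambda>u. P u u * b u)\<bar>)"
      by (rule sum_abs)
    also have "\<dots> \<le> (\<Sum>j<n. \<epsilon> * integral (?I j) (\<lambda>u. \<bar>b u\<bar>))"
    proof (rule sum_mono)
      fix j assume "j \<in> {..<n}"
      then have j: "j < n" by simp
      have i1: "b integrable_on ?I j" "(\<lambda>u. P u u * b u) integrable_on ?I j" "(\<lambda>u. \<bar>b u\<bar>) integrable_on ?I j"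
        using int[OF j] by (auto simp: absolutely_integrable_on_def)
      have "?p j * integral (?I j) b - integral (?I j) (\<lambda>u. P u u * b u) =
          integral (?I j) (\<lambda>u. ?p j * b u - P u u * b u)"
        using i1 by (subst Henstock_Kurzweil_Integration.integral_diff) (auto intro: integrable_on_mult_right)
      also have "norm \<dots> \<le> integral (?I j) (\<lambda>u. \<epsilon> * \<bar>b u\<bar>)"
      proof (rule integral_norm_bound_integral)
        fix u assume "u \<in> ?I j"
        then have "\<bar>?p j - P u u\<bar> \<le> \<epsilon>" using elim j by blast
        then show "norm (?p j * b u - P u u * b u) \<le> \<epsilon> * \<bar>b u\<bar>"
          unfolding real_norm_def left_diff_distrib[symmetric] abs_mult by (rule mult_right_mono) simp
      qed (use i1 in \<open>auto intro!: integrable_diff integrable_on_mult_right\<close>)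
      finally show "\<bar>?p j * integral (?I j) b - integral (?I j) (\<lambda>u. P u u * b u)\<bar>
          \<le> \<epsilon> * integral (?I j) (\<lambda>u. \<bar>b u\<bar>)" by simp
    qed
    also have "\<dots> = \<epsilon> * V"
      unfolding sum_distrib_left[symmetric] V_def
      by (subst integral_sum_grid[OF st _ elim(2)]) (use b in \<open>auto simp: absolutely_integrable_on_def\<close>)
    finally show ?case using \<epsilon> by simp
  qed
  then show ?case by (simp add: eventually_sequentially)
qed

lemma sum_grid_diff:
  fixes L :: "real \<Rightarrow> real"
  shows "n > 0 \<Longrightarrow> (\<Sum>j<n. L (grid s t n (Suc j)) - L (grid s t n j)) = L t - L s"
  using sum_lessThan_telescope[of "\<lambda>j. L (grid s t n j)" n] by simp

text \<open>The weights are controlled only on steps over which \<open>L\<close> moves; for the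
  reflection term nothing better is available elsewhere.\<close>

lemma abs_grid_sum_mono_le:
  fixes L :: "real \<Rightarrow> real"
  assumes "s \<le> t" "n > 0" and L: "mono_on {s..t} L"
    and le: "\<And>j. j < n \<Longrightarrow> L (grid s t n (Suc j)) \<noteq> L (grid s t n j) \<Longrightarrow> \<bar>p j\<bar> \<le> Y"
  shows "\<bar>\<Sum>j<n. p j * (L (grid s t n (Suc j)) - L (grid s t n j))\<bar> \<le> Y * (L t - L s)"
proof -
  let ?D = "\<lambda>j. L (grid s t n (Suc j)) - L (grid s t n j)"
  have "\<bar>\<Sum>j<n. p j * ?D j\<bar> \<le> (\<Sum>j<n. \<bar>p j * ?D j\<bar>)" by (rule sum_abs)
  also have "\<dots> \<le> (\<Sum>j<n. Y * ?D j)"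
  proof (rule sum_mono)
    fix j assume "j \<in> {..<n}"
    then have j: "j < n" by simp
    have "?D j \<ge> 0"
      using mono_onD[OF L, of "grid s t n j" "grid s t n (Suc j)"] assms(1) j
      by (simp add: grid_ge grid_le grid_mono)
    then show "\<bar>p j * ?D j\<bar> \<le> Y * ?D j"
      using le[OF j] by (cases "?D j = 0") (auto simp: abs_mult intro: mult_right_mono)
  qed
  also have "\<dots> = Y * (L t - L s)" unfolding sum_distrib_left[symmetric] using assms sum_grid_diff by simp
  finally show ?thesis .
qed

text \<open>A step over which \<open>L\<close> grows contains a time at which \<open>Z\<close> is
  not positive. The diagonal weight is at most \<open>K\<close> there, and by uniform continuity the
  weight of the step exceeds this by at most \<epsilon>. With \<open>K = 0\<close> the reflection
  term disappears in the limit.\<close>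

lemma grid_sum_reflection_bound:
  fixes P :: "real \<Rightarrow> real \<Rightarrow> real" and L Z :: "real \<Rightarrow> real"
  assumes st: "s \<le> t" and cont: "continuous_on ({s..t} \<times> {s..t}) (\<lambda>z. P (fst z) (snd z))"
    and L: "mono_on {s..t} L"
    and flat: "\<And>u v. s \<le> u \<Longrightarrow> u \<le> v \<Longrightarrow> v \<le> t \<Longrightarrow> (\<And>r. r \<in> {u..v} \<Longrightarrow> 0 < Z r) \<Longrightarrow> L v = L u"
    and K: "\<And>u. u \<in> {s..t} \<Longrightarrow> Z u \<le> 0 \<Longrightarrow> \<bar>P u u\<bar> \<le> K" and "\<epsilon> > 0"
  shows "\<forall>\<^sub>F n in sequentially. \<bar>\<Sum>j<n. P (grid s t n j) (grid s t n (Suc j)) *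
      (L (grid s t n (Suc j)) - L (grid s t n j))\<bar> \<le> (K + \<epsilon>) * (L t - L s)"
  using grid_uniform[OF st cont \<open>\<epsilon> > 0\<close>] eventually_gt_at_top[of 0]
proof eventually_elim
  case (elim n)
  show ?case
  proof (rule abs_grid_sum_mono_le[OF st elim(2) L])
    fix j assume j: "j < n" and ne: "L (grid s t n (Suc j)) \<noteq> L (grid s t n j)"
    have "grid s t n j \<le> grid s t n (Suc j)" "s \<le> grid s t n j" "grid s t n (Suc j) \<le> t"
      using st j by (auto intro: grid_ge grid_le grid_mono)
    with flat ne obtain u where u: "u \<in> {grid s t n j..grid s t n (Suc j)}" "Z u \<le> 0"
      by (meson not_le)
    have "\<bar>P u u\<bar> \<le> K" using K u grid_step_mem(1)[OF st j u(1)] by auto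
    moreover have "\<bar>P (grid s t n j) (grid s t n (Suc j)) - P u u\<bar> \<le> \<epsilon>" using elim(1) j u by blast
    ultimately show "\<bar>P (grid s t n j) (grid s t n (Suc j))\<bar> \<le> K + \<epsilon>" by linarith
  qed
qed

section \<open>Paths of the Bessel process\<close>

text \<open>The factor for the drift alone, as computed in \<open>bessel_generator_esym\<close>.
  Half the Laplacian contributes a further \<open>real N - real m + 1\<close>, which enters through
  the variance of the Brownian increments.\<close>

definition generator_coeff :: "nat \<Rightarrow> real \<Rightarrow> real \<Rightarrow> nat \<Rightarrow> real" where
  "generator_coeff N \<nu> \<beta> m = (real N - real m + 1) * (2 * \<nu> * \<beta> + 2 * \<beta> * (real N - real m))"

text \<open>
  The increment over \<open>[v, w]\<close> of \<open>c(t) e\<^sub>m(X\<^sub>t\<^sup>2)\<close>, minus the part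
  \<open>c(w) (e\<^sub>m((X\<^sub>v + \<Delta>B)\<^sup>2) - e\<^sub>m(X\<^sub>v\<^sup>2 + (w - v)))\<close> that is centered given the past.
\<close>

definition compensated_increment ::
    "nat \<Rightarrow> nat \<Rightarrow> (real \<Rightarrow> real) \<Rightarrow> (real \<Rightarrow> nat \<Rightarrow> real) \<Rightarrow> (real \<Rightarrow> nat \<Rightarrow> real) \<Rightarrow> real \<Rightarrow> real \<Rightarrow> real" where
  "compensated_increment N m c B X v w =
     c w * esym {1..N} m (\<lambda>l. (X w l)\<^sup>2) - c v * esym {1..N} m (\<lambda>l. (X v l)\<^sup>2)
     - c w * (esym {1..N} m (\<lambda>l. (X v l + (B w l - B v l))\<^sup>2) - esym {1..N} m (\<lambda>l. (X v l)\<^sup>2 + (w - v)))"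

text \<open>The constant produced by \<open>U_bound\<close>: the initial energy, the energy supplied
  by the drift up to time \<open>T\<close>, and what remains of the linear terms after Young's
  inequality, all doubled by the absorption except for the leading 1.\<close>

definition path_const :: "nat \<Rightarrow> real \<Rightarrow> real \<Rightarrow> (nat \<Rightarrow> real) \<Rightarrow> real \<Rightarrow> real" where
  "path_const N \<nu> \<beta> a T = 1 + 2 * (\<Sum>i=1..N. (a i)\<^sup>2) + 2 * (generator_coeff N \<nu> \<beta> 1 * T)
     + real N * (4 * real N + 2)\<^sup>2 + 2 * ((4 * real N + 2) * (\<Sum>i=1..N. \<bar>a i\<bar>))"

text \<open>Large enough to majorize every quantity in \<open>path_bounds\<close> at once. The
  factor 2 comes from the bound \<open>2 * W\<close> in \<open>drift_variation_le\<close>.\<close>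

definition path_bound :: "nat \<Rightarrow> real \<Rightarrow> real \<Rightarrow> (nat \<Rightarrow> real) \<Rightarrow> real \<Rightarrow> real" where
  "path_bound N \<nu> \<beta> a T = 2 * (real N * (path_const N \<nu> \<beta> a T + 1) + (\<Sum>i=1..N. \<bar>a i\<bar>)) + 1 + T"

text \<open>A single sample path. All analysis of the equation is deterministic; probability enters
  only because almost every path satisfies these conditions. The case \<nu> > 0 is included with
  \<open>L\<close> constantly 0.\<close>

locale bessel_path =
  fixes N :: nat and \<nu> \<beta> :: real and a :: "nat \<Rightarrow> real"
    and B X :: "real \<Rightarrow> nat \<Rightarrow> real" and L :: "real \<Rightarrow> real"
  assumes N: "N \<ge> 1" and \<nu>: "\<nu> \<ge> 0" and \<beta>: "\<beta> > 0"
    and cont_B: "i \<in> {1..N} \<Longrightarrow> continuous_on {0..} (\<lambda>t. B t i)"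
    and cont_X: "i \<in> {1..N} \<Longrightarrow> continuous_on {0..} (\<lambda>t. X t i)"
    and chamber: "t \<ge> 0 \<Longrightarrow> X t \<in> weyl_chamber_B N"
    and drift_defined: "AE s in lborel. 0 \<le> s \<longrightarrow> drift_defined_B N \<nu> (X s)"
    and L_0: "L 0 = 0" and L_mono: "mono_on {0..} L"
    and L_flat: "0 \<le> s \<Longrightarrow> s \<le> t \<Longrightarrow> (\<And>u. u \<in> {s..t} \<Longrightarrow> 0 < X u N) \<Longrightarrow> L t = L s"
    and drift_integrable: "t \<ge> 0 \<Longrightarrow> i \<in> {1..N} \<Longrightarrow>
      set_integrable lborel {0..t} (\<lambda>s. bessel_drift_B N \<nu> \<beta> (X s) i)"
    and sde: "t \<ge> 0 \<Longrightarrow> i \<in> {1..N} \<Longrightarrow>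
      X t i = a i + B t i + (LBINT s:{0..t}. bessel_drift_B N \<nu> \<beta> (X s) i) + (if i = N then L t else 0)"
begin

definition b :: "nat \<Rightarrow> real \<Rightarrow> real" where
  "b i u = bessel_drift_B N \<nu> \<beta> (X u) i"

definition U :: "real \<Rightarrow> nat \<Rightarrow> real" where
  "U t i = X t i - B t i"

lemma b_absolutely_integrable:
  assumes "0 \<le> s" "i \<in> {1..N}"
  shows "b i absolutely_integrable_on {s..t}"
proof (cases "0 \<le> t")
  case True
  have "set_integrable lborel {0..t} (b i)"
    using drift_integrable[OF True assms(2)] by (simp add: b_def[abs_def])
  then have "b i absolutely_integrable_on {0..t}"
    by (simp add: set_integrable_def integrable_completion borel_measurable_integrable)
  then show ?thesis by (rule absolutely_integrable_on_subcbox) (use assms in auto)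
qed (use assms in auto)

lemma b_integrable:
  assumes "0 \<le> s" "i \<in> {1..N}"
  shows "b i integrable_on {s..t}" "(\<lambda>u. \<bar>b i u\<bar>) integrable_on {s..t}"
  using b_absolutely_integrable[OF assms, of t] by (auto simp: absolutely_integrable_on_def)

lemma X_eq:
  assumes "t \<ge> 0" "i \<in> {1..N}"
  shows "X t i = a i + B t i + integral {0..t} (b i) + (if i = N then L t else 0)"
  using sde[OF assms] set_borel_integral_eq_integral(2)[OF drift_integrable[OF assms]]
  by (simp add: b_def[abs_def])

lemma U_0: "i \<in> {1..N} \<Longrightarrow> U 0 i = a i"
  using X_eq[of 0 i] L_0 by (simp add: U_def)

lemma U_increment:
  assumes "0 \<le> s" "s \<le> t" "i \<in> {1..N}"
  shows "U t i - U s i = integral {s..t} (b i) + (if i = N then L t - L s else 0)"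
proof -
  have "integral {0..s} (b i) + integral {s..t} (b i) = integral {0..t} (b i)"
    by (rule Henstock_Kurzweil_Integration.integral_combine) (use assms b_integrable in auto)
  then show ?thesis using X_eq[of s i] X_eq[of t i] assms by (cases "i = N") (auto simp: U_def)
qed

lemma L_nonneg: "t \<ge> 0 \<Longrightarrow> L t \<ge> 0"
  using mono_onD[OF L_mono, of 0 t] L_0 by simp

lemma bad_times_negligible:
  obtains S where "negligible S" "\<And>u. 0 \<le> u \<Longrightarrow> u \<notin> S \<Longrightarrow> drift_defined_B N \<nu> (X u)"
proof -
  obtain S where S: "\<And>s. s \<in> space lborel - S \<Longrightarrow> 0 \<le> s \<longrightarrow> drift_defined_B N \<nu> (X s)"
    "S \<in> null_sets lborel" using AE_E3[OF drift_defined] by blast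
  have "negligible S"
    using S(2) by (simp add: negligible_iff_null_sets null_sets_completionI)
  with S(1) that show ?thesis by auto
qed

text \<open>The separate drift components may blow up at collisions, and only their weighted sum
  simplifies. It does so at all times outside a null set, which the integral ignores. The function
  \<open>h\<close> will be a time-dependent coefficient.\<close>

lemma integral_generator:
  assumes "0 \<le> s" "m > 0" and h: "continuous_on {s..t} h"
  shows "(\<Sum>i=1..N. integral {s..t} (\<lambda>u. h u * (2 * X u i) * esym ({1..N} - {i}) (m - 1) (\<lambda>l. (X u l)\<^sup>2) * b i u))
    = integral {s..t} (\<lambda>u. h u * (generator_coeff N \<nu> \<beta> m * esym {1..N} (m - 1) (\<lambda>l. (X u l)\<^sup>2)))"
proof -
  have X: "continuous_on {s..t} (\<lambda>u. X u i)" if "i \<in> {1..N}" for i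
    by (rule continuous_on_subset[OF cont_X[OF that]]) (use assms in auto)
  have int: "(\<lambda>u. h u * (2 * X u i) * esym ({1..N} - {i}) (m - 1) (\<lambda>l. (X u l)\<^sup>2) * b i u) integrable_on {s..t}"
    if "i \<in> {1..N}" for i
  proof -
    have "continuous_on {s..t} (\<lambda>u. h u * (2 * X u i) * esym ({1..N} - {i}) (m - 1) (\<lambda>l. (X u l)\<^sup>2))"
      by (intro continuous_intros h X) (use that in auto)
    from absolutely_integrable_continuous_mult[OF this b_absolutely_integrable[OF assms(1) that]]
    show ?thesis by (simp add: absolutely_integrable_on_def)
  qed
  obtain S where S: "negligible S" "\<And>u. 0 \<le> u \<Longrightarrow> u \<notin> S \<Longrightarrow> drift_defined_B N \<nu> (X u)"
    using bad_times_negligible by blast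
  have "(\<Sum>i=1..N. integral {s..t} (\<lambda>u. h u * (2 * X u i) * esym ({1..N} - {i}) (m - 1) (\<lambda>l. (X u l)\<^sup>2) * b i u))
     = integral {s..t} (\<lambda>u. \<Sum>i=1..N. h u * (2 * X u i) * esym ({1..N} - {i}) (m - 1) (\<lambda>l. (X u l)\<^sup>2) * b i u)"
    by (rule integral_sum[symmetric]) (use int in auto)
  also have "\<dots> = integral {s..t} (\<lambda>u. h u * (generator_coeff N \<nu> \<beta> m * esym {1..N} (m - 1) (\<lambda>l. (X u l)\<^sup>2)))"
  proof (rule integral_spike[OF S(1)])
    fix u assume u: "u \<in> {s..t} - S"
    have "(\<Sum>i=1..N. h u * (2 * X u i) * esym ({1..N} - {i}) (m - 1) (\<lambda>l. (X u l)\<^sup>2) * b i u) =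
       h u * (\<Sum>i=1..N. 2 * X u i * esym ({1..N} - {i}) (m - 1) (\<lambda>l. (X u l)\<^sup>2) * b i u)"
      by (simp add: sum_distrib_left mult.assoc)
    also have "\<dots> = h u * (generator_coeff N \<nu> \<beta> m * esym {1..N} (m - 1) (\<lambda>l. (X u l)\<^sup>2))"
      using bessel_generator_esym[OF S(2) assms(2), of u \<beta>] u assms(1)
      by (simp add: b_def generator_coeff_def)
    finally show "h u * (generator_coeff N \<nu> \<beta> m * esym {1..N} (m - 1) (\<lambda>l. (X u l)\<^sup>2)) =
       (\<Sum>i=1..N. h u * (2 * X u i) * esym ({1..N} - {i}) (m - 1) (\<lambda>l. (X u l)\<^sup>2) * b i u)" ..
  qed
  finally show ?thesis .
qed

section \<open>A priori bounds for a single path\<close>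

lemma drift_variation_le:
  assumes t: "t \<ge> 0"
  defines "W \<equiv> \<Sum>i=1..N. \<bar>U t i\<bar> + \<bar>a i\<bar>"
  shows "i \<in> {1..N} \<Longrightarrow> integral {0..t} (\<lambda>u. \<bar>b i u\<bar>) \<le> 2 * W" and "L t \<le> W"
proof -
  let ?S = "\<lambda>k u. \<Sum>i=1..k. b i u"
  have S_nonneg: "0 \<le> ?S k u" if "k \<le> N" "u \<in> {0..t}" for k u
    unfolding b_def by (rule sum_bessel_drift_nonneg[OF chamber]) (use that \<nu> \<beta> in auto)
  have S_int: "?S k integrable_on {0..t}" if "k \<le> N" for k
    by (rule integrable_sum) (use that b_integrable in auto)
  have eq: "integral {0..t} (?S k) = (\<Sum>i=1..k. U t i - a i) - (if k = N then L t else 0)" if "k \<le> N" for k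
  proof -
    have "integral {0..t} (?S k) = (\<Sum>i=1..k. integral {0..t} (b i))"
      by (rule integral_sum) (use that b_integrable in auto)
    also have "\<dots> = (\<Sum>i=1..k. (U t i - a i) - (if i = N then L t else 0))"
      by (rule sum.cong[OF refl]) (use that t X_eq U_def in auto)
    also have "\<dots> = (\<Sum>i=1..k. U t i - a i) - (\<Sum>i=1..k. if i = N then L t else 0)"
      by (rule sum_subtractf)
    also have "(\<Sum>i=1..k. if i = N then L t else 0) = (if k = N then L t else 0)"
      using that N by (auto simp: sum.delta)
    finally show ?thesis .
  qed
  have le_W: "(\<Sum>i=1..k. U t i - a i) \<le> W" if "k \<le> N" for k
  proof -
    have "(\<Sum>i=1..k. U t i - a i) \<le> (\<Sum>i=1..k. \<bar>U t i\<bar> + \<bar>a i\<bar>)" by (rule sum_mono) linarith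
    also have "\<dots> \<le> W" unfolding W_def by (rule sum_mono2) (use that in auto)
    finally show ?thesis .
  qed
  have S_le: "integral {0..t} (?S k) \<le> W" if "k \<le> N" for k
    using eq[OF that] le_W[OF that] L_nonneg[OF t] by auto
  \<comment> \<open>For \<open>k = N\<close> the integral of the full sum is nonnegative and equals
    the total increment of \<open>U\<close> minus \<open>L t\<close>.\<close>
  show "L t \<le> W"
    using eq[of N] le_W[of N] integral_nonneg[OF S_int[of N] S_nonneg] by auto
  assume i: "i \<in> {1..N}"
  \<comment> \<open>\<open>b i\<close> is the difference of two consecutive partial sums. Both are
    nonnegative, so its absolute value is at most their sum, whose integral \<open>eq\<close>
    evaluates through \<open>U\<close> and \<open>L\<close>.\<close>
  have "\<bar>b i u\<bar> \<le> ?S i u + ?S (i - 1) u" if "u \<in> {0..t}" for u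
  proof -
    have "?S i u = ?S (i - 1) u + b i u" using i by (cases i) auto
    moreover have "0 \<le> ?S i u" "0 \<le> ?S (i - 1) u" by (rule S_nonneg; use i that in auto)+
    ultimately show ?thesis by linarith
  qed
  then have "integral {0..t} (\<lambda>u. \<bar>b i u\<bar>) \<le> integral {0..t} (\<lambda>u. ?S i u + ?S (i - 1) u)"
    using i b_integrable S_int by (intro integral_le integrable_add) auto
  also have "\<dots> = integral {0..t} (?S i) + integral {0..t} (?S (i - 1))"
    by (rule Henstock_Kurzweil_Integration.integral_add) (use i S_int in auto)
  also have "\<dots> \<le> W + W" by (intro add_mono S_le) (use i in auto)
  finally show "integral {0..t} (\<lambda>u. \<bar>b i u\<bar>) \<le> 2 * W" by simp
qed

lemma cont_on_square:
  assumes "0 \<le> s" "i \<in> {1..N}"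
  shows "continuous_on ({s..t} \<times> {s..t}) (\<lambda>z. X (fst z) i)" "continuous_on ({s..t} \<times> {s..t}) (\<lambda>z. X (snd z) i)"
    "continuous_on ({s..t} \<times> {s..t}) (\<lambda>z. B (fst z) i)" "continuous_on ({s..t} \<times> {s..t}) (\<lambda>z. B (snd z) i)"
  by (rule continuous_on_compose2[OF cont_X[OF assms(2)]] continuous_on_compose2[OF cont_B[OF assms(2)]];
      use assms in \<open>auto intro!: continuous_intros\<close>)+

text \<open>Along a grid, U_w^2 - U_v^2 = (U_v + U_w)(U_w - U_v) holds exactly, and since
  \<open>U\<close> has bounded variation the limit has no correction term. The diagonal weight is 2U
  = 2X - 2B: the part with X integrates to a multiple of \<open>t\<close>, and the part with B is at
  most \<open>2 * r\<close> times the variation of the drift.\<close>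

lemma energy_le:
  assumes t: "t \<ge> 0" and r: "\<And>u i. u \<in> {0..t} \<Longrightarrow> i \<in> {1..N} \<Longrightarrow> \<bar>B u i\<bar> \<le> r"
  shows "(\<Sum>i=1..N. (U t i)\<^sup>2) \<le> (\<Sum>i=1..N. (a i)\<^sup>2) + generator_coeff N \<nu> \<beta> 1 * t
     + 2 * r * (\<Sum>i=1..N. integral {0..t} (\<lambda>u. \<bar>b i u\<bar>)) + (2 * r + 1) * L t"
proof -
  let ?g = "grid 0 t"
  define P where "P i v w = U v i + U w i" for i v w
  have cP: "continuous_on ({0..t} \<times> {0..t}) (\<lambda>z. P i (fst z) (snd z))" if "i \<in> {1..N}" for i
    unfolding P_def U_def by (intro continuous_intros cont_on_square) (use that in auto)
  define f where "f n = (\<Sum>i=1..N. \<Sum>j<n. P i (?g n j) (?g n (Suc j)) * integral {?g n j..?g n (Suc j)} (b i))" for n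
  have f_lim: "f \<longlonglongrightarrow> (\<Sum>i=1..N. integral {0..t} (\<lambda>u. P i u u * b i u))"
    unfolding f_def
    by (intro tendsto_sum grid_sum_tendsto t cP b_absolutely_integrable) auto
  have NN: "N \<in> {1..N}" using N by simp
  have ev: "\<forall>\<^sub>F n in sequentially. (\<Sum>i=1..N. (U t i)\<^sup>2) - (\<Sum>i=1..N. (a i)\<^sup>2) - (2 * r + 1) * L t \<le> f n"
  proof -
    have "\<forall>\<^sub>F n in sequentially. \<bar>\<Sum>j<n. P N (?g n j) (?g n (Suc j)) * (L (?g n (Suc j)) - L (?g n j))\<bar>
        \<le> (2 * r + 1) * (L t - L 0)"
    proof (rule grid_sum_reflection_bound[OF t cP[OF NN], where Z = "\<lambda>u. X u N"])
      show "mono_on {0..t} L" using L_mono by (rule mono_on_subset) auto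
      show "L v = L u" if "0 \<le> u" "u \<le> v" "v \<le> t" "\<And>r. r \<in> {u..v} \<Longrightarrow> 0 < X r N" for u v
        using L_flat that by blast
      fix u assume u: "u \<in> {0..t}" "X u N \<le> 0"
      then have "X u N = 0" using weyl_chamber_B_nonneg[OF chamber NN, of u] by auto
      \<comment> \<open>When X_N = 0 the last component of U is -B_N, so the weight is -2 B_N. The
        extra 1 in \<open>2 * r + 1\<close> is the choice \<epsilon> = 1.\<close>
      then show "\<bar>P N u u\<bar> \<le> 2 * r" using r[OF u(1) NN] by (simp add: P_def U_def)
    qed simp
    then show ?thesis using eventually_gt_at_top[of 0]
    proof eventually_elim
      case (elim n)
      have "(\<Sum>i=1..N. (U t i)\<^sup>2) - (\<Sum>i=1..N. (a i)\<^sup>2) = (\<Sum>i=1..N. (U t i)\<^sup>2 - (U 0 i)\<^sup>2)"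
        by (simp add: sum_subtractf U_0)
      also have "\<dots> = (\<Sum>i=1..N. \<Sum>j<n. (U (?g n (Suc j)) i)\<^sup>2 - (U (?g n j) i)\<^sup>2)"
        using sum_grid_diff[OF elim(2), of "\<lambda>u. (U u _)\<^sup>2" 0 t] by simp
      also have "\<dots> = (\<Sum>i=1..N. \<Sum>j<n. P i (?g n j) (?g n (Suc j)) * integral {?g n j..?g n (Suc j)} (b i)
          + (if i = N then P N (?g n j) (?g n (Suc j)) * (L (?g n (Suc j)) - L (?g n j)) else 0))"
      proof (intro sum.cong refl)
        fix i j assume i: "i \<in> {1..N}" and "j \<in> {..<n}"
        have "(U (?g n (Suc j)) i)\<^sup>2 - (U (?g n j) i)\<^sup>2 =
            P i (?g n j) (?g n (Suc j)) * (U (?g n (Suc j)) i - U (?g n j) i)"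
          by (simp add: P_def power2_eq_square algebra_simps)
        then show "(U (?g n (Suc j)) i)\<^sup>2 - (U (?g n j) i)\<^sup>2 = 
           P i (?g n j) (?g n (Suc j)) * integral {?g n j..?g n (Suc j)} (b i)
          + (if i = N then P N (?g n j) (?g n (Suc j)) * (L (?g n (Suc j)) - L (?g n j)) else 0)"
          by (subst (asm) U_increment) (use t i in \<open>auto intro: grid_ge grid_mono simp: distrib_left\<close>)
      qed
      also have "\<dots> = f n + (\<Sum>i=1..N. if i = N then
          \<Sum>j<n. P N (?g n j) (?g n (Suc j)) * (L (?g n (Suc j)) - L (?g n j)) else 0)"
        unfolding f_def sum.distrib by (intro arg_cong2[of _ _ _ _ "(+)"] sum.cong refl) auto
      also have "\<dots> = f n + (\<Sum>j<n. P N (?g n j) (?g n (Suc j)) * (L (?g n (Suc j)) - L (?g n j)))"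
        using NN by (simp add: sum.delta)
      finally show ?case using elim(1) L_0 by simp
    qed
  qed
  have X: "continuous_on {0..t} (\<lambda>u. X u i)" "continuous_on {0..t} (\<lambda>u. B u i)" if "i \<in> {1..N}" for i
    by (rule continuous_on_subset[OF cont_X[OF that]] continuous_on_subset[OF cont_B[OF that]]; auto)+
  have int: "(\<lambda>u. h u * b i u) integrable_on {0..t}" if "continuous_on {0..t} h" "i \<in> {1..N}" for h i
    using absolutely_integrable_continuous_mult[OF that(1) b_absolutely_integrable[of 0 i t]] that(2)
    by (simp add: absolutely_integrable_on_def)
  have "(\<Sum>i=1..N. integral {0..t} (\<lambda>u. P i u u * b i u))
      \<le> (\<Sum>i=1..N. integral {0..t} (\<lambda>u. 2 * X u i * b i u) + 2 * r * integral {0..t} (\<lambda>u. \<bar>b i u\<bar>))"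
  proof (rule sum_mono)
    fix i assume i: "i \<in> {1..N}"
    have i1: "(\<lambda>u. 2 * X u i * b i u) integrable_on {0..t}"
      by (intro int continuous_intros X i)
    have "integral {0..t} (\<lambda>u. P i u u * b i u) \<le> integral {0..t} (\<lambda>u. 2 * X u i * b i u + 2 * r * \<bar>b i u\<bar>)"
    proof (rule integral_le)
      show "(\<lambda>u. P i u u * b i u) integrable_on {0..t}"
        by (rule int[OF continuous_on_diag[OF cP[OF i]] i])
      show "(\<lambda>u. 2 * X u i * b i u + 2 * r * \<bar>b i u\<bar>) integrable_on {0..t}"
        by (intro integrable_add i1 integrable_on_mult_right b_integrable i order_refl)
      fix u assume u: "u \<in> {0..t}"
      have "- (B u i * b i u) \<le> \<bar>B u i\<bar> * \<bar>b i u\<bar>" using abs_ge_minus_self[of "B u i * b i u"] by (simp add: abs_mult)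
      also have "\<dots> \<le> r * \<bar>b i u\<bar>" by (rule mult_right_mono) (use r[OF u i] in auto)
      finally show "P i u u * b i u \<le> 2 * X u i * b i u + 2 * r * \<bar>b i u\<bar>"
        by (simp add: P_def U_def algebra_simps)
    qed
    also have "\<dots> = integral {0..t} (\<lambda>u. 2 * X u i * b i u) + integral {0..t} (\<lambda>u. 2 * r * \<bar>b i u\<bar>)"
      by (intro Henstock_Kurzweil_Integration.integral_add i1 integrable_on_mult_right b_integrable i order_refl)
    finally show "integral {0..t} (\<lambda>u. P i u u * b i u) \<le>
        integral {0..t} (\<lambda>u. 2 * X u i * b i u) + 2 * r * integral {0..t} (\<lambda>u. \<bar>b i u\<bar>)" by simp
  qed
  \<comment> \<open>Degree 1 and \<open>h = 1\<close>: e_1(x^2) is the squared norm and e_0 = 1, so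
    the inner product of X with its drift is constant.\<close>
  also have "\<dots> = generator_coeff N \<nu> \<beta> 1 * t + 2 * r * (\<Sum>i=1..N. integral {0..t} (\<lambda>u. \<bar>b i u\<bar>))"
    using integral_generator[of 0 1 t "\<lambda>_. 1"] t by (simp add: sum.distrib sum_distrib_left)
  finally show ?thesis
    using tendsto_lowerbound[OF f_lim ev] by simp
qed

text \<open>The energy estimate bounds |U|^2 by a constant plus a multiple of
  \<open>(1 + r) * W\<close>, and \<open>W\<close> is only linear in U. Young's inequality therefore
  absorbs U into half of the left side and leaves a bound quadratic in \<open>r\<close>.\<close>

lemma U_bound:
  assumes "0 \<le> t" "t \<le> T" and r: "\<And>u i. u \<in> {0..T} \<Longrightarrow> i \<in> {1..N} \<Longrightarrow> \<bar>B u i\<bar> \<le> r"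
    and i: "i \<in> {1..N}"
  shows "\<bar>U t i\<bar> \<le> path_const N \<nu> \<beta> a T * (1 + r)\<^sup>2"
proof -
  define Q where "Q = (\<Sum>i=1..N. (U t i)\<^sup>2)"
  define q where "q = (\<Sum>i=1..N. (a i)\<^sup>2)"
  define \<kappa> where "\<kappa> = generator_coeff N \<nu> \<beta> 1"
  define A where "A = (\<Sum>i=1..N. \<bar>a i\<bar>)"
  define M where "M = 4 * real N + 2"
  define W where "W = (\<Sum>i=1..N. \<bar>U t i\<bar> + \<bar>a i\<bar>)"
  define D where "D = M * (1 + r)"
  have r0: "r \<ge> 0" using r[of 0 1] N assms by (intro order_trans[OF abs_ge_zero]) auto
  have pos: "q \<ge> 0" "\<kappa> \<ge> 0" "A \<ge> 0" "M \<ge> 0" "D \<ge> 0"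
    using N \<nu> \<beta> r0 by (auto simp: q_def \<kappa>_def A_def M_def D_def generator_coeff_def sum_nonneg)
  have W0: "W \<ge> 0" by (auto simp: W_def sum_nonneg)
  note var = drift_variation_le[OF assms(1), folded W_def]
  have s: "(\<Sum>i=1..N. integral {0..t} (\<lambda>u. \<bar>b i u\<bar>)) \<le> real N * (2 * W)"
    using sum_bounded_above[of "{1..N}" "\<lambda>i. integral {0..t} (\<lambda>u. \<bar>b i u\<bar>)" "2 * W"] var(1) by simp
  have "Q \<le> q + \<kappa> * t + 2 * r * (\<Sum>i=1..N. integral {0..t} (\<lambda>u. \<bar>b i u\<bar>)) + (2 * r + 1) * L t"
    unfolding Q_def q_def \<kappa>_def by (rule energy_le) (use assms in auto)
  also have "\<dots> \<le> q + \<kappa> * T + 2 * r * (real N * (2 * W)) + (2 * r + 1) * W"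
    using s var(2) r0 pos assms by (intro add_mono mult_left_mono) auto
  also have "\<dots> \<le> q + \<kappa> * T + D * W"
  proof -
    \<comment> \<open>Origin of \<open>M\<close>: the coefficient 4Nr + 2r + 1 is at most (4N + 2)(1
      + r).\<close>
    have "(2 * r * (real N * 2) + (2 * r + 1)) * W \<le> D * W"
      using r0 W0 by (intro mult_right_mono) (auto simp: D_def M_def algebra_simps)
    then show ?thesis by (simp add: algebra_simps)
  qed
  also have "D * W = (\<Sum>i=1..N. D * \<bar>U t i\<bar>) + D * A"
    by (simp add: W_def A_def sum.distrib sum_distrib_left distrib_left)
  \<comment> \<open>Young's inequality; the squares add up to \<open>Q / 2\<close>, which moves to
    the left side.\<close>
  also have "(\<Sum>i=1..N. D * \<bar>U t i\<bar>) \<le> (\<Sum>i=1..N. (U t i)\<^sup>2 / 2 + D\<^sup>2 / 2)"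
  proof (rule sum_mono)
    fix i
    have "0 \<le> (D - \<bar>U t i\<bar>)\<^sup>2" by simp
    then show "D * \<bar>U t i\<bar> \<le> (U t i)\<^sup>2 / 2 + D\<^sup>2 / 2" by (simp add: power2_eq_square algebra_simps)
  qed
  also have "\<dots> = Q / 2 + real N * (D\<^sup>2 / 2)" by (simp add: Q_def sum.distrib sum_divide_distrib)
  finally have Q: "Q \<le> 2 * q + 2 * (\<kappa> * T) + real N * D\<^sup>2 + 2 * (D * A)" by simp
  have "(U t i)\<^sup>2 \<le> Q" unfolding Q_def by (rule member_le_sum) (use i in auto)
  moreover have "\<bar>U t i\<bar> \<le> 1 + (U t i)\<^sup>2"
    using zero_le_power2[of "\<bar>U t i\<bar> - 1"] zero_le_power2[of "U t i"] unfolding power2_diff by simp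
  ultimately have "\<bar>U t i\<bar> \<le> 1 + 2 * q + 2 * (\<kappa> * T) + real N * D\<^sup>2 + 2 * (D * A)" using Q by simp
  also have "\<dots> \<le> (1 + 2 * q + 2 * (\<kappa> * T)) * (1 + r)\<^sup>2 + real N * M\<^sup>2 * (1 + r)\<^sup>2 + 2 * (M * A) * (1 + r)\<^sup>2"
  proof (intro add_mono)
    have one: "1 \<le> (1 + r)\<^sup>2" using r0 by simp
    show "1 + 2 * q + 2 * (\<kappa> * T) \<le> (1 + 2 * q + 2 * (\<kappa> * T)) * (1 + r)\<^sup>2"
      using mult_left_mono[OF one, of "1 + 2 * q + 2 * (\<kappa> * T)"] pos assms by simp
    show "real N * D\<^sup>2 \<le> real N * M\<^sup>2 * (1 + r)\<^sup>2" by (simp add: D_def power_mult_distrib)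
    have "1 + r \<le> (1 + r)\<^sup>2" using r0 by (simp add: power2_eq_square algebra_simps)
    then have "2 * (M * A) * (1 + r) \<le> 2 * (M * A) * (1 + r)\<^sup>2" using pos by (intro mult_left_mono) auto
    then show "2 * (D * A) \<le> 2 * (M * A) * (1 + r)\<^sup>2" by (simp add: D_def mult_ac)
  qed
  also have "\<dots> = path_const N \<nu> \<beta> a T * (1 + r)\<^sup>2"
    unfolding path_const_def q_def[symmetric] \<kappa>_def[symmetric] A_def[symmetric] M_def[symmetric]
    by (simp only: distrib_right)
  finally show ?thesis .
qed

text \<open>A single quadratic polynomial in \<open>r\<close> dominates everything that enters the
  weights and the variations, so it has all moments as soon as \<open>r\<close> has.\<close>

lemma path_bounds:
  assumes T: "0 \<le> T" and r: "\<And>u i. u \<in> {0..T} \<Longrightarrow> i \<in> {1..N} \<Longrightarrow> \<bar>B u i\<bar> \<le> r"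
  defines "R \<equiv> path_bound N \<nu> \<beta> a T * (1 + r)\<^sup>2"
  shows "1 \<le> R" "T \<le> R" "L T \<le> R"
    and "i \<in> {1..N} \<Longrightarrow> integral {0..T} (\<lambda>u. \<bar>b i u\<bar>) \<le> R"
    and "i \<in> {1..N} \<Longrightarrow> u \<in> {0..T} \<Longrightarrow> \<bar>X u i\<bar> \<le> R"
    and "i \<in> {1..N} \<Longrightarrow> u \<in> {0..T} \<Longrightarrow> \<bar>B u i\<bar> \<le> R"
proof -
  define K where "K = path_const N \<nu> \<beta> a T"
  define A where "A = (\<Sum>i=1..N. \<bar>a i\<bar>)"
  define W where "W = (\<Sum>i=1..N. \<bar>U T i\<bar> + \<bar>a i\<bar>)"
  have r0: "r \<ge> 0" using r[of 0 1] N T by (intro order_trans[OF abs_ge_zero]) auto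
  have one: "1 \<le> (1 + r)\<^sup>2" using r0 by simp
  have A: "A \<ge> 0" by (simp add: A_def sum_nonneg)
  have K: "K \<ge> 1"
    using N \<nu> \<beta> T A unfolding K_def path_const_def A_def[symmetric] generator_coeff_def
    by (auto intro!: add_increasing2 sum_nonneg mult_nonneg_nonneg simp: add.assoc)
  have R: "R = (2 * (real N * (K + 1) + A) + 1 + T) * (1 + r)\<^sup>2"
    by (simp add: R_def path_bound_def K_def A_def)
  have le: "c * (1 + r)\<^sup>2 \<le> R" if "c \<le> 2 * (real N * (K + 1) + A) + 1 + T" for c
    unfolding R using that by (intro mult_right_mono) auto
  have NK: "K + 1 \<le> real N * (K + 1)" using N K by simp
  have KR: "K + 1 \<le> 2 * (real N * (K + 1) + A) + 1 + T"
  proof -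
    have "K + 1 \<le> 2 * (y + A) + 1 + T" if "K + 1 \<le> y" for y
      using that K A T unfolding distrib_left by linarith
    from this[OF NK] show ?thesis .
  qed
  have "1 * (1 + r)\<^sup>2 \<le> R" by (rule le) (use NK K A T in auto)
  with one show "1 \<le> R" by simp
  have "T * (1 + r)\<^sup>2 \<le> R" by (rule le) (use NK K A T in auto)
  moreover have "T \<le> T * (1 + r)\<^sup>2" using mult_left_mono[OF one T] by simp
  ultimately show "T \<le> R" by simp
  have U: "\<bar>U u i\<bar> \<le> K * (1 + r)\<^sup>2" if "u \<in> {0..T}" "i \<in> {1..N}" for u i
    unfolding K_def by (rule U_bound) (use that r in auto)
  have "W = (\<Sum>i=1..N. \<bar>U T i\<bar>) + A" by (simp add: W_def A_def sum.distrib)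
  also have "\<dots> \<le> real N * (K * (1 + r)\<^sup>2) + A * (1 + r)\<^sup>2"
    using sum_bounded_above[of "{1..N}" "\<lambda>i. \<bar>U T i\<bar>" "K * (1 + r)\<^sup>2"] U T mult_left_mono[OF one A]
    by (intro add_mono) auto
  finally have W: "2 * W \<le> (2 * (real N * K + A)) * (1 + r)\<^sup>2" by (simp add: algebra_simps)
  also have "\<dots> \<le> R" by (rule le) (use T in \<open>auto simp: algebra_simps\<close>)
  finally have WR: "2 * W \<le> R" .
  have "W \<ge> 0" by (auto simp: W_def sum_nonneg)
  then show "L T \<le> R" using drift_variation_le(2)[OF T, folded W_def] WR by linarith
  show "integral {0..T} (\<lambda>u. \<bar>b i u\<bar>) \<le> R" if "i \<in> {1..N}"
    using drift_variation_le(1)[OF T, folded W_def, OF that] WR by linarith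
  have "r \<le> 1 * (1 + r)\<^sup>2" using r0 by (simp add: power2_eq_square algebra_simps)
  then have rR: "r \<le> (1 + r)\<^sup>2" by simp
  show "\<bar>X u i\<bar> \<le> R" if "i \<in> {1..N}" "u \<in> {0..T}"
  proof -
    have "\<bar>X u i\<bar> \<le> \<bar>U u i\<bar> + \<bar>B u i\<bar>" by (simp add: U_def)
    also have "\<dots> \<le> K * (1 + r)\<^sup>2 + (1 + r)\<^sup>2" using U r that rR by fastforce
    also have "\<dots> = (K + 1) * (1 + r)\<^sup>2" by (simp add: algebra_simps)
    also have "\<dots> \<le> R" by (rule le[OF KR])
    finally show ?thesis .
  qed
  show "\<bar>B u i\<bar> \<le> R" if "i \<in> {1..N}" "u \<in> {0..T}"
    using r[OF that(2,1)] rR le[of 1] NK K A T by simp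
qed

section \<open>Compensated increments summed over a grid\<close>

definition drift_weight :: "nat \<Rightarrow> (real \<Rightarrow> real) \<Rightarrow> nat \<Rightarrow> real \<Rightarrow> real \<Rightarrow> real" where
  "drift_weight m c i v w = c w * (X w i + X v i + (B w i - B v i)) *
     esym ({1..N} - {i}) (m - 1) (\<lambda>l. if l < i then (X w l)\<^sup>2 else (X v l + (B w l - B v l))\<^sup>2)"

definition heat_weight :: "nat \<Rightarrow> (real \<Rightarrow> real) \<Rightarrow> nat \<Rightarrow> real \<Rightarrow> real \<Rightarrow> real" where
  "heat_weight m c i v w = c w *
     esym ({1..N} - {i}) (m - 1) (\<lambda>l. if l < i then (X v l)\<^sup>2 + (w - v) else (X v l)\<^sup>2)"

text \<open>The two weights are the slopes in \<open>esym_telescope\<close>. For the drift, X_w^2 -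
  (X_v + \<Delta>B)^2 factors into X_w + X_v + \<Delta>B times the increment of U; for the heat part
  each squared coordinate grows by w - v. The lengths w - v and the increments of \<open>c\<close>
  are also written as integrals, so that \<open>grid_sum_tendsto\<close> covers every term but the
  reflection.\<close>

lemma compensated_increment_eq:
  assumes m: "m > 0" and vw: "0 \<le> v" "v \<le> w"
    and c: "\<And>u. u \<in> {v..w} \<Longrightarrow> (c has_vector_derivative c' u) (at u within {v..w})"
  shows "compensated_increment N m c B X v w =
     (\<Sum>i=1..N. drift_weight m c i v w * integral {v..w} (b i)) + drift_weight m c N v w * (L w - L v)
     + (\<Sum>i=1..N. heat_weight m c i v w * integral {v..w} (\<lambda>_. 1))
     + esym {1..N} m (\<lambda>l. (X v l)\<^sup>2) * integral {v..w} c'"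
proof -
  let ?e = "\<lambda>f. esym {1..N} m f"
  have NN: "N \<in> {1..N}" using N by simp
  have "c w * (?e (\<lambda>l. (X w l)\<^sup>2) - ?e (\<lambda>l. (X v l + (B w l - B v l))\<^sup>2)) =
      (\<Sum>i=1..N. drift_weight m c i v w * (U w i - U v i))"
    unfolding esym_telescope[OF m] sum_distrib_left drift_weight_def U_def
    by (intro sum.cong refl) (simp add: power2_eq_square algebra_simps)
  also have "\<dots> = (\<Sum>i=1..N. drift_weight m c i v w * integral {v..w} (b i) +
      (if i = N then drift_weight m c N v w * (L w - L v) else 0))"
    by (intro sum.cong refl) (use U_increment[OF vw] in \<open>auto simp: distrib_left\<close>)
  also have "\<dots> = (\<Sum>i=1..N. drift_weight m c i v w * integral {v..w} (b i)) + drift_weight m c N v w * (L w - L v)"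
    using NN by (simp add: sum.distrib sum.delta)
  finally have 1: "c w * (?e (\<lambda>l. (X w l)\<^sup>2) - ?e (\<lambda>l. (X v l + (B w l - B v l))\<^sup>2)) = \<dots>" .
  have 2: "c w * (?e (\<lambda>l. (X v l)\<^sup>2 + (w - v)) - ?e (\<lambda>l. (X v l)\<^sup>2)) =
      (\<Sum>i=1..N. heat_weight m c i v w * integral {v..w} (\<lambda>_. 1))"
    unfolding esym_telescope[OF m] sum_distrib_left heat_weight_def
    by (intro sum.cong refl) (use vw in \<open>simp add: mult_ac\<close>)
  have 3: "integral {v..w} c' = c w - c v"
    using fundamental_theorem_of_calculus[OF vw(2) c] by (rule integral_unique)
  show ?thesis
    unfolding 1[symmetric] 2[symmetric] 3 compensated_increment_def by (simp add: algebra_simps)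
qed

lemma continuous_on_drift_weight:
  assumes "0 \<le> s" "continuous_on {s..t} c" "i \<in> {1..N}"
  shows "continuous_on ({s..t} \<times> {s..t}) (\<lambda>z. drift_weight m c i (fst z) (snd z))"
proof -
  have c: "continuous_on ({s..t} \<times> {s..t}) (\<lambda>z. c (snd z))"
    by (rule continuous_on_compose2[OF assms(2)]) (auto intro!: continuous_intros)
  have "continuous_on ({s..t} \<times> {s..t})
      (\<lambda>z. if l < i then (X (snd z) l)\<^sup>2 else (X (fst z) l + (B (snd z) l - B (fst z) l))\<^sup>2)"
    if "l \<in> {1..N}" for l
    by (cases "l < i") (use assms that in \<open>auto intro!: continuous_intros cont_on_square\<close>)
  then show ?thesis
    unfolding drift_weight_def
    by (intro continuous_on_mult continuous_on_esym continuous_on_add continuous_on_diff c cont_on_square assms) auto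
qed

lemma continuous_on_heat_weight:
  assumes "0 \<le> s" "continuous_on {s..t} c" "i \<in> {1..N}"
  shows "continuous_on ({s..t} \<times> {s..t}) (\<lambda>z. heat_weight m c i (fst z) (snd z))"
proof -
  have c: "continuous_on ({s..t} \<times> {s..t}) (\<lambda>z. c (snd z))"
    by (rule continuous_on_compose2[OF assms(2)]) (auto intro!: continuous_intros)
  have "continuous_on ({s..t} \<times> {s..t})
      (\<lambda>z. if l < i then (X (fst z) l)\<^sup>2 + (snd z - fst z) else (X (fst z) l)\<^sup>2)"
    if "l \<in> {1..N}" for l
    by (cases "l < i") (use assms that in \<open>auto intro!: continuous_intros cont_on_square\<close>)
  then show ?thesis
    unfolding heat_weight_def
    by (intro continuous_on_mult continuous_on_esym c) auto
qed

lemma compensated_sum_eq: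
  assumes m: "m > 0" and st: "0 \<le> s" "s \<le> t"
    and c: "\<And>u. u \<in> {s..t} \<Longrightarrow> (c has_vector_derivative c' u) (at u within {s..t})"
  defines "g \<equiv> grid s t"
  shows "(\<Sum>j<n. compensated_increment N m c B X (g n j) (g n (Suc j))) =
      (\<Sum>i=1..N. \<Sum>j<n. drift_weight m c i (g n j) (g n (Suc j)) * integral {g n j..g n (Suc j)} (b i))
      + (\<Sum>j<n. drift_weight m c N (g n j) (g n (Suc j)) * (L (g n (Suc j)) - L (g n j)))
      + (\<Sum>i=1..N. \<Sum>j<n. heat_weight m c i (g n j) (g n (Suc j)) * integral {g n j..g n (Suc j)} (\<lambda>_. 1))
      + (\<Sum>j<n. esym {1..N} m (\<lambda>l. (X (g n j) l)\<^sup>2) * integral {g n j..g n (Suc j)} c')"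
proof -
  have "(\<Sum>j<n. compensated_increment N m c B X (g n j) (g n (Suc j))) =
    (\<Sum>j<n. (\<Sum>i=1..N. drift_weight m c i (g n j) (g n (Suc j)) * integral {g n j..g n (Suc j)} (b i))
      + drift_weight m c N (g n j) (g n (Suc j)) * (L (g n (Suc j)) - L (g n j))
      + (\<Sum>i=1..N. heat_weight m c i (g n j) (g n (Suc j)) * integral {g n j..g n (Suc j)} (\<lambda>_. 1))
      + esym {1..N} m (\<lambda>l. (X (g n j) l)\<^sup>2) * integral {g n j..g n (Suc j)} c')"
  proof (intro sum.cong[OF refl] compensated_increment_eq[OF m])
    fix j assume j: "j \<in> {..<n}"
    show "0 \<le> g n j" "g n j \<le> g n (Suc j)"
      using st grid_ge[of s t n j] unfolding g_def by (auto intro: grid_mono)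
    fix u assume "u \<in> {g n j..g n (Suc j)}"
    moreover have "{g n j..g n (Suc j)} \<subseteq> {s..t}"
      using grid_step_mem(1)[OF st(2)] j unfolding g_def by blast
    ultimately show "(c has_vector_derivative c' u) (at u within {g n j..g n (Suc j)})"
      using c has_vector_derivative_within_subset by blast
  qed
  then show ?thesis
    unfolding sum.distrib by (subst (1 2) sum.swap) simp
qed

text \<open>The limit integrates time derivative plus generator applied to c(t) e_m(x^2). On the
  diagonal \<Delta>B is 0, so the drift weight becomes c times the partial derivative of e_m(x^2),
  and the heat weights sum to c times half its Laplacian.\<close>

lemma compensated_sum_tendsto:
  assumes m: "m > 0" and st: "0 \<le> s" "s \<le> t"
    and c: "\<And>u. u \<in> {s..t} \<Longrightarrow> (c has_vector_derivative c' u) (at u within {s..t})"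
    and c': "continuous_on {s..t} c'"
  shows "(\<lambda>n. \<Sum>j<n. compensated_increment N m c B X (grid s t n j) (grid s t n (Suc j))) \<longlonglongrightarrow>
    integral {s..t} (\<lambda>u. c u * ((generator_coeff N \<nu> \<beta> m + (real N - real m + 1)) * esym {1..N} (m - 1) (\<lambda>l. (X u l)\<^sup>2))
      + c' u * esym {1..N} m (\<lambda>l. (X u l)\<^sup>2))"
proof -
  let ?g = "grid s t"
  define E where "E u = esym {1..N} m (\<lambda>l. (X u l)\<^sup>2)" for u
  define E1 where "E1 u = esym {1..N} (m - 1) (\<lambda>l. (X u l)\<^sup>2)" for u
  have NN: "N \<in> {1..N}" using N by simp
  have cc: "continuous_on {s..t} c" by (rule continuous_on_vector_derivative[OF c])
  have X: "continuous_on {s..t} (\<lambda>u. X u i)" if "i \<in> {1..N}" for i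
    by (rule continuous_on_subset[OF cont_X[OF that]]) (use st in auto)
  have cE: "continuous_on {s..t} E" "continuous_on {s..t} E1"
    unfolding E_def E1_def by (intro continuous_intros X; simp)+
  have ci: "f absolutely_integrable_on {s..t}" if "continuous_on {s..t} f" for f :: "real \<Rightarrow> real"
    using that by (rule absolutely_integrable_continuous_real)
  define FA where "FA n = (\<Sum>i=1..N. \<Sum>j<n. drift_weight m c i (?g n j) (?g n (Suc j)) *
    integral {?g n j..?g n (Suc j)} (b i))" for n
  define FL where "FL n = (\<Sum>j<n. drift_weight m c N (?g n j) (?g n (Suc j)) * (L (?g n (Suc j)) - L (?g n j)))" for n
  define FH where "FH n = (\<Sum>i=1..N. \<Sum>j<n. heat_weight m c i (?g n j) (?g n (Suc j)) *
    integral {?g n j..?g n (Suc j)} (\<lambda>_. 1))" for n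
  define FC where "FC n = (\<Sum>j<n. E (?g n j) * integral {?g n j..?g n (Suc j)} c')" for n
  have eq: "(\<Sum>j<n. compensated_increment N m c B X (?g n j) (?g n (Suc j))) = FA n + FL n + FH n + FC n" for n
    unfolding FA_def FL_def FH_def FC_def E_def by (rule compensated_sum_eq[OF m st c])
  have A: "FA \<longlonglongrightarrow> (\<Sum>i=1..N. integral {s..t} (\<lambda>u. drift_weight m c i u u * b i u))"
    unfolding FA_def
    by (intro tendsto_sum grid_sum_tendsto continuous_on_drift_weight b_absolutely_integrable st cc)
  also have "(\<Sum>i=1..N. integral {s..t} (\<lambda>u. drift_weight m c i u u * b i u)) =
     integral {s..t} (\<lambda>u. c u * (generator_coeff N \<nu> \<beta> m * E1 u))"
  proof -
    have "(\<lambda>l. if l < i then (X u l)\<^sup>2 else (X u l + (B u l - B u l))\<^sup>2) = (\<lambda>l. (X u l)\<^sup>2)" for i :: nat and u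
      by auto
    then have "drift_weight m c i u u = c u * (2 * X u i) * esym ({1..N} - {i}) (m - 1) (\<lambda>l. (X u l)\<^sup>2)" for i u
      by (simp add: drift_weight_def)
    then show ?thesis using integral_generator[OF st(1) m cc] by (simp add: E1_def)
  qed
  finally have A: "FA \<longlonglongrightarrow> integral {s..t} (\<lambda>u. c u * (generator_coeff N \<nu> \<beta> m * E1 u))" .
  have H: "FH \<longlonglongrightarrow> (\<Sum>i=1..N. integral {s..t} (\<lambda>u. heat_weight m c i u u * 1))"
    unfolding FH_def
    by (intro tendsto_sum grid_sum_tendsto continuous_on_heat_weight ci st cc continuous_on_const)
  also have "(\<Sum>i=1..N. integral {s..t} (\<lambda>u. heat_weight m c i u u * 1)) =
      integral {s..t} (\<lambda>u. \<Sum>i=1..N. heat_weight m c i u u * 1)"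
    by (rule integral_sum[symmetric])
       (auto intro!: integrable_continuous_real continuous_on_diag[OF continuous_on_heat_weight] st cc)
  also have "(\<lambda>u. \<Sum>i=1..N. heat_weight m c i u u * 1) = (\<lambda>u. c u * ((real N - real m + 1) * E1 u))"
  proof -
    have "(\<lambda>l. if l < i then (X u l)\<^sup>2 + (u - u) else (X u l)\<^sup>2) = (\<lambda>l. (X u l)\<^sup>2)" for i :: nat and u
      by auto
    then show ?thesis
      using m by (simp add: heat_weight_def E1_def sum_distrib_left[symmetric] sum_esym_remove of_nat_diff algebra_simps)
  qed
  finally have H: "FH \<longlonglongrightarrow> integral {s..t} (\<lambda>u. c u * ((real N - real m + 1) * E1 u))" .
  have C: "FC \<longlonglongrightarrow> integral {s..t} (\<lambda>u. E u * c' u)"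
    unfolding FC_def
    by (intro grid_sum_tendsto[where P = "\<lambda>v w. E v"] st ci c' continuous_on_compose2[OF cE(1)])
       (auto intro!: continuous_intros)
  have Lm: "mono_on {s..t} L" using L_mono by (rule mono_on_subset) (use st in auto)
  \<comment> \<open>At a zero of X_N the diagonal weight carries the factor 2 X_N = 0, so the
    reflection bound applies with \<open>K = 0\<close> and every \<epsilon>.\<close>
  have FL: "FL \<longlonglongrightarrow> 0"
  proof (rule LIMSEQ_I, goal_cases)
    case (1 e)
    define \<epsilon> where "\<epsilon> = e / (L t - L s + 1)"
    have Lst: "L t - L s \<ge> 0" using mono_onD[OF Lm, of s t] st by simp
    have \<epsilon>: "\<epsilon> > 0" "\<epsilon> * (L t - L s) < e" using Lst 1 by (auto simp: \<epsilon>_def field_simps)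
    have "\<forall>\<^sub>F n in sequentially. \<bar>FL n\<bar> \<le> (0 + \<epsilon>) * (L t - L s)"
      unfolding FL_def
    proof (rule grid_sum_reflection_bound[OF st(2) continuous_on_drift_weight[OF st(1) cc NN] Lm,
          where Z = "\<lambda>u. X u N"])
      show "L v = L u" if "s \<le> u" "u \<le> v" "v \<le> t" "\<And>r. r \<in> {u..v} \<Longrightarrow> 0 < X r N" for u v
        using L_flat that st by force
      fix u assume u: "u \<in> {s..t}" "X u N \<le> 0"
      then have "X u N = 0" using weyl_chamber_B_nonneg[OF chamber NN, of u] st by auto
      then show "\<bar>drift_weight m c N u u\<bar> \<le> 0" by (simp add: drift_weight_def)
    qed (rule \<epsilon>)
    then have "\<forall>\<^sub>F n in sequentially. norm (FL n - 0) < e"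
      by (rule eventually_mono) (use \<epsilon> in auto)
    then show ?case by (simp add: eventually_sequentially)
  qed
  have "(\<lambda>n. FA n + FL n + FH n + FC n) \<longlonglongrightarrow> integral {s..t} (\<lambda>u. c u * (generator_coeff N \<nu> \<beta> m * E1 u)) + 0
     + integral {s..t} (\<lambda>u. c u * ((real N - real m + 1) * E1 u)) + integral {s..t} (\<lambda>u. E u * c' u)"
    by (intro tendsto_add A FL H C)
  also have "integral {s..t} (\<lambda>u. c u * (generator_coeff N \<nu> \<beta> m * E1 u)) + 0
     + integral {s..t} (\<lambda>u. c u * ((real N - real m + 1) * E1 u)) + integral {s..t} (\<lambda>u. E u * c' u)
     = integral {s..t} (\<lambda>u. c u * (generator_coeff N \<nu> \<beta> m * E1 u) + c u * ((real N - real m + 1) * E1 u)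
      + E u * c' u)"
    by (subst Henstock_Kurzweil_Integration.integral_add,
        (intro integrable_continuous_real continuous_intros cc cE c'; fail)+)
       (subst Henstock_Kurzweil_Integration.integral_add,
        (intro integrable_continuous_real continuous_intros cc cE c'; fail)+, simp)
  finally show ?thesis unfolding eq E_def E1_def by (simp add: algebra_simps)
qed

text \<open>The right side contains neither \<open>n\<close> nor the grid, so with a random
  \<open>R\<close> it serves as the dominating function. The inputs about \<open>R\<close> are the
  conclusions of \<open>path_bounds\<close>.\<close>

lemma compensated_sum_bound:
  assumes m: "m > 0" and st: "0 \<le> s" "s \<le> t" "t \<le> T" and n: "n > 0"
    and c: "\<And>u. u \<in> {s..t} \<Longrightarrow> (c has_vector_derivative c' u) (at u within {s..t})"
    and c': "continuous_on {s..t} c'"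
    and C: "\<And>u. u \<in> {s..t} \<Longrightarrow> \<bar>c u\<bar> \<le> C" "\<And>u. u \<in> {s..t} \<Longrightarrow> \<bar>c' u\<bar> \<le> C"
    and R: "1 \<le> R" "T \<le> R" "L T \<le> R"
      "\<And>i. i \<in> {1..N} \<Longrightarrow> integral {0..T} (\<lambda>u. \<bar>b i u\<bar>) \<le> R"
      "\<And>i u. i \<in> {1..N} \<Longrightarrow> u \<in> {0..T} \<Longrightarrow> \<bar>X u i\<bar> \<le> R"
      "\<And>i u. i \<in> {1..N} \<Longrightarrow> u \<in> {0..T} \<Longrightarrow> \<bar>B u i\<bar> \<le> R"
  shows "\<bar>\<Sum>j<n. compensated_increment N m c B X (grid s t n j) (grid s t n (Suc j))\<bar>
    \<le> (5 * real N + 5) * C * 18 ^ N * R ^ (2 * N + 2)"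
proof -
  let ?g = "grid s t n"
  have NN: "N \<in> {1..N}" using N by simp
  have cc: "continuous_on {s..t} c" by (rule continuous_on_vector_derivative[OF c])
  have C0: "C \<ge> 0" using C(1)[of s] st by (intro order_trans[OF abs_ge_zero]) auto
  \<comment> \<open>There are at most 2^N subsets, and every variable is at most (3R)^2 = 9 R^2; the
    3 comes from |X_v + \<Delta>B| being at most R + 2R.\<close>
  define Y where "Y = 18 ^ N * R ^ (2 * N)"
  have Y0: "Y \<ge> 0" using R(1) by (simp add: Y_def)
  have gin: "?g j \<in> {s..t}" "?g j \<in> {0..T}" if "j \<le> n" for j
    using grid_ge[of s t n j] grid_le[of s t j n] that st by auto
  have gle: "?g j \<le> ?g (Suc j)" for j using st by (intro grid_mono) auto
  have Y: "\<bar>esym A q f\<bar> \<le> Y" if A: "A \<subseteq> {1..N}" and f: "\<And>l. l \<in> {1..N} \<Longrightarrow> \<bar>f l\<bar> \<le> 9 * R\<^sup>2" for A q f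
  proof -
    have fin: "finite A" "card A \<le> N" using A finite_subset card_mono[OF _ A] by auto
    have R2: "1 \<le> 9 * R\<^sup>2" using one_le_power[OF R(1), of 2] by linarith
    have "\<bar>esym A q f\<bar> \<le> 2 ^ card A * (9 * R\<^sup>2) ^ card A"
      by (rule abs_esym_le) (use fin A f R2 in auto)
    also have "\<dots> \<le> 2 ^ N * (9 * R\<^sup>2) ^ N"
      by (intro mult_mono power_increasing) (use fin R2 in auto)
    also have "\<dots> = (2 * 9) ^ N * (R\<^sup>2) ^ N" by (simp only: power_mult_distrib mult.assoc)
    also have "\<dots> = Y" unfolding Y_def power_mult by simp
    finally show ?thesis .
  qed
  have sq: "\<bar>z\<^sup>2\<bar> \<le> 9 * R\<^sup>2" if "\<bar>z\<bar> \<le> 3 * R" for z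
    using power_mono[OF that, of 2] by (simp add: power_mult_distrib)
  have RR: "R \<le> R\<^sup>2" using R(1) by (simp add: power2_eq_square)
  have X1: "\<bar>X v l\<bar> \<le> R" if "l \<in> {1..N}" "v \<in> {0..T}" for l v using R(5) that .
  have DB: "\<bar>B w l - B v l\<bar> \<le> 2 * R" if "l \<in> {1..N}" "v \<in> {0..T}" "w \<in> {0..T}" for l v w
    using R(6)[OF that(1,2)] R(6)[OF that(1,3)] by linarith
  have A: "\<bar>drift_weight m c i (?g j) (?g (Suc j))\<bar> \<le> C * (4 * R) * Y" if i: "i \<in> {1..N}" and j: "j < n" for i j
    unfolding drift_weight_def abs_mult
  proof (intro mult_mono Y)
    have g: "?g j \<in> {0..T}" "?g (Suc j) \<in> {0..T}" using gin[of j] gin[of "Suc j"] j by auto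
    show "\<bar>c (?g (Suc j))\<bar> \<le> C" using C(1) gin[of "Suc j"] j by simp
    show "\<bar>X (?g (Suc j)) i + X (?g j) i + (B (?g (Suc j)) i - B (?g j) i)\<bar> \<le> 4 * R"
      using X1[OF i g(1)] X1[OF i g(2)] DB[OF i g] by linarith
    fix l assume l: "l \<in> {1..N}"
    have "\<bar>X (?g (Suc j)) l\<bar> \<le> 3 * R" using X1[OF l g(2)] R(1) by linarith
    moreover have "\<bar>X (?g j) l + (B (?g (Suc j)) l - B (?g j) l)\<bar> \<le> 3 * R"
      using X1[OF l g(1)] DB[OF l g] by linarith
    ultimately show "\<bar>if l < i then (X (?g (Suc j)) l)\<^sup>2 else (X (?g j) l + (B (?g (Suc j)) l - B (?g j) l))\<^sup>2\<bar> \<le> 9 * R\<^sup>2"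
      using sq by simp
  qed (use C0 R(1) in auto)
  have H: "\<bar>heat_weight m c i (?g j) (?g (Suc j))\<bar> \<le> C * Y" if i: "i \<in> {1..N}" and j: "j < n" for i j
    unfolding heat_weight_def abs_mult
  proof (intro mult_mono Y)
    have g: "?g j \<in> {0..T}" "?g (Suc j) \<in> {0..T}" using gin[of j] gin[of "Suc j"] j by auto
    show "\<bar>c (?g (Suc j))\<bar> \<le> C" using C(1) gin[of "Suc j"] j by simp
    fix l assume l: "l \<in> {1..N}"
    have "(X (?g j) l)\<^sup>2 \<le> R\<^sup>2" using power_mono[OF X1[OF l g(1)], of 2] by simp
    moreover have "?g (Suc j) - ?g j \<le> R\<^sup>2" using g R(2) RR by auto
    ultimately have "\<bar>(X (?g j) l)\<^sup>2 + (?g (Suc j) - ?g j)\<bar> \<le> 9 * R\<^sup>2" "\<bar>(X (?g j) l)\<^sup>2\<bar> \<le> 9 * R\<^sup>2"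
      using gle[of j] zero_le_power2[of "X (?g j) l"] zero_le_power2[of R] by linarith+
    then show "\<bar>if l < i then (X (?g j) l)\<^sup>2 + (?g (Suc j) - ?g j) else (X (?g j) l)\<^sup>2\<bar> \<le> 9 * R\<^sup>2" by simp
  qed (use C0 in auto)
  have E: "\<bar>esym {1..N} m (\<lambda>l. (X (?g j) l)\<^sup>2)\<bar> \<le> Y" if j: "j < n" for j
  proof (rule Y)
    fix l assume l: "l \<in> {1..N}"
    show "\<bar>(X (?g j) l)\<^sup>2\<bar> \<le> 9 * R\<^sup>2"
      by (rule sq) (use X1[OF l, of "?g j"] gin[of j] j R(1) in auto)
  qed simp
  have ab: "integral {s..t} (\<lambda>u. \<bar>b i u\<bar>) \<le> R" if "i \<in> {1..N}" for i
    using integral_subset_le[of "{s..t}" "{0..T}" "\<lambda>u. \<bar>b i u\<bar>"] b_integrable(2)[OF _ that] R(4)[OF that] st by force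
  have LL: "L t - L s \<le> R"
    using mono_onD[OF L_mono, of t T] L_nonneg[of s] st R(3) by auto
  have tR: "t - s \<le> R" using st R(2) by linarith
  have Lm: "mono_on {s..t} L" using L_mono by (rule mono_on_subset) (use st in auto)
  have 1: "\<bar>\<Sum>i=1..N. \<Sum>j<n. drift_weight m c i (?g j) (?g (Suc j)) * integral {?g j..?g (Suc j)} (b i)\<bar>
      \<le> real N * (C * (4 * R) * Y * R)"
  proof -
    have "\<bar>\<Sum>i=1..N. \<Sum>j<n. drift_weight m c i (?g j) (?g (Suc j)) * integral {?g j..?g (Suc j)} (b i)\<bar>
      \<le> (\<Sum>i=1..N. C * (4 * R) * Y * R)"
    proof (rule sum_abs[THEN order_trans], rule sum_mono)
      fix i assume i: "i \<in> {1..N}"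
      have "\<bar>\<Sum>j<n. drift_weight m c i (?g j) (?g (Suc j)) * integral {?g j..?g (Suc j)} (b i)\<bar>
          \<le> C * (4 * R) * Y * integral {s..t} (\<lambda>u. \<bar>b i u\<bar>)"
        by (intro abs_grid_sum_le st n b_absolutely_integrable i A)
      also have "\<dots> \<le> C * (4 * R) * Y * R"
        by (intro mult_left_mono ab i) (use C0 R(1) Y0 in auto)
      finally show "\<bar>\<Sum>j<n. drift_weight m c i (?g j) (?g (Suc j)) * integral {?g j..?g (Suc j)} (b i)\<bar>
          \<le> C * (4 * R) * Y * R" .
    qed
    then show ?thesis by simp
  qed
  have 2: "\<bar>\<Sum>j<n. drift_weight m c N (?g j) (?g (Suc j)) * (L (?g (Suc j)) - L (?g j))\<bar> \<le> C * (4 * R) * Y * R"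
  proof -
    have "\<bar>\<Sum>j<n. drift_weight m c N (?g j) (?g (Suc j)) * (L (?g (Suc j)) - L (?g j))\<bar> \<le> C * (4 * R) * Y * (L t - L s)"
      by (intro abs_grid_sum_mono_le st n Lm A NN)
    also have "\<dots> \<le> C * (4 * R) * Y * R"
      by (intro mult_left_mono LL) (use C0 R(1) Y0 in auto)
    finally show ?thesis .
  qed
  have 3: "\<bar>\<Sum>i=1..N. \<Sum>j<n. heat_weight m c i (?g j) (?g (Suc j)) * integral {?g j..?g (Suc j)} (\<lambda>_. 1)\<bar>
      \<le> real N * (C * Y * R)"
  proof -
    have "\<bar>\<Sum>i=1..N. \<Sum>j<n. heat_weight m c i (?g j) (?g (Suc j)) * integral {?g j..?g (Suc j)} (\<lambda>_. 1)\<bar>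
      \<le> (\<Sum>i=1..N. C * Y * R)"
    proof (rule sum_abs[THEN order_trans], rule sum_mono)
      fix i assume i: "i \<in> {1..N}"
      have "\<bar>\<Sum>j<n. heat_weight m c i (?g j) (?g (Suc j)) * integral {?g j..?g (Suc j)} (\<lambda>_. 1)\<bar>
          \<le> C * Y * integral {s..t} (\<lambda>u. \<bar>1\<bar>)"
        by (intro abs_grid_sum_le st n absolutely_integrable_continuous_real continuous_on_const H i)
      also have "\<dots> \<le> C * Y * R"
        by (intro mult_left_mono) (use C0 Y0 st tR in auto)
      finally show "\<bar>\<Sum>j<n. heat_weight m c i (?g j) (?g (Suc j)) * integral {?g j..?g (Suc j)} (\<lambda>_. 1)\<bar> \<le> C * Y * R" .
    qed
    then show ?thesis by simp
  qed
  have 4: "\<bar>\<Sum>j<n. esym {1..N} m (\<lambda>l. (X (?g j) l)\<^sup>2) * integral {?g j..?g (Suc j)} c'\<bar> \<le> Y * (C * R)"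
  proof -
    have "\<bar>\<Sum>j<n. esym {1..N} m (\<lambda>l. (X (?g j) l)\<^sup>2) * integral {?g j..?g (Suc j)} c'\<bar>
        \<le> Y * integral {s..t} (\<lambda>u. \<bar>c' u\<bar>)"
      by (intro abs_grid_sum_le st n absolutely_integrable_continuous_real c' E)
    also have "integral {s..t} (\<lambda>u. \<bar>c' u\<bar>) \<le> integral {s..t} (\<lambda>u. C)"
      by (intro integral_le integrable_continuous_real continuous_intros c' C)
    also have "\<dots> \<le> C * R" using st tR C0 by (auto simp: mult.commute[of _ C] intro!: mult_left_mono)
    finally show ?thesis using Y0 by (simp add: mult_left_mono)
  qed
  have "\<bar>\<Sum>j<n. compensated_increment N m c B X (?g j) (?g (Suc j))\<bar> \<le>
      real N * (C * (4 * R) * Y * R) + C * (4 * R) * Y * R + real N * (C * Y * R) + Y * (C * R)"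
    by (subst compensated_sum_eq[OF m st(1,2) c]; (assumption | use 1 2 3 4 in linarith))
  \<comment> \<open>Since R is at most R^2, all four terms reach the power R^(2N+2). Their
    coefficients add up to 4N + 4 + N + 1 = 5N + 5.\<close>
  also have "\<dots> \<le> real N * (C * (4 * R) * Y * R) + C * (4 * R) * Y * R + real N * (C * Y * R\<^sup>2) + Y * (C * R\<^sup>2)"
    by (intro add_mono mult_left_mono order_refl RR) (use C0 Y0 in auto)
  also have "\<dots> = (5 * real N + 5) * C * 18 ^ N * R ^ (2 * N + 2)"
    by (simp add: Y_def power_add power2_eq_square algebra_simps)
  finally show ?thesis .
qed

end

section \<open>Random variables with all moments and maximal inequalities\<close>

text \<open>Unlike integrability, this class is closed under products, so polynomials in its members
  are integrable without any bookkeeping of exponents.\<close>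

definition all_moments :: "'a measure \<Rightarrow> ('a \<Rightarrow> real) \<Rightarrow> bool" where
  "all_moments M f \<longleftrightarrow> f \<in> borel_measurable M \<and> (\<forall>p::nat. integrable M (\<lambda>\<omega>. \<bar>f \<omega>\<bar> ^ p))"

lemma all_moments_measurable: "all_moments M f \<Longrightarrow> f \<in> borel_measurable M"
  by (simp add: all_moments_def)

lemma all_moments_integrable:
  assumes "all_moments M f"
  shows "integrable M f"
proof -
  have "integrable M (\<lambda>\<omega>. \<bar>f \<omega>\<bar> ^ 1)" using assms by (simp only: all_moments_def)
  then have "integrable M (\<lambda>\<omega>. \<bar>f \<omega>\<bar>)" by simp
  then show ?thesis by (rule integrable_abs_cancel) (rule all_moments_measurable[OF assms])
qed

lemma all_moments_bound:
  assumes g: "all_moments M g" and [measurable]: "f \<in> borel_measurable M"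
    and le: "AE \<omega> in M. \<bar>f \<omega>\<bar> \<le> g \<omega>"
  shows "all_moments M f"
  unfolding all_moments_def
proof (intro conjI allI)
  fix p :: nat
  have "integrable M (\<lambda>\<omega>. \<bar>g \<omega>\<bar> ^ p)" using g by (simp add: all_moments_def)
  then show "integrable M (\<lambda>\<omega>. \<bar>f \<omega>\<bar> ^ p)"
  proof (rule Bochner_Integration.integrable_bound)
    show "AE \<omega> in M. norm (\<bar>f \<omega>\<bar> ^ p) \<le> norm (\<bar>g \<omega>\<bar> ^ p)"
      using le by eventually_elim (auto intro!: power_mono)
  qed simp
qed simp

text \<open>The inequality 2ab \<le> a^2 + b^2 stands in for Hoelder's: moments of order 2p of the
  factors control the moment of order p of the product.\<close>

lemma all_moments_mult:
  assumes f: "all_moments M f" and g: "all_moments M g"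
  shows "all_moments M (\<lambda>\<omega>. f \<omega> * g \<omega>)"
  unfolding all_moments_def
proof (intro conjI allI)
  have [measurable]: "f \<in> borel_measurable M" "g \<in> borel_measurable M" using f g by (auto simp: all_moments_def)
  show "(\<lambda>\<omega>. f \<omega> * g \<omega>) \<in> borel_measurable M" by simp
  fix p :: nat
  have "integrable M (\<lambda>\<omega>. \<bar>f \<omega>\<bar> ^ (2 * p) + \<bar>g \<omega>\<bar> ^ (2 * p))"
    using f g by (intro Bochner_Integration.integrable_add) (auto simp: all_moments_def)
  then show "integrable M (\<lambda>\<omega>. \<bar>f \<omega> * g \<omega>\<bar> ^ p)"
  proof (rule Bochner_Integration.integrable_bound)
    have "\<bar>f \<omega> * g \<omega>\<bar> ^ p \<le> \<bar>f \<omega>\<bar> ^ (2 * p) + \<bar>g \<omega>\<bar> ^ (2 * p)" for \<omega>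
    proof -
      have "0 \<le> (\<bar>f \<omega>\<bar> ^ p - \<bar>g \<omega>\<bar> ^ p)\<^sup>2" by simp
      then have "2 * (\<bar>f \<omega>\<bar> ^ p * \<bar>g \<omega>\<bar> ^ p) \<le> (\<bar>f \<omega>\<bar> ^ p)\<^sup>2 + (\<bar>g \<omega>\<bar> ^ p)\<^sup>2"
        unfolding power2_diff by linarith
      moreover have "0 \<le> \<bar>f \<omega>\<bar> ^ p * \<bar>g \<omega>\<bar> ^ p" by simp
      ultimately show ?thesis
        unfolding abs_mult power_mult_distrib power_even_eq by linarith
    qed
    then show "AE \<omega> in M. norm (\<bar>f \<omega> * g \<omega>\<bar> ^ p) \<le> norm (\<bar>f \<omega>\<bar> ^ (2 * p) + \<bar>g \<omega>\<bar> ^ (2 * p))"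
      by (intro AE_I2) simp
  qed simp
qed

lemma all_moments_add:
  assumes f: "all_moments M f" and g: "all_moments M g"
  shows "all_moments M (\<lambda>\<omega>. f \<omega> + g \<omega>)"
  unfolding all_moments_def
proof (intro conjI allI)
  have [measurable]: "f \<in> borel_measurable M" "g \<in> borel_measurable M" using f g by (auto simp: all_moments_def)
  show "(\<lambda>\<omega>. f \<omega> + g \<omega>) \<in> borel_measurable M" by simp
  fix p :: nat
  have "integrable M (\<lambda>\<omega>. 2 ^ p * \<bar>f \<omega>\<bar> ^ p + 2 ^ p * \<bar>g \<omega>\<bar> ^ p)"
    using f g by (intro Bochner_Integration.integrable_add integrable_mult_right) (auto simp: all_moments_def)
  then show "integrable M (\<lambda>\<omega>. \<bar>f \<omega> + g \<omega>\<bar> ^ p)"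
  proof (rule Bochner_Integration.integrable_bound)
    have "\<bar>f \<omega> + g \<omega>\<bar> ^ p \<le> 2 ^ p * \<bar>f \<omega>\<bar> ^ p + 2 ^ p * \<bar>g \<omega>\<bar> ^ p" for \<omega>
    proof -
      have "\<bar>f \<omega> + g \<omega>\<bar> ^ p \<le> (2 * max \<bar>f \<omega>\<bar> \<bar>g \<omega>\<bar>) ^ p" by (rule power_mono) auto
      also have "\<dots> = 2 ^ p * max \<bar>f \<omega>\<bar> \<bar>g \<omega>\<bar> ^ p" by (rule power_mult_distrib)
      also have "\<dots> \<le> 2 ^ p * \<bar>f \<omega>\<bar> ^ p + 2 ^ p * \<bar>g \<omega>\<bar> ^ p"
        by (cases "\<bar>f \<omega>\<bar> \<le> \<bar>g \<omega>\<bar>") (auto simp: max_def)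
      finally show ?thesis .
    qed
    then show "AE \<omega> in M. norm (\<bar>f \<omega> + g \<omega>\<bar> ^ p) \<le> norm (2 ^ p * \<bar>f \<omega>\<bar> ^ p + 2 ^ p * \<bar>g \<omega>\<bar> ^ p)"
      by (intro AE_I2) simp
  qed simp
qed

lemma (in prob_space) all_moments_const: "all_moments M (\<lambda>\<omega>. c)"
  by (simp add: all_moments_def)

lemma all_moments_uminus: "all_moments M f \<Longrightarrow> all_moments M (\<lambda>\<omega>. - f \<omega>)"
  by (simp add: all_moments_def)

lemma all_moments_diff:
  "all_moments M f \<Longrightarrow> all_moments M g \<Longrightarrow> all_moments M (\<lambda>\<omega>. f \<omega> - g \<omega>)"
  using all_moments_add[OF _ all_moments_uminus] by fastforce

lemma (in prob_space) all_moments_power: "all_moments M f \<Longrightarrow> all_moments M (\<lambda>\<omega>. f \<omega> ^ n)"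
  by (induction n) (auto intro: all_moments_mult all_moments_const)

lemma (in prob_space) all_moments_sum:
  "(\<And>i. i \<in> I \<Longrightarrow> all_moments M (f i)) \<Longrightarrow> all_moments M (\<lambda>\<omega>. \<Sum>i\<in>I. f i \<omega>)"
  by (induction I rule: infinite_finite_induct) (auto intro: all_moments_add all_moments_const)

lemma (in prob_space) all_moments_prod:
  "(\<And>i. i \<in> I \<Longrightarrow> all_moments M (f i)) \<Longrightarrow> all_moments M (\<lambda>\<omega>. \<Prod>i\<in>I. f i \<omega>)"
  by (induction I rule: infinite_finite_induct) (auto intro: all_moments_mult all_moments_const)

lemma (in prob_space) all_moments_indicator: "A \<in> sets M \<Longrightarrow> all_moments M (indicator A)"
  by (rule all_moments_bound[OF all_moments_const[of 1]]) (auto simp: indicator_def)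

lemmas (in prob_space) all_moments_intros =
  all_moments_mult all_moments_add all_moments_diff all_moments_uminus all_moments_const
  all_moments_power all_moments_sum all_moments_prod

lemma (in prob_space) all_moments_esym:
  "(\<And>i. i \<in> A \<Longrightarrow> all_moments M (\<lambda>\<omega>. f \<omega> i)) \<Longrightarrow> all_moments M (\<lambda>\<omega>. esym A k (f \<omega>))"
  unfolding esym_def by (intro all_moments_sum all_moments_prod) auto

text \<open>For a submartingale \<open>z\<close> the sum has nonnegative mean, which gives \<open>E m\<^sup>2 \<le> 4 E z\<^sup>2\<close>.\<close>

lemma running_max_transform:
  fixes z :: "nat \<Rightarrow> real"
  assumes "\<And>j. 0 \<le> z j"
  defines "m \<equiv> \<lambda>n. Max (z ` {..n})"
  shows "(m n)\<^sup>2 / 2 + (\<Sum>j<n. m j * (z (Suc j) - z j)) \<le> m n * z n"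
proof (induction n)
  case 0
  show ?case using assms(1)[of 0] by (simp add: m_def power2_eq_square)
next
  case (Suc n)
  have m: "m (Suc n) = max (z (Suc n)) (m n)"
    unfolding m_def atMost_Suc image_insert by (subst Max_insert) auto
  show ?case
  proof (cases "z (Suc n) \<le> m n")
    case True
    with Suc show ?thesis by (simp add: m algebra_simps)
  next
    case False
    \<comment> \<open>A new maximum: now \<open>m (Suc n) = z (Suc n)\<close>, and the induction
      hypothesis closes once the mixed product is split into two half squares.\<close>
    have "0 \<le> (m n - z (Suc n))\<^sup>2" by simp
    then have "m n * z (Suc n) \<le> (m n)\<^sup>2 / 2 + (z (Suc n))\<^sup>2 / 2"
      by (simp add: power2_eq_square algebra_simps)
    with Suc False show ?thesis by (simp add: m max_def power2_eq_square algebra_simps)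
  qed
qed

text \<open>The tangent line lies below the convex function x^(2q), by Bernoulli's inequality for
  x/y. With \<open>y\<close> the present and \<open>x\<close> the next value, this is how even
  powers of a martingale become a submartingale.\<close>

lemma even_power_tangent:
  fixes x y :: real
  assumes "q > 0"
  shows "x ^ (2 * q) \<ge> y ^ (2 * q) + 2 * real q * y ^ (2 * q - 1) * (x - y)"
proof (cases "y = 0")
  case False
  have "1 + real (2 * q) * (x / y - 1) \<le> (1 + (x / y - 1)) ^ (2 * q)"
    by (rule Bernoulli_inequality_even) simp
  then have "y ^ (2 * q) * (1 + real (2 * q) * (x / y - 1)) \<le> y ^ (2 * q) * (x / y) ^ (2 * q)"
    by (intro mult_left_mono) auto
  also have "\<dots> = x ^ (2 * q)" using False by (simp add: power_divide)
  finally have "y ^ (2 * q) + 2 * real q * (y ^ (2 * q) * (x / y - 1)) \<le> x ^ (2 * q)"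
    by (simp add: algebra_simps)
  moreover have "y ^ (2 * q) = y ^ (2 * q - 1) * y" using assms by (simp add: power_eq_if[of y "2 * q"])
  then have "y ^ (2 * q) * (x / y - 1) = y ^ (2 * q - 1) * (x - y)" using False by (simp add: field_simps)
  ultimately show ?thesis by (simp add: mult.assoc)
qed (use assms in \<open>simp add: power_0_left\<close>)

section \<open>Brownian motion and its increments in one component\<close>

locale brownian = prob_space M for M :: "'a measure" +
  fixes N :: nat and B :: "real \<Rightarrow> 'a \<Rightarrow> nat \<Rightarrow> real"
  assumes brownian: "brownian_motion M N B"
begin

lemma standard_component: "i \<in> {1..N} \<Longrightarrow> standard_brownian_motion M (\<lambda>t \<omega>. B t \<omega> i)"
  using brownian by (simp add: brownian_motion_def)

lemma B_measurable: "i \<in> {1..N} \<Longrightarrow> 0 \<le> t \<Longrightarrow> (\<lambda>\<omega>. B t \<omega> i) \<in> borel_measurable M"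
  using standard_component by (auto simp: standard_brownian_motion_def)

lemma AE_B_0: "i \<in> {1..N} \<Longrightarrow> AE \<omega> in M. B 0 \<omega> i = 0"
  using standard_component by (auto simp: standard_brownian_motion_def)

lemma AE_continuous_B: "i \<in> {1..N} \<Longrightarrow> AE \<omega> in M. continuous_on {0..} (\<lambda>t. B t \<omega> i)"
  using standard_component by (auto simp: standard_brownian_motion_def)

text \<open>Independence is given only for consecutive increments along an ordered list of times.
  Sorting the past times, with 0 in front and \<open>t\<close>, \<open>t'\<close> at the end, makes
  each past value a partial sum of earlier increments, while the increment over [t, t'] is the last
  one.\<close>

lemma increment_indep_finite:
  assumes i: "i \<in> {1..N}" and t: "0 \<le> t" "t \<le> t'" and J: "finite J" "J \<subseteq> {0..t}"
    and A: "\<And>u. A u \<in> sets borel" and C: "C \<in> sets borel"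
  shows "prob {\<omega> \<in> space M. (\<forall>u\<in>J. B u \<omega> i \<in> A u) \<and> B t' \<omega> i - B t \<omega> i \<in> C} =
    prob {\<omega> \<in> space M. \<forall>u\<in>J. B u \<omega> i \<in> A u} * prob {\<omega> \<in> space M. B t' \<omega> i - B t \<omega> i \<in> C}"
proof -
  define xs where "xs = sorted_list_of_set (insert 0 J)"
  define n where "n = length xs"
  \<comment> \<open>Positions below \<open>n\<close> are the sorted past times, position
    \<open>n\<close> is \<open>t\<close>, and all later ones are \<open>t'\<close>. Hence
    \<open>\<Delta> n\<close> is the increment in question and the past involves only
    \<open>\<Delta> j\<close> with \<open>j < n\<close>.\<close>
  define \<tau> where "\<tau> j = (if j < n then xs ! j else if j = n then t else t')" for j
  define \<Delta> where "\<Delta> = (\<lambda>j \<omega>. B (\<tau> (Suc j)) \<omega> i - B (\<tau> j) \<omega> i)"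
  have xs: "set xs = insert 0 J" "sorted xs"
    unfolding xs_def using J(1) set_sorted_list_of_set[of "insert 0 J"] by (simp_all only: finite_insert sorted_sorted_list_of_set)
  have n0: "n > 0" using xs by (auto simp: n_def)
  have xs0: "xs ! 0 = 0"
  proof -
    obtain k where k: "k < n" "xs ! k = 0" using xs(1) unfolding n_def by (metis in_set_conv_nth insertI1)
    have "xs ! 0 \<le> xs ! k" using xs(2) k by (intro sorted_nth_mono) (auto simp: n_def)
    moreover have "xs ! 0 \<in> insert 0 J" using n0 xs(1) nth_mem[of 0 xs] by (simp add: n_def)
    ultimately show ?thesis using k J(2) by auto
  qed
  have xs_mem: "xs ! j \<in> {0..t}" if "j < n" for j
    using that xs(1) J(2) t nth_mem[of j xs] by (auto simp: n_def)
  have \<tau>_mono: "\<tau> j \<le> \<tau> (Suc j)" if "j < Suc n" for j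
    using that xs_mem[of j] t sorted_nth_mono[OF xs(2), of j "Suc j"] by (auto simp: \<tau>_def n_def)
  have \<tau>_0: "\<tau> 0 = 0" using xs0 n0 by (simp add: \<tau>_def)
  have \<tau>_nonneg: "0 \<le> \<tau> j" for j using xs_mem[of j] t by (auto simp: \<tau>_def)
  have ind: "indep_vars (\<lambda>_. borel) \<Delta> {..<Suc n}"
  proof -
    have *: "0 \<le> \<tau> 0 \<and> (\<forall>j<n. \<tau> j \<le> \<tau> (Suc j)) \<longrightarrow>
        indep_vars (\<lambda>_. borel) (\<lambda>j \<omega>. B (\<tau> (Suc j)) \<omega> i - B (\<tau> j) \<omega> i) {..<n}" for n and \<tau> :: "nat \<Rightarrow> real"
      using standard_component[OF i] by (simp add: standard_brownian_motion_def)
    show ?thesis unfolding \<Delta>_def by (rule *[of \<tau> "Suc n", rule_format]) (use \<tau>_mono \<tau>_0 in auto)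
  qed
  define k where "k u = (SOME k. k < n \<and> xs ! k = u)" for u
  have k: "k u < n \<and> xs ! (k u) = u" if "u \<in> J" for u
  proof -
    have "u \<in> set xs" using that xs(1) by simp
    then have "\<exists>k. k < n \<and> xs ! k = u" by (simp add: in_set_conv_nth n_def)
    then show ?thesis unfolding k_def by (rule someI_ex)
  qed
  have tel: "B u \<omega> i = (\<Sum>j<k u. \<Delta> j \<omega>)" if "u \<in> J" "B 0 \<omega> i = 0" for u \<omega>
  proof -
    have "(\<Sum>j<k u. \<Delta> j \<omega>) = B (\<tau> (k u)) \<omega> i - B (\<tau> 0) \<omega> i"
      unfolding \<Delta>_def by (rule sum_lessThan_telescope)
    then show ?thesis using k[OF that(1)] that(2) \<tau>_0 by (simp add: \<tau>_def)
  qed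
  let ?P1 = "Pi\<^sub>M {..<n} (\<lambda>_. borel :: real measure)" and ?P2 = "Pi\<^sub>M {n} (\<lambda>_. borel :: real measure)"
  define S1 where "S1 = {f \<in> space ?P1. \<forall>u\<in>J. (\<Sum>j<k u. f j) \<in> A u}"
  define S2 where "S2 = {f \<in> space ?P2. f n \<in> C}"
  have S1: "S1 \<in> sets ?P1"
    unfolding S1_def
  proof (rule sets.sets_Collect_finite_All[OF _ J(1)])
    fix u assume "u \<in> J"
    then have ku: "k u < n" using k by auto
    then have "(\<lambda>f. \<Sum>j<k u. f j) \<in> borel_measurable ?P1"
      by (intro borel_measurable_sum measurable_component_singleton) auto
    from measurable_sets[OF this A[of u]]
    show "{f \<in> space ?P1. (\<Sum>j<k u. f j) \<in> A u} \<in> sets ?P1"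
      by (simp add: vimage_def Int_def conj_commute)
  qed
  have S2: "S2 \<in> sets ?P2"
  proof -
    have "(\<lambda>f. f n) \<in> borel_measurable ?P2" by (rule measurable_component_singleton) simp
    from measurable_sets[OF this C] show ?thesis unfolding S2_def
      by (simp add: vimage_def Int_def conj_commute)
  qed
  have "indep_var ?P1 (\<lambda>\<omega>. restrict (\<lambda>j. \<Delta> j \<omega>) {..<n}) ?P2 (\<lambda>\<omega>. restrict (\<lambda>j. \<Delta> j \<omega>) {n})"
    by (rule indep_var_restrict[OF ind]) auto
  note D = indep_varD[OF this S1 S2]
  have last: "\<Delta> n \<omega> = B t' \<omega> i - B t \<omega> i" for \<omega> by (simp add: \<Delta>_def \<tau>_def)
  have mem1: "restrict (\<lambda>j. \<Delta> j \<omega>) {..<n} \<in> S1 \<longleftrightarrow> (\<forall>u\<in>J. (\<Sum>j<k u. \<Delta> j \<omega>) \<in> A u)" for \<omega>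
  proof -
    have "(\<Sum>j<k u. restrict (\<lambda>j. \<Delta> j \<omega>) {..<n} j) = (\<Sum>j<k u. \<Delta> j \<omega>)" if "u \<in> J" for u
      by (intro sum.cong) (use k[OF that] in auto)
    then show ?thesis by (auto simp: S1_def space_PiM PiE_def)
  qed
  have mem2: "restrict (\<lambda>j. \<Delta> j \<omega>) {n} \<in> S2 \<longleftrightarrow> B t' \<omega> i - B t \<omega> i \<in> C" for \<omega>
    by (auto simp: S2_def space_PiM PiE_def last)
  have m\<Delta>: "(\<lambda>\<omega>. \<Delta> j \<omega>) \<in> borel_measurable M" for j
    unfolding \<Delta>_def by (intro borel_measurable_diff B_measurable[OF i] \<tau>_nonneg)
  have C_ev: "{\<omega> \<in> space M. B t' \<omega> i - B t \<omega> i \<in> C} \<in> events"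
  proof -
    have "(\<lambda>\<omega>. B t' \<omega> i - B t \<omega> i) \<in> borel_measurable M"
      using t by (intro borel_measurable_diff B_measurable[OF i]) auto
    from measurable_sets[OF this C] show ?thesis by (simp add: vimage_def Int_def conj_commute)
  qed
  have E'_ev: "{\<omega> \<in> space M. \<forall>u\<in>J. (\<Sum>j<k u. \<Delta> j \<omega>) \<in> A u} \<in> events"
  proof (rule sets.sets_Collect_finite_All[OF _ J(1)])
    fix u assume "u \<in> J"
    have "(\<lambda>\<omega>. \<Sum>j<k u. \<Delta> j \<omega>) \<in> borel_measurable M"
      by (intro borel_measurable_sum m\<Delta>)
    from measurable_sets[OF this A[of u]]
    show "{\<omega> \<in> space M. (\<Sum>j<k u. \<Delta> j \<omega>) \<in> A u} \<in> events" by (simp add: vimage_def Int_def conj_commute)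
  qed
  have E_ev: "{\<omega> \<in> space M. \<forall>u\<in>J. B u \<omega> i \<in> A u} \<in> events"
  proof (rule sets.sets_Collect_finite_All[OF _ J(1)])
    fix u assume "u \<in> J"
    then have "(\<lambda>\<omega>. B u \<omega> i) \<in> borel_measurable M" using J by (intro B_measurable[OF i]) auto
    from measurable_sets[OF this A[of u]]
    show "{\<omega> \<in> space M. B u \<omega> i \<in> A u} \<in> events" by (simp add: vimage_def Int_def conj_commute)
  qed
  \<comment> \<open>The values are sums of increments only where the path starts at 0, so the events
    agree up to a null set.\<close>
  have "prob {\<omega> \<in> space M. (\<forall>u\<in>J. B u \<omega> i \<in> A u) \<and> B t' \<omega> i - B t \<omega> i \<in> C} =
      prob {\<omega> \<in> space M. (\<forall>u\<in>J. (\<Sum>j<k u. \<Delta> j \<omega>) \<in> A u) \<and> B t' \<omega> i - B t \<omega> i \<in> C}"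
  proof (rule finite_measure_eq_AE)
    show "AE \<omega> in M. (\<omega> \<in> {\<omega> \<in> space M. (\<forall>u\<in>J. B u \<omega> i \<in> A u) \<and> B t' \<omega> i - B t \<omega> i \<in> C}) =
      (\<omega> \<in> {\<omega> \<in> space M. (\<forall>u\<in>J. (\<Sum>j<k u. \<Delta> j \<omega>) \<in> A u) \<and> B t' \<omega> i - B t \<omega> i \<in> C})"
      using AE_B_0[OF i] by eventually_elim (use tel in auto)
    show "{\<omega> \<in> space M. (\<forall>u\<in>J. B u \<omega> i \<in> A u) \<and> B t' \<omega> i - B t \<omega> i \<in> C} \<in> events"
      using sets.Int[OF E_ev C_ev] by (simp add: Int_def conj_ac cong: conj_cong)
    show "{\<omega> \<in> space M. (\<forall>u\<in>J. (\<Sum>j<k u. \<Delta> j \<omega>) \<in> A u) \<and> B t' \<omega> i - B t \<omega> i \<in> C} \<in> events"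
      using sets.Int[OF E'_ev C_ev] by (simp add: Int_def conj_ac cong: conj_cong)
  qed
  also have "\<dots> = prob ((\<lambda>\<omega>. (restrict (\<lambda>j. \<Delta> j \<omega>) {..<n}, restrict (\<lambda>j. \<Delta> j \<omega>) {n})) -` (S1 \<times> S2) \<inter> space M)"
    by (rule arg_cong[where f = prob]) (use mem1 mem2 in auto)
  also have "\<dots> = prob ((\<lambda>\<omega>. restrict (\<lambda>j. \<Delta> j \<omega>) {..<n}) -` S1 \<inter> space M) *
      prob ((\<lambda>\<omega>. restrict (\<lambda>j. \<Delta> j \<omega>) {n}) -` S2 \<inter> space M)"
    by (rule D)
  also have "(\<lambda>\<omega>. restrict (\<lambda>j. \<Delta> j \<omega>) {..<n}) -` S1 \<inter> space M = {\<omega> \<in> space M. \<forall>u\<in>J. (\<Sum>j<k u. \<Delta> j \<omega>) \<in> A u}"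
    using mem1 by auto
  also have "(\<lambda>\<omega>. restrict (\<lambda>j. \<Delta> j \<omega>) {n}) -` S2 \<inter> space M = {\<omega> \<in> space M. B t' \<omega> i - B t \<omega> i \<in> C}"
    using mem2 by auto
  also have "prob {\<omega> \<in> space M. \<forall>u\<in>J. (\<Sum>j<k u. \<Delta> j \<omega>) \<in> A u} = prob {\<omega> \<in> space M. \<forall>u\<in>J. B u \<omega> i \<in> A u}"
  proof (rule finite_measure_eq_AE[OF _ E'_ev E_ev])
    show "AE \<omega> in M. (\<omega> \<in> {\<omega> \<in> space M. \<forall>u\<in>J. (\<Sum>j<k u. \<Delta> j \<omega>) \<in> A u}) =
      (\<omega> \<in> {\<omega> \<in> space M. \<forall>u\<in>J. B u \<omega> i \<in> A u})"
      using AE_B_0[OF i] by eventually_elim (use tel in auto)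
  qed
  finally show ?thesis .
qed

end

section \<open>Independence of Brownian increments from the past\<close>

context brownian
begin

lemma canonical_generator_subset:
  "{(\<lambda>\<omega>. B s \<omega> i) -` A \<inter> space M | s i A. 0 \<le> s \<and> s \<le> t \<and> i \<in> {1..N} \<and> A \<in> sets borel} \<union> null_sets M
    \<subseteq> Pow (space M)"
  by (auto dest: null_setsD2 sets.sets_into_space)

lemma space_canonical [simp]: "space (canonical_filtration M N B t) = space M"
  unfolding canonical_filtration_def by (rule space_measure_of) (rule canonical_generator_subset)

lemma sets_canonical:
  "sets (canonical_filtration M N B t) = sigma_sets (space M)
    ({(\<lambda>\<omega>. B s \<omega> i) -` A \<inter> space M | s i A. 0 \<le> s \<and> s \<le> t \<and> i \<in> {1..N} \<and> A \<in> sets borel} \<union> null_sets M)"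
  unfolding canonical_filtration_def by (rule sets_measure_of) (rule canonical_generator_subset)

lemma subalgebra_canonical: "subalgebra M (canonical_filtration M N B t)"
  unfolding subalgebra_def
proof
  show "sets (canonical_filtration M N B t) \<subseteq> sets M"
    unfolding sets_canonical
    by (rule sets.sigma_sets_subset) (auto intro: measurable_sets[OF B_measurable] dest: null_setsD2)
qed simp

lemma canonical_mono:
  "s \<le> t \<Longrightarrow> sets (canonical_filtration M N B s) \<subseteq> sets (canonical_filtration M N B t)"
  unfolding sets_canonical by (rule sigma_sets_mono') fastforce

lemma filtration_canonical: "filtration (space M) (canonical_filtration M N B)"
  by unfold_locales (auto dest: canonical_mono)

text \<open>
  The whole paths of the other components are included so that the factors of a product over the
  coordinates can be averaged one at a time.
\<close>

definition history_generator :: "nat \<Rightarrow> real \<Rightarrow> 'a set set" where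
  "history_generator i t = {(\<lambda>\<omega>. B s \<omega> l) -` A \<inter> space M | s l A.
     0 \<le> s \<and> (l = i \<longrightarrow> s \<le> t) \<and> l \<in> {1..N} \<and> A \<in> sets borel} \<union> null_sets M"

definition history :: "nat \<Rightarrow> real \<Rightarrow> 'a measure" where
  "history i t = sigma (space M) (history_generator i t)"

lemma history_generator_subset: "history_generator i t \<subseteq> Pow (space M)"
  by (auto simp: history_generator_def dest: null_setsD2 sets.sets_into_space)

lemma space_history [simp]: "space (history i t) = space M"
  unfolding history_def by (rule space_measure_of) (rule history_generator_subset)

lemma sets_history: "sets (history i t) = sigma_sets (space M) (history_generator i t)"
  unfolding history_def by (rule sets_measure_of) (rule history_generator_subset)

lemma subalgebra_history: "subalgebra M (history i t)"
  unfolding subalgebra_def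
proof
  show "sets (history i t) \<subseteq> sets M"
    unfolding sets_history history_generator_def
    by (rule sets.sigma_sets_subset) (auto intro: measurable_sets[OF B_measurable] dest: null_setsD2)
qed simp

lemma subalgebra_history_canonical: "subalgebra (history i t) (canonical_filtration M N B t)"
  unfolding subalgebra_def
proof
  show "sets (canonical_filtration M N B t) \<subseteq> sets (history i t)"
    unfolding sets_history sets_canonical history_generator_def by (rule sigma_sets_mono') fastforce
qed simp

lemma B_history_measurable:
  assumes "0 \<le> s" "l = i \<longrightarrow> s \<le> t" "l \<in> {1..N}"
  shows "(\<lambda>\<omega>. B s \<omega> l) \<in> borel_measurable (history i t)"
proof (rule measurableI)
  fix A :: "real set" assume "A \<in> sets borel"
  then show "(\<lambda>\<omega>. B s \<omega> l) -` A \<inter> space (history i t) \<in> sets (history i t)"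
    unfolding sets_history space_history history_generator_def
    by (intro sigma_sets.Basic UnI1) (use assms in blast)
qed simp

definition cylinders :: "nat \<Rightarrow> real \<Rightarrow> 'a set set" where
  "cylinders i t = {{\<omega> \<in> space M. \<forall>p\<in>J. B (fst p) \<omega> (snd p) \<in> A p} | J A.
     finite J \<and> J \<subseteq> {(s, l). 0 \<le> s \<and> (l = i \<longrightarrow> s \<le> t) \<and> l \<in> {1..N}} \<and> (\<forall>p. A p \<in> sets borel)}"

lemma cylinders_Int:
  assumes "E \<in> cylinders i t" "E' \<in> cylinders i t"
  shows "E \<inter> E' \<in> cylinders i t"
proof -
  let ?T = "{(s, l). 0 \<le> s \<and> (l = i \<longrightarrow> s \<le> t) \<and> l \<in> {1..N}}"
  obtain J A where J: "finite J" "J \<subseteq> ?T" "\<And>p. A p \<in> sets borel"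
    "E = {\<omega> \<in> space M. \<forall>p\<in>J. B (fst p) \<omega> (snd p) \<in> A p}"
    using assms(1) unfolding cylinders_def by auto
  obtain J' A' where J': "finite J'" "J' \<subseteq> ?T" "\<And>p. A' p \<in> sets borel"
    "E' = {\<omega> \<in> space M. \<forall>p\<in>J'. B (fst p) \<omega> (snd p) \<in> A' p}"
    using assms(2) unfolding cylinders_def by auto
  define A'' where "A'' p = (if p \<in> J then A p else UNIV) \<inter> (if p \<in> J' then A' p else UNIV)" for p
  have "E \<inter> E' = {\<omega> \<in> space M. \<forall>p\<in>J \<union> J'. B (fst p) \<omega> (snd p) \<in> A'' p}"
    unfolding J(4) J'(4) A''_def by auto
  moreover have "A'' p \<in> sets borel" for p using J(3) J'(3) by (simp add: A''_def)
  ultimately show ?thesis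
    unfolding cylinders_def using J J' by (intro CollectI exI[of _ "J \<union> J'"] exI[of _ A'']) auto
qed

text \<open>The event restricts finitely many values, so it factors over the components, which are
  independent as whole processes. The increment meets only the factor of component \<open>i\<close>,
  where \<open>increment_indep_finite\<close> separates it.\<close>

lemma cylinder_increment_indep:
  assumes E: "E \<in> cylinders i t" and i: "i \<in> {1..N}" and t: "0 \<le> t" "t \<le> t'" and D: "D \<in> sets borel"
  shows "E \<in> events"
    and "prob (E \<inter> {\<omega> \<in> space M. B t' \<omega> i - B t \<omega> i \<in> D}) = prob E * prob {\<omega> \<in> space M. B t' \<omega> i - B t \<omega> i \<in> D}"
proof -
  obtain J A where J: "finite J" "J \<subseteq> {(s, l). 0 \<le> s \<and> (l = i \<longrightarrow> s \<le> t) \<and> l \<in> {1..N}}"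
    and A: "\<And>p. A p \<in> sets borel" and E_eq: "E = {\<omega> \<in> space M. \<forall>p\<in>J. B (fst p) \<omega> (snd p) \<in> A p}"
    using E unfolding cylinders_def by auto
  let ?P = "Pi\<^sub>M {0..} (\<lambda>_. borel :: real measure)"
  define Y where "Y l \<omega> = (\<lambda>t\<in>{0..}. B t \<omega> l)" for l \<omega>
  define S where "S D l = {f \<in> space ?P. (\<forall>p\<in>J. snd p = l \<longrightarrow> f (fst p) \<in> A p) \<and> (l = i \<longrightarrow> f t' - f t \<in> D)}" for D l
  have ind: "indep_vars (\<lambda>_. ?P) Y {1..N}"
    using brownian by (simp add: brownian_motion_def Y_def[abs_def])
  have ev: "(\<lambda>f. f s) \<in> borel_measurable ?P" if "0 \<le> s" for s
    using that by (intro measurable_component_singleton) auto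
  have S_sets: "S D l \<in> sets ?P" if "D \<in> sets borel" for D l
  proof -
    have 1: "{f \<in> space ?P. \<forall>p\<in>J. snd p = l \<longrightarrow> f (fst p) \<in> A p} \<in> sets ?P"
    proof (rule sets.sets_Collect_finite_All[OF _ J(1)])
      fix p assume p: "p \<in> J"
      then have "0 \<le> fst p" using J(2) by auto
      from measurable_sets[OF ev[OF this] A[of p]]
      show "{f \<in> space ?P. snd p = l \<longrightarrow> f (fst p) \<in> A p} \<in> sets ?P"
        by (cases "snd p = l") (simp_all add: vimage_def Int_def conj_commute)
    qed
    have 2: "{f \<in> space ?P. l = i \<longrightarrow> f t' - f t \<in> D} \<in> sets ?P"
    proof -
      have "(\<lambda>f. f t' - f t) \<in> borel_measurable ?P" using t by (intro borel_measurable_diff ev) auto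
      from measurable_sets[OF this that] show ?thesis
        by (cases "l = i") (simp_all add: vimage_def Int_def conj_commute)
    qed
    have "S D l = {f \<in> space ?P. \<forall>p\<in>J. snd p = l \<longrightarrow> f (fst p) \<in> A p} \<inter> {f \<in> space ?P. l = i \<longrightarrow> f t' - f t \<in> D}"
      by (auto simp: S_def)
    then show ?thesis using sets.Int[OF 1 2] by (simp only:)
  qed
  have pre: "Y l -` S D l \<inter> space M =
      {\<omega> \<in> space M. (\<forall>p\<in>J. snd p = l \<longrightarrow> B (fst p) \<omega> l \<in> A p) \<and> (l = i \<longrightarrow> B t' \<omega> i - B t \<omega> i \<in> D)}" for D l
  proof -
    have "Y l \<omega> s = B s \<omega> l" if "0 \<le> s" for s \<omega> using that by (simp add: Y_def)
    moreover have "Y l \<omega> \<in> space ?P" for \<omega> by (simp add: Y_def space_PiM)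
    moreover have "0 \<le> fst p" if "p \<in> J" for p using that J(2) by auto
    ultimately show ?thesis using t by (auto simp: S_def)
  qed
  have prod: "prob (E \<inter> {\<omega> \<in> space M. B t' \<omega> i - B t \<omega> i \<in> D}) = (\<Prod>l\<in>{1..N}. prob (Y l -` S D l \<inter> space M))"
    if "D \<in> sets borel" for D
  proof -
    have "E \<inter> {\<omega> \<in> space M. B t' \<omega> i - B t \<omega> i \<in> D} = (\<Inter>l\<in>{1..N}. Y l -` S D l \<inter> space M)"
      unfolding pre E_eq using i J(2) by fastforce
    then show ?thesis using indep_varsD[OF ind, of "{1..N}" "S D"] i S_sets[OF that] by auto
  qed
  have split: "(\<Prod>l\<in>{1..N}. prob (Y l -` S D l \<inter> space M)) =
      prob {\<omega> \<in> space M. (\<forall>p\<in>J. snd p = i \<longrightarrow> B (fst p) \<omega> i \<in> A p) \<and> B t' \<omega> i - B t \<omega> i \<in> D} *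
      (\<Prod>l\<in>{1..N} - {i}. prob {\<omega> \<in> space M. \<forall>p\<in>J. snd p = l \<longrightarrow> B (fst p) \<omega> l \<in> A p})" for D
  proof -
    have "(\<Prod>l\<in>{1..N}. prob (Y l -` S D l \<inter> space M)) =
        prob (Y i -` S D i \<inter> space M) * (\<Prod>l\<in>{1..N} - {i}. prob (Y l -` S D l \<inter> space M))"
      using i by (simp add: prod.remove)
    also have "(\<Prod>l\<in>{1..N} - {i}. prob (Y l -` S D l \<inter> space M)) =
        (\<Prod>l\<in>{1..N} - {i}. prob {\<omega> \<in> space M. \<forall>p\<in>J. snd p = l \<longrightarrow> B (fst p) \<omega> l \<in> A p})"
      by (rule prod.cong[OF refl]) (auto simp: pre)
    finally show ?thesis by (simp add: pre)
  qed
  define Ji where "Ji = fst ` {p \<in> J. snd p = i}"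
  have Ji: "(\<forall>p\<in>J. snd p = i \<longrightarrow> B (fst p) \<omega> i \<in> A p) \<longleftrightarrow> (\<forall>u\<in>Ji. B u \<omega> i \<in> A (u, i))" for \<omega>
    unfolding Ji_def by force
  have one: "prob {\<omega> \<in> space M. (\<forall>p\<in>J. snd p = i \<longrightarrow> B (fst p) \<omega> i \<in> A p) \<and> B t' \<omega> i - B t \<omega> i \<in> D} =
    prob {\<omega> \<in> space M. \<forall>p\<in>J. snd p = i \<longrightarrow> B (fst p) \<omega> i \<in> A p} * prob {\<omega> \<in> space M. B t' \<omega> i - B t \<omega> i \<in> D}"
    if "D \<in> sets borel" for D
    unfolding Ji
  proof (rule increment_indep_finite[OF i t _ _ A that])
    show "finite Ji" unfolding Ji_def using J(1) by auto
    show "Ji \<subseteq> {0..t}" unfolding Ji_def using J(2) by auto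
  qed
  \<comment> \<open>Taking the whole line for \<open>D\<close> recovers \<open>E\<close>, so its
    probability is the same product without the increment.\<close>
  have E_sub: "E \<inter> {\<omega> \<in> space M. B t' \<omega> i - B t \<omega> i \<in> UNIV} = E" by (auto simp: E_eq)
  have "prob E = prob {\<omega> \<in> space M. \<forall>p\<in>J. snd p = i \<longrightarrow> B (fst p) \<omega> i \<in> A p} *
      (\<Prod>l\<in>{1..N} - {i}. prob {\<omega> \<in> space M. \<forall>p\<in>J. snd p = l \<longrightarrow> B (fst p) \<omega> l \<in> A p})"
    using prod[of UNIV] unfolding split E_sub by simp
  then show "prob (E \<inter> {\<omega> \<in> space M. B t' \<omega> i - B t \<omega> i \<in> D}) = prob E * prob {\<omega> \<in> space M. B t' \<omega> i - B t \<omega> i \<in> D}"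
    unfolding prod[OF D] split one[OF D] by simp
  show "E \<in> events"
    unfolding E_eq
  proof (rule sets.sets_Collect_finite_All[OF _ J(1)])
    fix p assume p: "p \<in> J"
    then have "(\<lambda>\<omega>. B (fst p) \<omega> (snd p)) \<in> borel_measurable M" using J(2) by (intro B_measurable) auto
    from measurable_sets[OF this A[of p]]
    show "{\<omega> \<in> space M. B (fst p) \<omega> (snd p) \<in> A p} \<in> events" by (simp add: vimage_def Int_def conj_commute)
  qed
qed

text \<open>Independence passes from intersection-stable families to the generated sigma-algebras.
  Null sets are independent of every event, so they can be adjoined to the cylinders, which takes
  care of the augmented filtration.\<close>

lemma history_increment_indep:
  assumes i: "i \<in> {1..N}" and t: "0 \<le> t" "t \<le> t'" and \<zeta>: "\<zeta> \<in> borel_measurable (history i t)"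
  shows "indep_var borel \<zeta> borel (\<lambda>\<omega>. B t' \<omega> i - B t \<omega> i)"
proof -
  let ?D = "\<lambda>\<omega>. B t' \<omega> i - B t \<omega> i"
  let ?C = "{?D -` A \<inter> space M | A. A \<in> sets borel}"
  have D: "?D \<in> borel_measurable M" using i t by (intro borel_measurable_diff B_measurable) auto
  have pre: "?D -` A \<inter> space M = {\<omega> \<in> space M. ?D \<omega> \<in> A}" for A by auto
  have "indep_set (cylinders i t \<union> null_sets M) ?C"
  proof (rule indep_setI)
    show "cylinders i t \<union> null_sets M \<subseteq> events"
      using cylinder_increment_indep(1)[OF _ i t] sets.top by (fastforce dest: null_setsD2)
    show "?C \<subseteq> events" using measurable_sets[OF D] by auto
    fix a b assume a: "a \<in> cylinders i t \<union> null_sets M" and b: "b \<in> ?C"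
    then obtain A where A: "A \<in> sets borel" "b = ?D -` A \<inter> space M" by auto
    show "prob (a \<inter> b) = prob a * prob b"
    proof (cases "a \<in> cylinders i t")
      case True
      then show ?thesis using cylinder_increment_indep(2)[OF True i t A(1)] unfolding A(2) pre by simp
    next
      case False
      then have "a \<in> null_sets M" using a by simp
      moreover have "b \<in> events" using A measurable_sets[OF D] by auto
      ultimately have "a \<inter> b \<in> null_sets M" by (intro null_set_Int2)
      with \<open>a \<in> null_sets M\<close> show ?thesis by (simp add: measure_eq_0_null_sets)
    qed
  qed
  moreover have "Int_stable (cylinders i t \<union> null_sets M)"
  proof (rule Int_stableI)
    fix a b assume "a \<in> cylinders i t \<union> null_sets M" "b \<in> cylinders i t \<union> null_sets M"
    moreover have "a \<inter> b \<in> null_sets M" if "a \<in> events" "b \<in> events" "a \<in> null_sets M \<or> b \<in> null_sets M"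
      using that null_set_Int1[of b M a] null_set_Int2[of a M b] by (auto simp: Int_commute)
    ultimately show "a \<inter> b \<in> cylinders i t \<union> null_sets M"
      using cylinders_Int[of a i t b] cylinder_increment_indep(1)[OF _ i t, of _ UNIV] by (auto dest: null_setsD2)
  qed
  moreover have "Int_stable ?C"
  proof (rule Int_stableI)
    fix a b assume "a \<in> ?C" "b \<in> ?C"
    then obtain A A' where "A \<in> sets borel" "A' \<in> sets borel" "a = ?D -` A \<inter> space M" "b = ?D -` A' \<inter> space M"
      by auto
    then show "a \<inter> b \<in> ?C" by (intro CollectI exI[of _ "A \<inter> A'"]) auto
  qed
  ultimately have ind: "indep_set (sigma_sets (space M) (cylinders i t \<union> null_sets M)) (sigma_sets (space M) ?C)"
    by (rule indep_set_sigma_sets)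
  have "history_generator i t \<subseteq> cylinders i t \<union> null_sets M"
  proof
    fix a assume a: "a \<in> history_generator i t"
    show "a \<in> cylinders i t \<union> null_sets M"
    proof (cases "a \<in> null_sets M")
      case False
      then obtain s l A where *: "a = (\<lambda>\<omega>. B s \<omega> l) -` A \<inter> space M" "0 \<le> s" "l = i \<longrightarrow> s \<le> t" "l \<in> {1..N}" "A \<in> sets borel"
        using a by (auto simp: history_generator_def)
      have "a \<in> cylinders i t"
        unfolding cylinders_def
        by (intro CollectI exI[of _ "{(s, l)}"] exI[of _ "\<lambda>_. A"]) (use * in auto)
      then show ?thesis by simp
    qed simp
  qed
  then have "sets (history i t) \<subseteq> sigma_sets (space M) (cylinders i t \<union> null_sets M)"
    unfolding sets_history by (rule sigma_sets_mono')
  then have "{\<zeta> -` A \<inter> space M | A. A \<in> sets borel} \<subseteq> sigma_sets (space M) (cylinders i t \<union> null_sets M)"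
    using measurable_sets[OF \<zeta>] by auto
  then have sub: "sigma_sets (space M) {\<zeta> -` A \<inter> space M | A. A \<in> sets borel}
      \<subseteq> sigma_sets (space M) (cylinders i t \<union> null_sets M)"
    by (rule sigma_sets_mono)
  have "\<zeta> \<in> borel_measurable M" using subalgebra_history \<zeta> by (rule measurable_from_subalg)
  moreover have "indep_set (sigma_sets (space M) {\<zeta> -` A \<inter> space M | A. A \<in> sets borel}) (sigma_sets (space M) ?C)"
    using ind sub unfolding indep_sets2_eq by blast
  ultimately show ?thesis unfolding indep_var_eq using D by simp
qed

lemma increment_moments:
  assumes i: "i \<in> {1..N}" and t: "0 \<le> t" "t \<le> t'"
  shows "all_moments M (\<lambda>\<omega>. B t' \<omega> i - B t \<omega> i)"
    and "expectation (\<lambda>\<omega>. B t' \<omega> i - B t \<omega> i) = 0"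
    and "expectation (\<lambda>\<omega>. (B t' \<omega> i - B t \<omega> i)\<^sup>2) = t' - t"
proof -
  let ?D = "\<lambda>\<omega>. B t' \<omega> i - B t \<omega> i"
  have D: "?D \<in> borel_measurable M" using i t by (intro borel_measurable_diff B_measurable) auto
  have "all_moments M ?D \<and> expectation ?D = 0 \<and> expectation (\<lambda>\<omega>. (?D \<omega>)\<^sup>2) = t' - t"
  \<comment> \<open>The normal law is given for a positive time difference; for equal times the
    increment is identically 0.\<close>
  proof (cases "t = t'")
    case True
    then show ?thesis by (simp add: all_moments_const)
  next
    case False
    then have tt: "t < t'" using t by simp
    let ?\<sigma> = "sqrt (t' - t)"
    have \<sigma>: "0 < ?\<sigma>" using tt by simp
    have dist: "distributed M lborel ?D (normal_density 0 ?\<sigma>)"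
      using standard_component[OF i] t tt by (simp add: standard_brownian_motion_def)
    have "integrable M (\<lambda>\<omega>. \<bar>?D \<omega>\<bar> ^ p)" for p :: nat
      using distributed_integrable[OF dist, of "\<lambda>x. \<bar>x\<bar> ^ p"] integrable_normal_moment_abs[OF \<sigma>, of 0 p] by simp
    moreover have "expectation ?D = 0" by (rule normal_distributed_expectation[OF \<sigma> dist])
    moreover have "expectation (\<lambda>\<omega>. (?D \<omega>)\<^sup>2) = t' - t"
      using normal_distributed_variance[OF \<sigma> dist] calculation(2) tt by simp
    ultimately show ?thesis using D by (simp add: all_moments_def)
  qed
  then show "all_moments M ?D" "expectation ?D = 0" "expectation (\<lambda>\<omega>. (?D \<omega>)\<^sup>2) = t' - t" by auto
qed

lemma B_all_moments:
  assumes i: "i \<in> {1..N}" and t: "0 \<le> t"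
  shows "all_moments M (\<lambda>\<omega>. B t \<omega> i)"
proof (rule all_moments_bound)
  have "all_moments M (\<lambda>\<omega>. (B t \<omega> i - B 0 \<omega> i)\<^sup>2 + 1)"
    by (intro all_moments_intros increment_moments(1) i t) auto
  then show "all_moments M (\<lambda>\<omega>. (B t \<omega> i - B 0 \<omega> i)\<^sup>2 + 1)" .
  show "AE \<omega> in M. \<bar>B t \<omega> i\<bar> \<le> (B t \<omega> i - B 0 \<omega> i)\<^sup>2 + 1"
    using AE_B_0[OF i]
  proof eventually_elim
    case (elim \<omega>)
    have "0 \<le> (\<bar>B t \<omega> i\<bar> - 1)\<^sup>2" "0 \<le> (B t \<omega> i)\<^sup>2" by auto
    then show ?case unfolding elim power2_diff by simp
  qed
qed (rule B_measurable[OF assms])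

end

section \<open>The running maximum of Brownian motion\<close>

context brownian
begin

text \<open>Conditional mean 0 and conditional second moment t' - t given
  \<open>history i t\<close>, in the form tested against a variable \<zeta> known from that
  history.\<close>

lemma expectation_mult_increment:
  assumes i: "i \<in> {1..N}" and t: "0 \<le> t" "t \<le> t'"
    and \<zeta>: "\<zeta> \<in> borel_measurable (history i t)" "integrable M \<zeta>"
  shows "expectation (\<lambda>\<omega>. \<zeta> \<omega> * (B t' \<omega> i - B t \<omega> i)) = 0"
    and "expectation (\<lambda>\<omega>. \<zeta> \<omega> * (B t' \<omega> i - B t \<omega> i)\<^sup>2) = (t' - t) * expectation \<zeta>"
proof -
  let ?D = "\<lambda>\<omega>. B t' \<omega> i - B t \<omega> i"
  note ind = history_increment_indep[OF i t \<zeta>(1)] and D = increment_moments[OF i t]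
  show "expectation (\<lambda>\<omega>. \<zeta> \<omega> * ?D \<omega>) = 0"
    using indep_var_lebesgue_integral[OF ind \<zeta>(2) all_moments_integrable[OF D(1)]] D(2) by simp
  have "indep_var borel (id \<circ> \<zeta>) borel ((\<lambda>x. x\<^sup>2) \<circ> ?D)"
    by (rule indep_var_compose[OF ind]) auto
  then have "indep_var borel \<zeta> borel (\<lambda>\<omega>. (?D \<omega>)\<^sup>2)" by (simp add: o_def)
  from indep_var_lebesgue_integral[OF this \<zeta>(2) all_moments_integrable[OF all_moments_power[OF D(1)]]] D(3)
  show "expectation (\<lambda>\<omega>. \<zeta> \<omega> * (?D \<omega>)\<^sup>2) = (t' - t) * expectation \<zeta>" by simp
qed

text \<open>Doob's inequality in mean square for the submartingale B^(2q) on a grid. The constant 4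
  is independent of \<open>n\<close>, so the grid may be refined afterwards.\<close>

lemma grid_maximal_inequality:
  assumes i: "i \<in> {1..N}" and T: "0 \<le> T" and n: "n > 0" and q: "q > 0"
  defines "m \<equiv> \<lambda>\<omega>. Max ((\<lambda>j. B (grid 0 T n j) \<omega> i ^ (2 * q)) ` {..n})"
  shows "all_moments M m" and "expectation (\<lambda>\<omega>. (m \<omega>)\<^sup>2) \<le> 4 * expectation (\<lambda>\<omega>. (B T \<omega> i ^ (2 * q))\<^sup>2)"
proof -
  define S where "S j \<omega> = B (grid 0 T n j) \<omega> i" for j \<omega>
  define Z where "Z j \<omega> = S j \<omega> ^ (2 * q)" for j \<omega>
  define m' where "m' k \<omega> = Max ((\<lambda>j. Z j \<omega>) ` {..k})" for k \<omega>
  have g0: "0 \<le> grid 0 T n j" for j using grid_ge[OF T] .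
  have S: "all_moments M (S j)" for j unfolding S_def by (rule B_all_moments[OF i g0])
  have Z: "all_moments M (Z j)" for j unfolding Z_def by (intro all_moments_power S)
  have Z0: "0 \<le> Z j \<omega>" for j \<omega> by (simp add: Z_def)
  have m'_ge: "Z j \<omega> \<le> m' k \<omega>" if "j \<le> k" for j k \<omega> unfolding m'_def by (rule Max_ge) (use that in auto)
  have m'0: "0 \<le> m' k \<omega>" for k \<omega> using Z0[of 0] m'_ge[of 0 k] by (meson order_trans le0)
  have m': "all_moments M (m' k)" for k
  proof (rule all_moments_bound)
    show "all_moments M (\<lambda>\<omega>. \<Sum>j\<le>k. Z j \<omega>)" by (intro all_moments_sum Z)
    show "m' k \<in> borel_measurable M"
      unfolding m'_def[abs_def] by (intro borel_measurable_Max all_moments_measurable Z) auto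
    have "m' k \<omega> \<le> (\<Sum>j\<le>k. Z j \<omega>)" for \<omega>
    proof -
      have "m' k \<omega> \<in> (\<lambda>j. Z j \<omega>) ` {..k}" unfolding m'_def by (rule Max_in) auto
      then obtain j where "j \<le> k" "m' k \<omega> = Z j \<omega>" by auto
      then show ?thesis using member_le_sum[of j "{..k}" "\<lambda>j. Z j \<omega>"] Z0 by simp
    qed
    then show "AE \<omega> in M. \<bar>m' k \<omega>\<bar> \<le> (\<Sum>j\<le>k. Z j \<omega>)" using m'0 by simp
  qed
  have m_eq: "m = m' n" by (rule ext) (simp add: m_def m'_def Z_def S_def)
  show "all_moments M m" unfolding m_eq by (rule m')
  have incr: "0 \<le> expectation (\<lambda>\<omega>. m' j \<omega> * (Z (Suc j) \<omega> - Z j \<omega>))" for j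
  proof -
    \<comment> \<open>The running maximum times the slope of the tangent at the present value. It is
      known from the history, so its product with the next increment has mean 0, and that product is
      a lower bound for the term.\<close>
    let ?\<zeta> = "\<lambda>\<omega>. m' j \<omega> * (2 * real q * S j \<omega> ^ (2 * q - 1))"
    have Sj: "S l \<in> borel_measurable (history i (grid 0 T n j))" if "l \<le> j" for l
      unfolding S_def[abs_def] by (rule B_history_measurable) (use g0 that T i in \<open>auto intro: grid_mono\<close>)
    have "m' j \<in> borel_measurable (history i (grid 0 T n j))"
      unfolding m'_def[abs_def] Z_def by (intro borel_measurable_Max borel_measurable_power Sj) auto
    then have \<zeta>: "?\<zeta> \<in> borel_measurable (history i (grid 0 T n j))"
      by (intro borel_measurable_times borel_measurable_power borel_measurable_const Sj order_refl)
    have \<zeta>i: "all_moments M ?\<zeta>" by (intro all_moments_intros m' S)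
    have "0 = expectation (\<lambda>\<omega>. ?\<zeta> \<omega> * (S (Suc j) \<omega> - S j \<omega>))"
      using expectation_mult_increment(1)[OF i g0 _ \<zeta> all_moments_integrable[OF \<zeta>i], of "grid 0 T n (Suc j)"] T
      by (simp add: S_def[symmetric] grid_mono)
    also have "\<dots> \<le> expectation (\<lambda>\<omega>. m' j \<omega> * (Z (Suc j) \<omega> - Z j \<omega>))"
    proof (rule integral_mono)
      show "integrable M (\<lambda>\<omega>. ?\<zeta> \<omega> * (S (Suc j) \<omega> - S j \<omega>))"
        "integrable M (\<lambda>\<omega>. m' j \<omega> * (Z (Suc j) \<omega> - Z j \<omega>))"
        by (intro all_moments_integrable all_moments_intros m' S Z)+
      fix \<omega>
      have "2 * real q * S j \<omega> ^ (2 * q - 1) * (S (Suc j) \<omega> - S j \<omega>) \<le> Z (Suc j) \<omega> - Z j \<omega>"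
        using even_power_tangent[OF q, of "S j \<omega>" "S (Suc j) \<omega>"] by (simp add: Z_def)
      from mult_left_mono[OF this m'0[of j \<omega>]]
      show "?\<zeta> \<omega> * (S (Suc j) \<omega> - S j \<omega>) \<le> m' j \<omega> * (Z (Suc j) \<omega> - Z j \<omega>)" by (simp add: mult_ac)
    qed
    finally show ?thesis .
  qed
  have pw: "(m' n \<omega>)\<^sup>2 + 4 * (\<Sum>j<n. m' j \<omega> * (Z (Suc j) \<omega> - Z j \<omega>)) \<le> 4 * (Z n \<omega>)\<^sup>2" for \<omega>
  proof -
    have "(m' n \<omega>)\<^sup>2 / 2 + (\<Sum>j<n. m' j \<omega> * (Z (Suc j) \<omega> - Z j \<omega>)) \<le> m' n \<omega> * Z n \<omega>"
      using running_max_transform[of "\<lambda>j. Z j \<omega>" n] Z0 by (simp add: m'_def)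
    \<comment> \<open>This splitting leaves a quarter of the squared maximum on the left, which is
      where the constant 4 comes from.\<close>
    moreover have "0 \<le> (m' n \<omega> / 2 - Z n \<omega>)\<^sup>2" by simp
    then have "m' n \<omega> * Z n \<omega> \<le> (m' n \<omega>)\<^sup>2 / 4 + (Z n \<omega>)\<^sup>2"
      by (simp add: power2_eq_square algebra_simps)
    ultimately show ?thesis by linarith
  qed
  have i1: "integrable M (\<lambda>\<omega>. (m' n \<omega>)\<^sup>2)" "integrable M (\<lambda>\<omega>. 4 * (Z n \<omega>)\<^sup>2)"
    "\<And>j. integrable M (\<lambda>\<omega>. m' j \<omega> * (Z (Suc j) \<omega> - Z j \<omega>))"
    "integrable M (\<lambda>\<omega>. 4 * (\<Sum>j<n. m' j \<omega> * (Z (Suc j) \<omega> - Z j \<omega>)))"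
    by (intro all_moments_integrable all_moments_intros m' S Z)+
  have "expectation (\<lambda>\<omega>. (m' n \<omega>)\<^sup>2) \<le> expectation (\<lambda>\<omega>. (m' n \<omega>)\<^sup>2) +
      4 * (\<Sum>j<n. expectation (\<lambda>\<omega>. m' j \<omega> * (Z (Suc j) \<omega> - Z j \<omega>)))"
    using incr by (simp add: sum_nonneg)
  also have "\<dots> = expectation (\<lambda>\<omega>. (m' n \<omega>)\<^sup>2 + 4 * (\<Sum>j<n. m' j \<omega> * (Z (Suc j) \<omega> - Z j \<omega>)))"
    by (subst Bochner_Integration.integral_add[OF i1(1,4)]) (simp add: Bochner_Integration.integral_sum i1)
  also have "\<dots> \<le> expectation (\<lambda>\<omega>. 4 * (Z n \<omega>)\<^sup>2)"
    by (intro integral_mono Bochner_Integration.integrable_add i1 pw)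
  finally show "expectation (\<lambda>\<omega>. (m \<omega>)\<^sup>2) \<le> 4 * expectation (\<lambda>\<omega>. (B T \<omega> i ^ (2 * q))\<^sup>2)"
    using n by (simp add: m_eq Z_def S_def)
qed

text \<open>Dyadic grids are nested, so the maxima \<open>V n\<close> increase, and by continuity
  their limit dominates the path on the whole interval. Fatou's lemma carries the moment bounds,
  which are uniform in \<open>n\<close>, over to the limit.\<close>

lemma component_running_bound:
  assumes i: "i \<in> {1..N}" and T: "0 \<le> T"
  obtains r where "all_moments M r" "AE \<omega> in M. \<forall>u\<in>{0..T}. \<bar>B u \<omega> i\<bar> \<le> r \<omega>"
proof -
  define g where "g n j = grid 0 T (2 ^ n) j" for n j
  define V where "V n \<omega> = Max ((\<lambda>j. \<bar>B (g n j) \<omega> i\<bar>) ` {..2 ^ n})" for n \<omega>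
  \<comment> \<open>\<open>lim\<close> has a value at every sample point, so \<open>r\<close> is
    measurable without setting exceptional paths aside. On continuous paths it is the supremum of
    the absolute value.\<close>
  define r where "r \<omega> = lim (\<lambda>n. V n \<omega>)" for \<omega>
  have g0: "0 \<le> g n j" for n j unfolding g_def by (rule grid_ge[OF T])
  have gT: "g n j \<le> T" if "j \<le> 2 ^ n" for n j unfolding g_def by (rule grid_le[OF T that])
  have V_meas [measurable]: "V n \<in> borel_measurable M" for n
    unfolding V_def[abs_def] by (intro borel_measurable_Max borel_measurable_abs B_measurable i g0) auto
  have r_meas: "r \<in> borel_measurable M" unfolding r_def[abs_def] by measurable
  have V_ge: "\<bar>B (g n j) \<omega> i\<bar> \<le> V n \<omega>" if "j \<le> 2 ^ n" for n j \<omega>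
    unfolding V_def by (rule Max_ge) (use that in auto)
  have V_ex: "\<exists>j\<le>2 ^ n. V n \<omega> = \<bar>B (g n j) \<omega> i\<bar>" for n \<omega>
  proof -
    have "V n \<omega> \<in> (\<lambda>j. \<bar>B (g n j) \<omega> i\<bar>) ` {..2 ^ n}" unfolding V_def by (rule Max_in) auto
    then show ?thesis by auto
  qed
  have V0: "0 \<le> V n \<omega>" for n \<omega> using V_ge[of 0 n \<omega>] by (auto intro: order_trans[OF abs_ge_zero])
  have V_inc: "incseq (\<lambda>n. V n \<omega>)" for \<omega>
  proof (rule incseq_SucI)
    fix n
    obtain j where j: "j \<le> 2 ^ n" "V n \<omega> = \<bar>B (g n j) \<omega> i\<bar>" using V_ex by blast
    have "g n j = g (Suc n) (2 * j)" by (simp add: g_def grid_def)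
    then show "V n \<omega> \<le> V (Suc n) \<omega>" using V_ge[of "2 * j" "Suc n" \<omega>] j by simp
  qed
  have good: "(\<lambda>n. V n \<omega>) \<longlonglongrightarrow> r \<omega> \<and> (\<forall>u\<in>{0..T}. \<bar>B u \<omega> i\<bar> \<le> r \<omega>)"
    if cont: "continuous_on {0..} (\<lambda>t. B t \<omega> i)" for \<omega>
  proof
    have cT: "continuous_on {0..T} (\<lambda>t. B t \<omega> i)" by (rule continuous_on_subset[OF cont]) auto
    then have "bounded ((\<lambda>t. B t \<omega> i) ` {0..T})"
      by (intro compact_imp_bounded compact_continuous_image) auto
    then obtain K where K: "\<forall>u\<in>{0..T}. \<bar>B u \<omega> i\<bar> \<le> K" by (auto simp: bounded_iff)
    have "V n \<omega> \<le> K" for n using V_ex[of n \<omega>] K g0 gT by fastforce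
    then obtain L where L: "(\<lambda>n. V n \<omega>) \<longlonglongrightarrow> L" "\<forall>n. V n \<omega> \<le> L"
      using incseq_convergent[OF V_inc] by blast
    have rL: "r \<omega> = L" unfolding r_def by (rule limI[OF L(1)])
    with L show "(\<lambda>n. V n \<omega>) \<longlonglongrightarrow> r \<omega>" by simp
    show "\<forall>u\<in>{0..T}. \<bar>B u \<omega> i\<bar> \<le> r \<omega>"
    proof
      fix u assume u: "u \<in> {0..T}"
      \<comment> \<open>The index of the last dyadic grid point not after \<open>u\<close>; for
        \<open>T = 0\<close> the quotient is 0 and so is the index.\<close>
      define j where "j n = nat \<lfloor>u * 2 ^ n / T\<rfloor>" for n :: nat
      have j: "j n \<le> 2 ^ n \<and> \<bar>g n (j n) - u\<bar> \<le> T / 2 ^ n" for n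
      proof (cases "T = 0")
        case True
        then show ?thesis using u by (simp add: j_def g_def grid_def)
      next
        case False
        then have T0: "T > 0" using T by simp
        define y where "y = u * 2 ^ n / T"
        have y: "0 \<le> y" "y \<le> 2 ^ n" using u T0 by (auto simp: y_def field_simps)
        have rj: "real (j n) = of_int \<lfloor>y\<rfloor>" using y by (simp add: j_def y_def[symmetric])
        have "real (j n) \<le> 2 ^ n" using rj y by linarith
        then have "j n \<le> 2 ^ n" by (metis of_nat_le_iff of_nat_numeral of_nat_power)
        have "u = T * y / 2 ^ n" using T0 by (simp add: y_def)
        then have "g n (j n) - u = T * (real (j n) - y) / 2 ^ n"
          by (simp add: g_def grid_def right_diff_distrib diff_divide_distrib)
        also have "\<bar>\<dots>\<bar> = T * \<bar>real (j n) - y\<bar> / 2 ^ n" using T0 by (simp add: abs_mult)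
        also have "\<dots> \<le> T * 1 / 2 ^ n"
          by (intro divide_right_mono mult_left_mono) (use rj T0 in \<open>auto, linarith\<close>)
        finally show ?thesis using \<open>j n \<le> 2 ^ n\<close> by simp
      qed
      have "(\<lambda>n. g n (j n)) \<longlonglongrightarrow> u"
      proof (rule LIM_zero_cancel, rule Lim_null_comparison)
        show "\<forall>\<^sub>F n in sequentially. norm (g n (j n) - u) \<le> T / 2 ^ n" using j by simp
        show "(\<lambda>n. T / 2 ^ n) \<longlonglongrightarrow> 0" by (rule LIMSEQ_divide_realpow_zero) simp
      qed
      then have "(\<lambda>n. B (g n (j n)) \<omega> i) \<longlonglongrightarrow> B u \<omega> i"
        using u g0 by (intro continuous_on_tendsto_compose[OF cont]) auto
      then have "(\<lambda>n. \<bar>B (g n (j n)) \<omega> i\<bar>) \<longlonglongrightarrow> \<bar>B u \<omega> i\<bar>" by (rule tendsto_rabs)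
      then show "\<bar>B u \<omega> i\<bar> \<le> r \<omega>"
        by (rule LIMSEQ_le_const2) (use V_ge j L(2) rL order_trans in blast)
    qed
  qed
  have int: "integrable M (\<lambda>\<omega>. \<bar>r \<omega>\<bar> ^ (4 * q))" if q: "q > 0" for q :: nat
  proof (rule integrableI_bounded)
    let ?C = "4 * expectation (\<lambda>\<omega>. (B T \<omega> i ^ (2 * q))\<^sup>2)"
    have VC: "(\<integral>\<^sup>+\<omega>. ennreal (V n \<omega> ^ (4 * q)) \<partial>M) \<le> ennreal ?C" for n
    proof -
      define m where "m \<omega> = Max ((\<lambda>j. B (grid 0 T (2 ^ n) j) \<omega> i ^ (2 * q)) ` {..2 ^ n})" for \<omega>
      note mx = grid_maximal_inequality[OF i T _ q, of "2 ^ n", folded m_def]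
      have le: "V n \<omega> ^ (4 * q) \<le> (m \<omega>)\<^sup>2" for \<omega>
      proof -
        obtain j where j: "j \<le> 2 ^ n" "V n \<omega> = \<bar>B (g n j) \<omega> i\<bar>" using V_ex by blast
        have "V n \<omega> ^ (2 * q) = B (g n j) \<omega> i ^ (2 * q)" unfolding j(2) by (simp add: power_even_abs)
        also have "\<dots> \<le> m \<omega>" unfolding m_def g_def by (rule Max_ge) (use j in auto)
        finally have "(V n \<omega> ^ (2 * q))\<^sup>2 \<le> (m \<omega>)\<^sup>2" using V0 by (intro power_mono) auto
        then show ?thesis by (simp add: power_mult[symmetric] mult.commute)
      qed
      have "(\<integral>\<^sup>+\<omega>. ennreal (V n \<omega> ^ (4 * q)) \<partial>M) \<le> (\<integral>\<^sup>+\<omega>. ennreal ((m \<omega>)\<^sup>2) \<partial>M)"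
        by (intro nn_integral_mono ennreal_leI le)
      also have "\<dots> = ennreal (expectation (\<lambda>\<omega>. (m \<omega>)\<^sup>2))"
        by (rule nn_integral_eq_integral) (use mx(1) in \<open>auto intro!: all_moments_integrable all_moments_power\<close>)
      also have "\<dots> \<le> ennreal ?C" by (rule ennreal_leI) (use mx(2) in simp)
      finally show ?thesis .
    qed
    \<comment> \<open>Fatou's lemma: on continuous paths the powers of \<open>V n\<close> converge,
      so the integrand may be written as a lower limit.\<close>
    have "(\<integral>\<^sup>+\<omega>. ennreal (norm (\<bar>r \<omega>\<bar> ^ (4 * q))) \<partial>M) = (\<integral>\<^sup>+\<omega>. liminf (\<lambda>n. ennreal (V n \<omega> ^ (4 * q))) \<partial>M)"
    proof (rule nn_integral_cong_AE)
      show "AE \<omega> in M. ennreal (norm (\<bar>r \<omega>\<bar> ^ (4 * q))) = liminf (\<lambda>n. ennreal (V n \<omega> ^ (4 * q)))"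
        using AE_continuous_B[OF i]
      proof eventually_elim
        case (elim \<omega>)
        then have "(\<lambda>n. V n \<omega>) \<longlonglongrightarrow> r \<omega>" using good by blast
        then have "(\<lambda>n. ennreal (V n \<omega> ^ (4 * q))) \<longlonglongrightarrow> ennreal (r \<omega> ^ (4 * q))"
          by (intro tendsto_ennrealI tendsto_power)
        then have "liminf (\<lambda>n. ennreal (V n \<omega> ^ (4 * q))) = ennreal (r \<omega> ^ (4 * q))"
          by (intro lim_imp_Liminf) auto
        moreover have "0 \<le> r \<omega> ^ (4 * q)" by (rule zero_le_even_power) simp
        ultimately show ?case by (simp add: power_abs[symmetric])
      qed
    qed
    also have "\<dots> \<le> liminf (\<lambda>n. \<integral>\<^sup>+\<omega>. ennreal (V n \<omega> ^ (4 * q)) \<partial>M)"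
      by (rule nn_integral_liminf) measurable
    also have "\<dots> \<le> limsup (\<lambda>n. \<integral>\<^sup>+\<omega>. ennreal (V n \<omega> ^ (4 * q)) \<partial>M)"
      by (rule Liminf_le_Limsup) simp
    also have "\<dots> \<le> ennreal ?C" by (rule Limsup_bounded) (use VC in simp)
    also have "\<dots> < \<infinity>" by simp
    finally show "(\<integral>\<^sup>+\<omega>. ennreal (norm (\<bar>r \<omega>\<bar> ^ (4 * q))) \<partial>M) < \<infinity>" .
  qed (use r_meas in measurable)
  have "all_moments M r"
    unfolding all_moments_def
  proof (intro conjI allI r_meas)
    fix p :: nat
    show "integrable M (\<lambda>\<omega>. \<bar>r \<omega>\<bar> ^ p)"
    proof (cases "p = 0")
      case False
      have "integrable M (\<lambda>\<omega>. 1 + \<bar>r \<omega>\<bar> ^ (4 * p))"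
        using int[of p] False by (intro Bochner_Integration.integrable_add) auto
      then show ?thesis
      proof (rule Bochner_Integration.integrable_bound)
        have "\<bar>r \<omega>\<bar> ^ p \<le> 1 + \<bar>r \<omega>\<bar> ^ (4 * p)" for \<omega>
        proof (cases "\<bar>r \<omega>\<bar> \<le> 1")
          case True
          then have "\<bar>r \<omega>\<bar> ^ p \<le> 1" by (intro power_le_one) auto
          then show ?thesis by (intro add_increasing2) auto
        next
          case False
          then have "\<bar>r \<omega>\<bar> ^ p \<le> \<bar>r \<omega>\<bar> ^ (4 * p)" by (intro power_increasing) auto
          then show ?thesis by simp
        qed
        then show "AE \<omega> in M. norm (\<bar>r \<omega>\<bar> ^ p) \<le> norm (1 + \<bar>r \<omega>\<bar> ^ (4 * p))"
          by (intro AE_I2) simp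
      qed (use r_meas in measurable)
    qed simp
  qed
  moreover have "AE \<omega> in M. \<forall>u\<in>{0..T}. \<bar>B u \<omega> i\<bar> \<le> r \<omega>"
    using AE_continuous_B[OF i] by eventually_elim (use good in blast)
  ultimately show ?thesis by (rule that)
qed

lemma running_bound:
  assumes T: "0 \<le> T"
  obtains r where "all_moments M r" "AE \<omega> in M. \<forall>u\<in>{0..T}. \<forall>i\<in>{1..N}. \<bar>B u \<omega> i\<bar> \<le> r \<omega>"
proof -
  define P where "P i r \<longleftrightarrow> all_moments M r \<and> (AE \<omega> in M. \<forall>u\<in>{0..T}. \<bar>B u \<omega> i\<bar> \<le> r \<omega>)" for i r
  define r where "r i = (SOME r. P i r)" for i
  have "P i (r i)" if i: "i \<in> {1..N}" for i
  proof -
    have "\<exists>r. P i r" unfolding P_def by (rule component_running_bound[OF i T]) blast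
    then show ?thesis unfolding r_def by (rule someI_ex)
  qed
  then have r: "\<And>i. i \<in> {1..N} \<Longrightarrow> all_moments M (r i)"
    "\<And>i. i \<in> {1..N} \<Longrightarrow> AE \<omega> in M. \<forall>u\<in>{0..T}. \<bar>B u \<omega> i\<bar> \<le> r i \<omega>"
    unfolding P_def by auto
  have "AE \<omega> in M. \<forall>i\<in>{1..N}. \<forall>u\<in>{0..T}. \<bar>B u \<omega> i\<bar> \<le> r i \<omega>"
    by (rule AE_finite_allI) (use r(2) in auto)
  then have "AE \<omega> in M. \<forall>u\<in>{0..T}. \<forall>i\<in>{1..N}. \<bar>B u \<omega> i\<bar> \<le> (\<Sum>i=1..N. r i \<omega>)"
  proof eventually_elim
    case (elim \<omega>)
    show ?case
    proof (intro ballI)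
      fix u i assume u: "u \<in> {0..T}" and i: "i \<in> {1..N}"
      have "0 \<le> r l \<omega>" if "l \<in> {1..N}" for l
        using elim that u by (meson abs_ge_zero order_trans)
      then have "r i \<omega> \<le> (\<Sum>i=1..N. r i \<omega>)" by (intro member_le_sum[OF i]) auto
      then show "\<bar>B u \<omega> i\<bar> \<le> (\<Sum>i=1..N. r i \<omega>)" using elim u i by fastforce
    qed
  qed
  moreover have "all_moments M (\<lambda>\<omega>. \<Sum>i=1..N. r i \<omega>)" by (intro all_moments_sum r(1))
  ultimately show ?thesis by (intro that)
qed

end

section \<open>The martingale property\<close>

lemma esym_scale: "esym A k (\<lambda>i. c * y i) = c ^ k * esym A k y"
  unfolding esym_def sum_distrib_left by (intro sum.cong refl) (auto simp: prod.distrib)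

text \<open>Given the past, (x + \<Delta>B)^2 has mean x^2 + (w - v) in each coordinate, and e_m
  contains only products over distinct coordinates. Testing on events \<open>F\<close> of the past
  expresses the conditional statement.\<close>

lemma (in brownian) expectation_esym_increment:
  assumes F: "F \<in> sets (canonical_filtration M N B v)" and vw: "0 \<le> v" "v \<le> w"
    and Xv: "\<And>l. l \<in> {1..N} \<Longrightarrow> (\<lambda>\<omega>. Xv \<omega> l) \<in> borel_measurable (canonical_filtration M N B v)"
    and Xm: "\<And>l. l \<in> {1..N} \<Longrightarrow> all_moments M (\<lambda>\<omega>. Xv \<omega> l)"
  shows "expectation (\<lambda>\<omega>. indicator F \<omega> * esym {1..N} m (\<lambda>l. (Xv \<omega> l + (B w \<omega> l - B v \<omega> l))\<^sup>2))
    = expectation (\<lambda>\<omega>. indicator F \<omega> * esym {1..N} m (\<lambda>l. (Xv \<omega> l)\<^sup>2 + (w - v)))"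
proof -
  define D where "D l \<omega> = B w \<omega> l - B v \<omega> l" for l \<omega>
  define P where "P l \<omega> = (Xv \<omega> l + D l \<omega>)\<^sup>2" for l \<omega>
  define Q where "Q l \<omega> = (Xv \<omega> l)\<^sup>2 + (w - v)" for l \<omega>
  define I :: "'a \<Rightarrow> real" where "I = indicator F"
  have FM: "F \<in> events" using F subalgebra_canonical[of v] by (auto simp: subalgebra_def)
  have Im: "all_moments M I" unfolding I_def by (rule all_moments_indicator[OF FM])
  have Dm: "all_moments M (D l)" if "l \<in> {1..N}" for l
    unfolding D_def by (rule increment_moments(1)[OF that vw])
  have Pm: "all_moments M (P l)" and Qm: "all_moments M (Q l)" if "l \<in> {1..N}" for l
    unfolding P_def Q_def by (intro all_moments_intros Xm Dm that)+
  have hist: "(\<lambda>\<omega>. Xv \<omega> l) \<in> borel_measurable (history i v)" if "l \<in> {1..N}" for i l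
    using subalgebra_history_canonical Xv[OF that] by (rule measurable_from_subalg)
  have Ih: "I \<in> borel_measurable (history i v)" for i
    unfolding I_def using F subalgebra_history_canonical[of i v] by (auto simp: subalgebra_def)
  have Qh: "Q l \<in> borel_measurable (history i v)" if "l \<in> {1..N}" for i l
    unfolding Q_def[abs_def] by (intro borel_measurable_add borel_measurable_power hist that borel_measurable_const)
  have Ph: "P l \<in> borel_measurable (history i v)" if "l \<in> {1..N}" "l \<noteq> i" for i l
    unfolding P_def[abs_def] D_def
    by (intro borel_measurable_add borel_measurable_diff borel_measurable_power hist B_history_measurable)
       (use that vw in auto)
  \<comment> \<open>Induction over the set \<open>T\<close> of coordinates already averaged. When
    \<open>i\<close> is added, all other factors, averaged or not, are measurable for
    \<open>history i v\<close>, so only the first two moments of \<open>D i\<close> enter.\<close>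
  have swap: "expectation (\<lambda>\<omega>. I \<omega> * ((\<Prod>l\<in>T. Q l \<omega>) * (\<Prod>l\<in>S - T. P l \<omega>))) = expectation (\<lambda>\<omega>. I \<omega> * (\<Prod>l\<in>S. P l \<omega>))"
    if S: "S \<subseteq> {1..N}" and T: "finite T" "T \<subseteq> S" for S T
    using T
  proof (induction T rule: finite_induct)
    case (insert i T)
    have finS: "finite S" using S finite_subset by blast
    have i: "i \<in> {1..N}" and TS: "T \<subseteq> {1..N}" using insert.prems S by auto
    define \<zeta> where "\<zeta> \<omega> = I \<omega> * ((\<Prod>l\<in>T. Q l \<omega>) * (\<Prod>l\<in>S - insert i T. P l \<omega>))" for \<omega>
    have \<zeta>h: "\<zeta> \<in> borel_measurable (history i v)"
      unfolding \<zeta>_def[abs_def]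
      by (intro borel_measurable_times borel_measurable_prod Ih Qh Ph) (use TS S in auto)
    have \<zeta>m: "all_moments M \<zeta>"
      unfolding \<zeta>_def by (intro all_moments_intros Im Qm Pm) (use TS S in auto)
    note Xi = Xm[OF i] and Di = Dm[OF i]
    have P: "(\<Prod>l\<in>S - T. P l \<omega>) = P i \<omega> * (\<Prod>l\<in>S - insert i T. P l \<omega>)" for \<omega>
      using prod.remove[of "S - T" i "\<lambda>l. P l \<omega>"] finS insert.hyps insert.prems
      by (simp add: Diff_insert[symmetric])
    have "expectation (\<lambda>\<omega>. I \<omega> * ((\<Prod>l\<in>T. Q l \<omega>) * (\<Prod>l\<in>S - T. P l \<omega>))) =
        expectation (\<lambda>\<omega>. \<zeta> \<omega> * (Xv \<omega> i)\<^sup>2 + 2 * (\<zeta> \<omega> * Xv \<omega> i * D i \<omega>) + \<zeta> \<omega> * (D i \<omega>)\<^sup>2)"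
    proof (rule Bochner_Integration.integral_cong[OF refl])
      fix \<omega>
      have "P i \<omega> = (Xv \<omega> i)\<^sup>2 + 2 * (Xv \<omega> i * D i \<omega>) + (D i \<omega>)\<^sup>2"
        by (simp add: P_def power2_sum algebra_simps)
      then show "I \<omega> * ((\<Prod>l\<in>T. Q l \<omega>) * (\<Prod>l\<in>S - T. P l \<omega>)) =
          \<zeta> \<omega> * (Xv \<omega> i)\<^sup>2 + 2 * (\<zeta> \<omega> * Xv \<omega> i * D i \<omega>) + \<zeta> \<omega> * (D i \<omega>)\<^sup>2"
        unfolding P \<zeta>_def by (simp only: ring_distribs mult_ac)
    qed
    also have "\<dots> = expectation (\<lambda>\<omega>. \<zeta> \<omega> * (Xv \<omega> i)\<^sup>2) + 2 * expectation (\<lambda>\<omega>. \<zeta> \<omega> * Xv \<omega> i * D i \<omega>)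
        + expectation (\<lambda>\<omega>. \<zeta> \<omega> * (D i \<omega>)\<^sup>2)"
      by (subst Bochner_Integration.integral_add,
          (intro all_moments_integrable all_moments_intros \<zeta>m Xi Di; fail)+)
         (subst Bochner_Integration.integral_add,
          (intro all_moments_integrable all_moments_intros \<zeta>m Xi Di; fail)+, simp)
    also have "expectation (\<lambda>\<omega>. \<zeta> \<omega> * Xv \<omega> i * D i \<omega>) = 0"
      unfolding D_def
      by (rule expectation_mult_increment(1)[OF i vw])
         (intro borel_measurable_times \<zeta>h hist i all_moments_integrable all_moments_intros \<zeta>m Xi)+
    also have "expectation (\<lambda>\<omega>. \<zeta> \<omega> * (D i \<omega>)\<^sup>2) = expectation (\<lambda>\<omega>. (w - v) * \<zeta> \<omega>)"
      unfolding D_def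
      by (subst expectation_mult_increment(2)[OF i vw \<zeta>h all_moments_integrable[OF \<zeta>m]]) simp
    also have "expectation (\<lambda>\<omega>. \<zeta> \<omega> * (Xv \<omega> i)\<^sup>2) + 2 * 0 + expectation (\<lambda>\<omega>. (w - v) * \<zeta> \<omega>) =
        expectation (\<lambda>\<omega>. \<zeta> \<omega> * (Xv \<omega> i)\<^sup>2 + (w - v) * \<zeta> \<omega>)"
      by (subst Bochner_Integration.integral_add)
         ((intro all_moments_integrable all_moments_intros \<zeta>m Xi; fail)+, simp)
    also have "\<dots> = expectation (\<lambda>\<omega>. I \<omega> * ((\<Prod>l\<in>insert i T. Q l \<omega>) * (\<Prod>l\<in>S - insert i T. P l \<omega>)))"
    proof (rule Bochner_Integration.integral_cong[OF refl])
      fix \<omega>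
      show "\<zeta> \<omega> * (Xv \<omega> i)\<^sup>2 + (w - v) * \<zeta> \<omega> = I \<omega> * ((\<Prod>l\<in>insert i T. Q l \<omega>) * (\<Prod>l\<in>S - insert i T. P l \<omega>))"
        unfolding \<zeta>_def prod.insert[OF insert.hyps] Q_def[of i] by (simp only: ring_distribs mult_ac)
    qed
    finally show ?case using insert.IH insert.prems by simp
  qed simp
  have eq: "expectation (\<lambda>\<omega>. I \<omega> * (\<Prod>l\<in>S. P l \<omega>)) = expectation (\<lambda>\<omega>. I \<omega> * (\<Prod>l\<in>S. Q l \<omega>))"
    if S: "S \<subseteq> {1..N}" for S
    using swap[OF S finite_subset[OF S] order_refl] by simp
  have "expectation (\<lambda>\<omega>. I \<omega> * esym {1..N} m (\<lambda>l. P l \<omega>)) =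
      (\<Sum>S | S \<subseteq> {1..N} \<and> card S = m. expectation (\<lambda>\<omega>. I \<omega> * (\<Prod>l\<in>S. P l \<omega>)))"
    unfolding esym_def sum_distrib_left
    by (intro Bochner_Integration.integral_sum all_moments_integrable all_moments_intros Im Pm) auto
  also have "\<dots> = (\<Sum>S | S \<subseteq> {1..N} \<and> card S = m. expectation (\<lambda>\<omega>. I \<omega> * (\<Prod>l\<in>S. Q l \<omega>)))"
    by (intro sum.cong refl eq) auto
  also have "\<dots> = expectation (\<lambda>\<omega>. I \<omega> * esym {1..N} m (\<lambda>l. Q l \<omega>))"
    unfolding esym_def sum_distrib_left
    by (intro Bochner_Integration.integral_sum[symmetric] all_moments_integrable all_moments_intros Im Qm) auto
  finally show ?thesis by (simp add: I_def P_def Q_def D_def)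
qed

section \<open>Moments and compensated increments of the Bessel process\<close>

locale bessel = brownian M N B for M :: "'a measure" and N B +
  fixes \<nu> \<beta> :: real and a :: "nat \<Rightarrow> real" and X :: "real \<Rightarrow> 'a \<Rightarrow> nat \<Rightarrow> real" and L :: "real \<Rightarrow> 'a \<Rightarrow> real"
  assumes adapted: "0 \<le> t \<Longrightarrow> i \<in> {1..N} \<Longrightarrow> (\<lambda>\<omega>. X t \<omega> i) \<in> borel_measurable (canonical_filtration M N B t)"
    and AE_path: "AE \<omega> in M. bessel_path N \<nu> \<beta> a (\<lambda>t. B t \<omega>) (\<lambda>t. X t \<omega>) (\<lambda>t. L t \<omega>)"
begin

lemma X_measurable: "0 \<le> t \<Longrightarrow> i \<in> {1..N} \<Longrightarrow> (\<lambda>\<omega>. X t \<omega> i) \<in> borel_measurable M"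
  using subalgebra_canonical adapted by (rule measurable_from_subalg)

text \<open>The running bound of the Brownian motion is inserted for \<open>r\<close> in
  \<open>path_bounds\<close>, giving one random variable with all moments for the whole
  interval.\<close>

lemma path_dominated:
  assumes T: "0 \<le> T"
  obtains R where "all_moments M R"
    "AE \<omega> in M. 1 \<le> R \<omega> \<and> T \<le> R \<omega> \<and> L T \<omega> \<le> R \<omega> \<and>
      (\<forall>i\<in>{1..N}. integral {0..T} (\<lambda>u. \<bar>bessel_drift_B N \<nu> \<beta> (X u \<omega>) i\<bar>) \<le> R \<omega> \<and>
        (\<forall>u\<in>{0..T}. \<bar>X u \<omega> i\<bar> \<le> R \<omega> \<and> \<bar>B u \<omega> i\<bar> \<le> R \<omega>))"
proof -
  obtain r where r: "all_moments M r" "AE \<omega> in M. \<forall>u\<in>{0..T}. \<forall>i\<in>{1..N}. \<bar>B u \<omega> i\<bar> \<le> r \<omega>"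
    using running_bound[OF T] by blast
  have "all_moments M (\<lambda>\<omega>. path_bound N \<nu> \<beta> a T * (1 + r \<omega>)\<^sup>2)"
    by (intro all_moments_intros r(1))
  moreover have "AE \<omega> in M. 1 \<le> path_bound N \<nu> \<beta> a T * (1 + r \<omega>)\<^sup>2 \<and> T \<le> path_bound N \<nu> \<beta> a T * (1 + r \<omega>)\<^sup>2 \<and>
      L T \<omega> \<le> path_bound N \<nu> \<beta> a T * (1 + r \<omega>)\<^sup>2 \<and>
      (\<forall>i\<in>{1..N}. integral {0..T} (\<lambda>u. \<bar>bessel_drift_B N \<nu> \<beta> (X u \<omega>) i\<bar>) \<le> path_bound N \<nu> \<beta> a T * (1 + r \<omega>)\<^sup>2 \<and>
        (\<forall>u\<in>{0..T}. \<bar>X u \<omega> i\<bar> \<le> path_bound N \<nu> \<beta> a T * (1 + r \<omega>)\<^sup>2 \<and>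
          \<bar>B u \<omega> i\<bar> \<le> path_bound N \<nu> \<beta> a T * (1 + r \<omega>)\<^sup>2))"
    using AE_path r(2)
  proof eventually_elim
    case (elim \<omega>)
    interpret bessel_path N \<nu> \<beta> a "\<lambda>t. B t \<omega>" "\<lambda>t. X t \<omega>" "\<lambda>t. L t \<omega>" by (rule elim(1))
    have r': "\<bar>B u \<omega> i\<bar> \<le> r \<omega>" if "u \<in> {0..T}" "i \<in> {1..N}" for u i using elim(2) that by blast
    from path_bounds[OF T r'] show ?case unfolding b_def by blast
  qed
  ultimately show ?thesis by (rule that)
qed

lemma X_all_moments:
  assumes "0 \<le> t" "i \<in> {1..N}"
  shows "all_moments M (\<lambda>\<omega>. X t \<omega> i)"
proof -
  obtain R where R: "all_moments M R"
    "AE \<omega> in M. 1 \<le> R \<omega> \<and> t \<le> R \<omega> \<and> L t \<omega> \<le> R \<omega> \<and>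
      (\<forall>i\<in>{1..N}. integral {0..t} (\<lambda>u. \<bar>bessel_drift_B N \<nu> \<beta> (X u \<omega>) i\<bar>) \<le> R \<omega> \<and>
        (\<forall>u\<in>{0..t}. \<bar>X u \<omega> i\<bar> \<le> R \<omega> \<and> \<bar>B u \<omega> i\<bar> \<le> R \<omega>))"
    using path_dominated[OF assms(1)] by blast
  show ?thesis
    by (rule all_moments_bound[OF R(1) X_measurable[OF assms]])
       (use R(2) in eventually_elim, use assms in auto)
qed

lemma esym_X_all_moments: "0 \<le> t \<Longrightarrow> all_moments M (\<lambda>\<omega>. esym {1..N} m (\<lambda>i. (X t \<omega> i)\<^sup>2))"
  by (intro all_moments_esym all_moments_power X_all_moments)

text \<open>The centered part has mean 0 on every event of the past, so in expectation only a
  difference of endpoint values remains, and it telescopes over a grid.\<close>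

lemma expectation_compensated_increment:
  assumes F: "F \<in> sets (canonical_filtration M N B s)" and "0 \<le> s" "s \<le> v" "v \<le> w"
  shows "integrable M (\<lambda>\<omega>. indicator F \<omega> * compensated_increment N m c (\<lambda>t. B t \<omega>) (\<lambda>t. X t \<omega>) v w)"
    and "expectation (\<lambda>\<omega>. indicator F \<omega> * compensated_increment N m c (\<lambda>t. B t \<omega>) (\<lambda>t. X t \<omega>) v w) =
      c w * expectation (\<lambda>\<omega>. indicator F \<omega> * esym {1..N} m (\<lambda>l. (X w \<omega> l)\<^sup>2))
      - c v * expectation (\<lambda>\<omega>. indicator F \<omega> * esym {1..N} m (\<lambda>l. (X v \<omega> l)\<^sup>2))"
proof -
  let ?I = "indicator F :: 'a \<Rightarrow> real"
  let ?E = "\<lambda>f \<omega>. ?I \<omega> * esym {1..N} m (f \<omega>)"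
  have v0: "0 \<le> v" "0 \<le> w" using assms by auto
  have Fv: "F \<in> sets (canonical_filtration M N B v)" using F canonical_mono[OF assms(3)] by blast
  have FM: "F \<in> events" using F subalgebra_canonical[of s] by (auto simp: subalgebra_def)
  have m: "all_moments M (?E (\<lambda>\<omega> l. (X w \<omega> l)\<^sup>2))" "all_moments M (?E (\<lambda>\<omega> l. (X v \<omega> l)\<^sup>2))"
    "all_moments M (?E (\<lambda>\<omega> l. (X v \<omega> l + (B w \<omega> l - B v \<omega> l))\<^sup>2))"
    "all_moments M (?E (\<lambda>\<omega> l. (X v \<omega> l)\<^sup>2 + (w - v)))"
    by (intro all_moments_mult all_moments_indicator FM all_moments_esym all_moments_power all_moments_add
        all_moments_const X_all_moments increment_moments(1) v0 assms; assumption)+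
  have eq: "?I \<omega> * compensated_increment N m c (\<lambda>t. B t \<omega>) (\<lambda>t. X t \<omega>) v w =
      c w * ?E (\<lambda>\<omega> l. (X w \<omega> l)\<^sup>2) \<omega> - c v * ?E (\<lambda>\<omega> l. (X v \<omega> l)\<^sup>2) \<omega>
      - c w * (?E (\<lambda>\<omega> l. (X v \<omega> l + (B w \<omega> l - B v \<omega> l))\<^sup>2) \<omega> - ?E (\<lambda>\<omega> l. (X v \<omega> l)\<^sup>2 + (w - v)) \<omega>)" for \<omega>
    unfolding compensated_increment_def by (simp add: algebra_simps)
  show "integrable M (\<lambda>\<omega>. ?I \<omega> * compensated_increment N m c (\<lambda>t. B t \<omega>) (\<lambda>t. X t \<omega>) v w)"
    unfolding eq by (intro all_moments_integrable all_moments_diff all_moments_mult all_moments_const m)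
  have "expectation (?E (\<lambda>\<omega> l. (X v \<omega> l + (B w \<omega> l - B v \<omega> l))\<^sup>2)) = expectation (?E (\<lambda>\<omega> l. (X v \<omega> l)\<^sup>2 + (w - v)))"
    by (rule expectation_esym_increment[OF Fv v0(1) assms(4)]) (intro adapted X_all_moments v0; assumption)+
  then show "expectation (\<lambda>\<omega>. ?I \<omega> * compensated_increment N m c (\<lambda>t. B t \<omega>) (\<lambda>t. X t \<omega>) v w) =
      c w * expectation (?E (\<lambda>\<omega> l. (X w \<omega> l)\<^sup>2)) - c v * expectation (?E (\<lambda>\<omega> l. (X v \<omega> l)\<^sup>2))"
    unfolding eq using m[THEN all_moments_integrable] by simp
qed

text \<open>The compensated sum over a grid has a mean that does not depend on the grid, namely the
  difference of the two sides, whereas the sum tends to 0 almost surely. The hypotheses on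
  \<open>c'\<close> say that time derivative plus generator annihilates the polynomial in
  \<open>G\<close>, degree by degree.\<close>

lemma expectation_space_time_harmonic:
  fixes c c' :: "nat \<Rightarrow> real \<Rightarrow> real"
  assumes F: "F \<in> sets (canonical_filtration M N B s)" and st: "0 \<le> s" "s \<le> t"
    and c: "\<And>l u. (c l has_real_derivative c' l u) (at u)" and c'_cont: "\<And>l. continuous_on UNIV (c' l)"
    and c'_0: "\<And>u. c' 0 u = 0"
    and c'_Suc: "\<And>l u. l < k \<Longrightarrow> c' (Suc l) u =
      - (generator_coeff N \<nu> \<beta> (k - l) + (real N - real (k - l) + 1)) * c l u"
  defines "G \<equiv> \<lambda>t \<omega>. \<Sum>l\<le>k. c l t * esym {1..N} (k - l) (\<lambda>i. (X t \<omega> i)\<^sup>2)"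
  shows "expectation (\<lambda>\<omega>. indicator F \<omega> * G t \<omega>) = expectation (\<lambda>\<omega>. indicator F \<omega> * G s \<omega>)"
proof -
  let ?g = "grid s t"
  let ?I = "indicator F :: 'a \<Rightarrow> real"
  let ?inc = "\<lambda>l \<omega> v w. compensated_increment N (k - l) (c l) (\<lambda>t. B t \<omega>) (\<lambda>t. X t \<omega>) v w"
  define S where "S n \<omega> = (\<Sum>l\<le>k. \<Sum>j<n. ?inc l \<omega> (?g n j) (?g n (Suc j)))" for n \<omega>
  have FM: "F \<in> events" using F subalgebra_canonical[of s] by (auto simp: subalgebra_def)
  have cv: "(c l has_vector_derivative c' l u) (at u within A)" for l u A
    using c[of l u] by (simp add: has_real_derivative_iff_has_vector_derivative has_vector_derivative_at_within)
  have c'c: "continuous_on A (c' l)" for l A using c'_cont by (rule continuous_on_subset) simp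
  have cc: "continuous_on A (c l)" for l A by (rule continuous_on_vector_derivative[OF cv])
  have g: "s \<le> ?g n j" "?g n j \<le> ?g n (Suc j)" for n j
    using st by (auto intro: grid_ge grid_mono)
  have exp_S: "expectation (\<lambda>\<omega>. ?I \<omega> * S n \<omega>) =
      expectation (\<lambda>\<omega>. ?I \<omega> * G t \<omega>) - expectation (\<lambda>\<omega>. ?I \<omega> * G s \<omega>)" if n: "n > 0" for n
  proof -
    define \<phi> where "\<phi> l u = c l u * expectation (\<lambda>\<omega>. ?I \<omega> * esym {1..N} (k - l) (\<lambda>i. (X u \<omega> i)\<^sup>2))" for l u
    have G: "expectation (\<lambda>\<omega>. ?I \<omega> * G u \<omega>) = (\<Sum>l\<le>k. \<phi> l u)" if "0 \<le> u" for u
    proof -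
      have "expectation (\<lambda>\<omega>. ?I \<omega> * G u \<omega>) =
          expectation (\<lambda>\<omega>. \<Sum>l\<le>k. c l u * (?I \<omega> * esym {1..N} (k - l) (\<lambda>i. (X u \<omega> i)\<^sup>2)))"
        by (simp add: G_def sum_distrib_left mult_ac)
      also have "\<dots> = (\<Sum>l\<le>k. expectation (\<lambda>\<omega>. c l u * (?I \<omega> * esym {1..N} (k - l) (\<lambda>i. (X u \<omega> i)\<^sup>2))))"
        by (intro Bochner_Integration.integral_sum all_moments_integrable all_moments_mult all_moments_const
            all_moments_indicator FM esym_X_all_moments that)
      finally show ?thesis by (simp add: \<phi>_def)
    qed
    have "expectation (\<lambda>\<omega>. ?I \<omega> * S n \<omega>) =
        expectation (\<lambda>\<omega>. \<Sum>l\<le>k. \<Sum>j<n. ?I \<omega> * ?inc l \<omega> (?g n j) (?g n (Suc j)))"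
      by (simp add: S_def sum_distrib_left)
    also have "\<dots> = (\<Sum>l\<le>k. \<Sum>j<n. expectation (\<lambda>\<omega>. ?I \<omega> * ?inc l \<omega> (?g n j) (?g n (Suc j))))"
      by (subst Bochner_Integration.integral_sum,
          (intro Bochner_Integration.integrable_sum expectation_compensated_increment(1)[OF F st(1) g]; fail),
          intro sum.cong[OF refl] Bochner_Integration.integral_sum expectation_compensated_increment(1)[OF F st(1) g])
    also have "\<dots> = (\<Sum>l\<le>k. \<Sum>j<n. \<phi> l (?g n (Suc j)) - \<phi> l (?g n j))"
      unfolding expectation_compensated_increment(2)[OF F st(1) g] \<phi>_def ..
    also have "\<dots> = (\<Sum>l\<le>k. \<phi> l t - \<phi> l s)" using sum_grid_diff[OF n] by simp
    also have "\<dots> = expectation (\<lambda>\<omega>. ?I \<omega> * G t \<omega>) - expectation (\<lambda>\<omega>. ?I \<omega> * G s \<omega>)"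
      using G[of t] G[of s] st by (simp add: sum_subtractf)
    finally show ?thesis .
  qed
  have lim: "AE \<omega> in M. (\<lambda>n. S n \<omega>) \<longlonglongrightarrow> 0"
    using AE_path
  proof eventually_elim
    case (elim \<omega>)
    interpret bessel_path N \<nu> \<beta> a "\<lambda>t. B t \<omega>" "\<lambda>t. X t \<omega>" "\<lambda>t. L t \<omega>" by (rule elim)
    define e where "e m u = esym {1..N} m (\<lambda>i. (X u \<omega> i)\<^sup>2)" for m u
    \<comment> \<open>At \<open>l = k\<close> the polynomial is e_0 = 1, which the generator kills.
      \<open>compensated_sum_tendsto\<close> is stated for positive degree, so this term is treated
      separately; its increments are those of \<open>c k\<close>.\<close>
    define f where "f l u = (if l < k then c l u * ((generator_coeff N \<nu> \<beta> (k - l) + (real N - real (k - l) + 1)) *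
      e (k - l - 1) u) else 0) + c' l u * e (k - l) u" for l u
    have ce: "continuous_on {s..t} (e m)" for m
      unfolding e_def by (intro continuous_intros continuous_on_subset[OF cont_X]) (use st in auto)
    have "(\<lambda>n. \<Sum>j<n. ?inc l \<omega> (?g n j) (?g n (Suc j))) \<longlonglongrightarrow> integral {s..t} (f l)" if l: "l \<le> k" for l
    proof (cases "l < k")
      case True
      have "f l = (\<lambda>u. c l u * ((generator_coeff N \<nu> \<beta> (k - l) + (real N - real (k - l) + 1)) *
          e (k - l - 1) u) + c' l u * e (k - l) u)"
        using True by (simp add: f_def[abs_def])
      then show ?thesis
        using compensated_sum_tendsto[OF _ st cv c'c, of "k - l"] True unfolding e_def by simp
    next
      case False
      with l have lk: "l = k" by simp
      have "integral {s..t} (f l) = c l t - c l s"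
        unfolding f_def lk e_def
        using fundamental_theorem_of_calculus[OF st(2) cv[of k]] by (simp add: integral_unique)
      moreover have "\<forall>\<^sub>F n in sequentially. (\<Sum>j<n. ?inc l \<omega> (?g n j) (?g n (Suc j))) = c l t - c l s"
        using eventually_gt_at_top[of 0]
        by eventually_elim (use sum_grid_diff[of _ "c l" s t] in \<open>simp add: compensated_increment_def lk\<close>)
      ultimately show ?thesis by (simp add: tendsto_eventually)
    qed
    then have "(\<lambda>n. S n \<omega>) \<longlonglongrightarrow> (\<Sum>l\<le>k. integral {s..t} (f l))"
      unfolding S_def by (intro tendsto_sum) auto
    also have "(\<Sum>l\<le>k. integral {s..t} (f l)) = integral {s..t} (\<lambda>u. \<Sum>l\<le>k. f l u)"
    proof (rule integral_sum[symmetric])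
      fix l assume "l \<in> {..k}"
      show "f l integrable_on {s..t}"
        unfolding f_def[abs_def]
        by (rule integrable_continuous_real, cases "l < k") (auto intro!: continuous_intros cc c'c ce)
    qed simp
    also have "(\<lambda>u. \<Sum>l\<le>k. f l u) = (\<lambda>u. 0)"
    proof
      fix u
      \<comment> \<open>Shifting the index pairs the time derivative of \<open>c (Suc l)\<close>
        with the generator acting on degree \<open>k - l\<close>; both multiply the polynomial of
        degree \<open>k - l - 1\<close>.\<close>
      have "(\<Sum>l\<le>k. c' l u * e (k - l) u) = (\<Sum>l<k. c' (Suc l) u * e (k - Suc l) u)"
        unfolding lessThan_Suc_atMost[symmetric] sum.lessThan_Suc_shift by (simp add: c'_0)
      also have "\<dots> = (\<Sum>l<k. - (c l u * ((generator_coeff N \<nu> \<beta> (k - l) + (real N - real (k - l) + 1)) * e (k - l - 1) u)))"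
        by (intro sum.cong refl) (simp add: c'_Suc algebra_simps)
      also have "\<dots> = - (\<Sum>l\<le>k. if l < k then c l u * ((generator_coeff N \<nu> \<beta> (k - l) + (real N - real (k - l) + 1)) *
          e (k - l - 1) u) else 0)"
        unfolding lessThan_Suc_atMost[symmetric] by (simp add: sum_negf)
      finally show "(\<Sum>l\<le>k. f l u) = 0" by (simp add: f_def sum.distrib)
    qed
    finally show ?case by simp
  qed
  obtain R where R: "all_moments M R"
    "AE \<omega> in M. 1 \<le> R \<omega> \<and> t \<le> R \<omega> \<and> L t \<omega> \<le> R \<omega> \<and>
      (\<forall>i\<in>{1..N}. integral {0..t} (\<lambda>u. \<bar>bessel_drift_B N \<nu> \<beta> (X u \<omega>) i\<bar>) \<le> R \<omega> \<and>
        (\<forall>u\<in>{0..t}. \<bar>X u \<omega> i\<bar> \<le> R \<omega> \<and> \<bar>B u \<omega> i\<bar> \<le> R \<omega>))"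
    using path_dominated[of t] st by auto
  obtain C where C: "\<And>l u. l \<le> k \<Longrightarrow> u \<in> {s..t} \<Longrightarrow> \<bar>c l u\<bar> \<le> C" "\<And>l u. l \<le> k \<Longrightarrow> u \<in> {s..t} \<Longrightarrow> \<bar>c' l u\<bar> \<le> C"
  proof -
    have "bounded (\<Union>l\<in>{..k}. c l ` {s..t} \<union> c' l ` {s..t})"
      by (intro bounded_UN ballI finite_atMost bounded_Un[THEN iffD2] conjI compact_imp_bounded
          compact_continuous_image cc c'c compact_Icc)
    then obtain C where "\<forall>z\<in>(\<Union>l\<in>{..k}. c l ` {s..t} \<union> c' l ` {s..t}). norm z \<le> C"
      by (auto simp: bounded_iff)
    then show ?thesis by (intro that[of C]) auto
  qed
  define K where "K = (5 * real N + 5) * C * 18 ^ N"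
  have C0: "0 \<le> C" using C(1)[of 0 s] st by (intro order_trans[OF abs_ge_zero]) auto
  have bound: "AE \<omega> in M. \<forall>n>0. \<bar>S n \<omega>\<bar> \<le> (real k + 1) * ((K + 2 * C) * R \<omega> ^ (2 * N + 2))"
    using AE_path R(2)
  proof eventually_elim
    case (elim \<omega>)
    interpret bessel_path N \<nu> \<beta> a "\<lambda>t. B t \<omega>" "\<lambda>t. X t \<omega>" "\<lambda>t. L t \<omega>" by (rule elim)
    have R1: "1 \<le> R \<omega> ^ (2 * N + 2)" using elim(2) by (intro one_le_power) auto
    have K0: "0 \<le> K" using C0 by (simp add: K_def)
    have le: "\<bar>\<Sum>j<n. ?inc l \<omega> (?g n j) (?g n (Suc j))\<bar> \<le> (K + 2 * C) * R \<omega> ^ (2 * N + 2)"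
      if n: "n > 0" and l: "l \<le> k" for n l
    proof (cases "l < k")
      case True
      have "\<bar>\<Sum>j<n. ?inc l \<omega> (?g n j) (?g n (Suc j))\<bar> \<le> K * R \<omega> ^ (2 * N + 2)"
        unfolding K_def
        by (rule compensated_sum_bound[OF _ st order_refl n cv c'c C(1)[OF l] C(2)[OF l]])
           (use elim(2) True in \<open>auto simp: b_def\<close>)
      also have "\<dots> \<le> (K + 2 * C) * R \<omega> ^ (2 * N + 2)"
        using C0 R1 by (intro mult_right_mono) auto
      finally show ?thesis .
    next
      case False
      with l have lk: "l = k" by simp
      have "\<bar>\<Sum>j<n. ?inc l \<omega> (?g n j) (?g n (Suc j))\<bar> = \<bar>c l t - c l s\<bar>"
        using sum_grid_diff[OF n, of "c l" s t] by (simp add: compensated_increment_def lk)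
      also have "\<dots> \<le> 2 * C" using C(1)[OF l, of s] C(1)[OF l, of t] st by auto
      also have "\<dots> \<le> (K + 2 * C) * 1" using K0 by simp
      also have "\<dots> \<le> (K + 2 * C) * R \<omega> ^ (2 * N + 2)" using R1 K0 C0 by (intro mult_left_mono) auto
      finally show ?thesis .
    qed
    have "\<bar>S n \<omega>\<bar> \<le> (\<Sum>l\<le>k. (K + 2 * C) * R \<omega> ^ (2 * N + 2))" if "n > 0" for n
      unfolding S_def by (rule sum_abs[THEN order_trans], rule sum_mono, rule le) (use that in auto)
    then show ?case by (simp add: add.commute)
  qed
  define w where "w \<omega> = (real k + 1) * ((K + 2 * C) * R \<omega> ^ (2 * N + 2))" for \<omega>
  have wm: "all_moments M w" unfolding w_def by (intro all_moments_mult all_moments_const all_moments_power R(1))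
  have int_S: "integrable M (\<lambda>\<omega>. ?I \<omega> * S n \<omega>)" for n
    unfolding S_def sum_distrib_left
    by (intro Bochner_Integration.integrable_sum expectation_compensated_increment(1)[OF F st(1) g])
  \<comment> \<open>The shift to \<open>Suc n\<close> excludes the grid without steps, for which the
    sum is empty and does not telescope to the endpoints.\<close>
  have "(\<lambda>n. expectation (\<lambda>\<omega>. ?I \<omega> * S (Suc n) \<omega>)) \<longlonglongrightarrow> expectation (\<lambda>\<omega>. 0)"
  proof (rule integral_dominated_convergence[where w = w])
    show "AE \<omega> in M. (\<lambda>n. ?I \<omega> * S (Suc n) \<omega>) \<longlonglongrightarrow> 0"
      using lim
    proof eventually_elim
      case (elim \<omega>)
      from tendsto_mult_right_zero[OF LIMSEQ_Suc[OF elim], of "?I \<omega>"] show ?case .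
    qed
    show "AE \<omega> in M. norm (?I \<omega> * S (Suc n) \<omega>) \<le> w \<omega>" for n
      using bound
    proof eventually_elim
      case (elim \<omega>)
      have "norm (?I \<omega> * S (Suc n) \<omega>) \<le> \<bar>S (Suc n) \<omega>\<bar>" by (auto simp: indicator_def)
      also have "\<dots> \<le> w \<omega>" unfolding w_def using elim by blast
      finally show ?case .
    qed
  qed (use int_S all_moments_integrable[OF wm] in \<open>auto intro: borel_measurable_integrable\<close>)
  then have "(\<lambda>n :: nat. expectation (\<lambda>\<omega>. ?I \<omega> * G t \<omega>) - expectation (\<lambda>\<omega>. ?I \<omega> * G s \<omega>)) \<longlonglongrightarrow> 0"
    using exp_S by simp
  then show ?thesis by (simp add: LIMSEQ_const_iff)
qed

end

section \<open>From expectations on past events to the martingale\<close>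

lemma (in brownian) martingaleI:
  assumes meas: "\<And>t. 0 \<le> t \<Longrightarrow> Y t \<in> borel_measurable (canonical_filtration M N B t)"
    and int: "\<And>t. 0 \<le> t \<Longrightarrow> integrable M (Y t)"
    and eq: "\<And>s t F. 0 \<le> s \<Longrightarrow> s \<le> t \<Longrightarrow> F \<in> sets (canonical_filtration M N B s) \<Longrightarrow>
      expectation (\<lambda>\<omega>. indicator F \<omega> * Y t \<omega>) = expectation (\<lambda>\<omega>. indicator F \<omega> * Y s \<omega>)"
  shows "martingale M (canonical_filtration M N B) Y"
  unfolding martingale_def
proof (intro conjI allI impI)
  fix s t :: real assume st: "0 \<le> s \<and> s \<le> t"
  interpret finite_measure_subalgebra M "canonical_filtration M N B s"
    by unfold_locales (rule subalgebra_canonical)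
  show "AE \<omega> in M. real_cond_exp M (canonical_filtration M N B s) (Y t) \<omega> = Y s \<omega>"
    by (rule real_cond_exp_charact)
       (use st eq[of s t] meas[of s] int[of s] int[of t] in \<open>auto simp: set_lebesgue_integral_def\<close>)
qed (use prob_space_axioms filtration_canonical subalgebra_canonical meas int in auto)

lemma bessel_process_B_bessel:
  assumes "N \<ge> 1" "\<nu> \<ge> 0" "\<beta> > 0" and X: "bessel_process_B M N \<nu> \<beta> B a X"
  obtains L where "bessel M N B \<nu> \<beta> a X L"
proof -
  let ?F = "canonical_filtration M N B"
  have bm: "brownian_motion M N B"
    and adapted: "\<forall>t\<ge>0. \<forall>i\<in>{1..N}. (\<lambda>\<omega>. X t \<omega> i) \<in> borel_measurable (?F t)"
    and cont_X: "AE \<omega> in M. \<forall>i\<in>{1..N}. continuous_on {0..} (\<lambda>t. X t \<omega> i)"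
    and chamber: "AE \<omega> in M. \<forall>t\<ge>0. X t \<omega> \<in> weyl_chamber_B N"
    and defined: "AE \<omega> in M. AE s in lborel. 0 \<le> s \<longrightarrow> drift_defined_B N \<nu> (X s \<omega>)"
    using X unfolding bessel_process_B_def by blast+
  obtain L where L: "if \<nu> = 0 then reflection_term M ?F (\<lambda>t \<omega>. X t \<omega> N) L else L = (\<lambda>_ _. 0)"
    and sde: "AE \<omega> in M. \<forall>t\<ge>0. \<forall>i\<in>{1..N}.
           set_integrable lborel {0..t} (\<lambda>s. bessel_drift_B N \<nu> \<beta> (X s \<omega>) i) \<and>
           X t \<omega> i = a i + B t \<omega> i + (LBINT s:{0..t}. bessel_drift_B N \<nu> \<beta> (X s \<omega>) i)
             + (if i = N then L t \<omega> else 0)"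
    using X unfolding bessel_process_B_def by blast
  interpret prob_space M using bm by (simp add: brownian_motion_def)
  interpret brownian M N B by unfold_locales (rule bm)
  have reflection: "AE \<omega> in M. L 0 \<omega> = 0 \<and> mono_on {0..} (\<lambda>t. L t \<omega>) \<and>
      (\<forall>s t. 0 \<le> s \<and> s \<le> t \<and> (\<forall>u\<in>{s..t}. X u \<omega> N > 0) \<longrightarrow> L t \<omega> = L s \<omega>)"
  proof (cases "\<nu> = 0")
    case True
    then have "AE \<omega> in M. L 0 \<omega> = 0 \<and> continuous_on {0..} (\<lambda>t. L t \<omega>) \<and> mono_on {0..} (\<lambda>t. L t \<omega>) \<and>
      (\<forall>s t. 0 \<le> s \<and> s \<le> t \<and> (\<forall>u\<in>{s..t}. X u \<omega> N > 0) \<longrightarrow> L t \<omega> = L s \<omega>)"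
      using L by (simp add: reflection_term_def)
    then show ?thesis by eventually_elim blast
  next
    case False
    then show ?thesis using L by (simp add: mono_on_def)
  qed
  have cont_B: "AE \<omega> in M. \<forall>i\<in>{1..N}. continuous_on {0..} (\<lambda>t. B t \<omega> i)"
    by (rule AE_finite_allI) (use AE_continuous_B in auto)
  have "AE \<omega> in M. bessel_path N \<nu> \<beta> a (\<lambda>t. B t \<omega>) (\<lambda>t. X t \<omega>) (\<lambda>t. L t \<omega>)"
    using cont_X chamber defined sde reflection cont_B
  proof eventually_elim
    case (elim \<omega>)
    show ?case
      by unfold_locales (use elim assms(1-3) in blast)+
  qed
  then have "bessel M N B \<nu> \<beta> a X L"
    by unfold_locales (use adapted in blast)+
  then show ?thesis by (rule that)
qed

theorem proposition3p3:
  fixes M :: "'a measure" and B X :: "real \<Rightarrow> 'a \<Rightarrow> nat \<Rightarrow> real"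
    and N k :: nat and \<nu> \<beta> :: real and x :: "nat \<Rightarrow> real"
  assumes "N \<ge> 1" and "\<nu> \<ge> 0" and "\<beta> > 0" and "k \<in> {1..N}"
    and "x \<in> weyl_chamber_B N"
    and "bessel_process_B M N \<nu> \<beta> B (\<lambda>i. sqrt \<beta> * x i) X"
  shows "martingale M (canonical_filtration M N B)
    (\<lambda>t \<omega>. elem_sym N k (\<lambda>i. (renormalized \<beta> X t \<omega> i)\<^sup>2) +
      (\<Sum>l=1..k. (- 2 * t) ^ l * real ((N - k + l) choose l) *
         pochhammer (real (N - k) + \<nu> + 1 / (2 * \<beta>)) l *
         elem_sym N (k - l) (\<lambda>i. (renormalized \<beta> X t \<omega> i)\<^sup>2)))"
proof -
  obtain L where "bessel M N B \<nu> \<beta> (\<lambda>i. sqrt \<beta> * x i) X L"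
    using bessel_process_B_bessel[OF assms(1-3,6)] by blast
  then interpret bessel M N B \<nu> \<beta> "\<lambda>i. sqrt \<beta> * x i" X L .
  define p where "p = real (N - k) + \<nu> + 1 / (2 * \<beta>)"
  \<comment> \<open>The power of 1/\<beta> undoes the renormalization, because e_q(x^2/\<beta>) is
    the q-th power of 1/\<beta> times e_q(x^2).\<close>
  define d where "d l = real ((N - k + l) choose l) * pochhammer p l * (1 / \<beta>) ^ (k - l)" for l
  define c where "c l t = d l * (- 2 * t) ^ l" for l and t :: real
  \<comment> \<open>For \<open>l = 0\<close> the truncated exponent is harmless, since the factor
    \<open>real l\<close> vanishes.\<close>
  define c' where "c' l t = d l * (real l * (- 2 * t) ^ (l - 1) * (- 2))" for l and t :: real
  define G where "G t \<omega> = (\<Sum>l\<le>k. c l t * esym {1..N} (k - l) (\<lambda>i. (X t \<omega> i)\<^sup>2))" for t \<omega>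
  have kN: "k \<le> N" using assms(4) by simp
  \<comment> \<open>With n = N-k+l the first factor on the right is (n+1)(2\<beta>n + 2\<nu>\<beta>
    + 1). Here n+1 comes from (l+1) binom(n+1, l+1) = (n+1) binom(n, l), and the other factor from
    the next Pochhammer factor p + l = (2\<beta>n + 2\<nu>\<beta> + 1)/(2\<beta>). Its denominator
    \<beta> is matched by the exponent \<open>k - l\<close> dropping by one.\<close>
  have d_Suc: "2 * real (Suc l) * d (Suc l) = (generator_coeff N \<nu> \<beta> (k - l) + (real N - real (k - l) + 1)) * d l"
    if l: "l < k" for l
  proof -
    define n where "n = N - k + l"
    have n: "real N - real (k - l) = real n" using l kN by (simp add: n_def of_nat_diff)
    have "real (Suc l) * real (Suc n choose Suc l) = real (Suc n) * real (n choose l)"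
      by (metis Suc_times_binomial_eq of_nat_mult mult.commute)
    moreover have "N - k + Suc l = Suc n" by (simp add: n_def)
    moreover have "(1 / \<beta>) ^ (k - l) = (1 / \<beta>) * (1 / \<beta>) ^ (k - Suc l)"
      using l by (metis Suc_diff_Suc power_Suc)
    moreover have "2 * \<beta> * (p + real l) = 2 * \<beta> * real n + 2 * \<nu> * \<beta> + 1"
      using assms(3) by (simp add: p_def n_def field_simps)
    then have "p + real l = (2 * \<beta> * real n + 2 * \<nu> * \<beta> + 1) * (1 / \<beta>) / 2"
      using assms(3) by (simp add: field_simps)
    ultimately have "2 * real (Suc l) * d (Suc l) =
        2 * (real (Suc n) * real (n choose l)) * (pochhammer p l * ((2 * \<beta> * real n + 2 * \<nu> * \<beta> + 1) * (1 / \<beta>) / 2)) *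
        (1 / \<beta>) ^ (k - Suc l)"
      by (simp add: d_def pochhammer_Suc mult.assoc[symmetric] del: of_nat_Suc binomial_Suc_Suc)
    also have "\<dots> = (real n + 1) * (1 + 2 * \<nu> * \<beta> + 2 * \<beta> * real n) * (real (n choose l) * pochhammer p l * ((1 / \<beta>) * (1 / \<beta>) ^ (k - Suc l)))"
      by (simp add: algebra_simps)
    also have "\<dots> = (real n + 1) * (1 + 2 * \<nu> * \<beta> + 2 * \<beta> * real n) * d l"
      using l by (simp add: d_def n_def power_Suc[symmetric] Suc_diff_Suc del: power_Suc)
    finally show ?thesis unfolding generator_coeff_def n by (simp add: algebra_simps)
  qed
  have eq: "(\<lambda>t \<omega>. elem_sym N k (\<lambda>i. (renormalized \<beta> X t \<omega> i)\<^sup>2) +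
      (\<Sum>l=1..k. (- 2 * t) ^ l * real ((N - k + l) choose l) *
         pochhammer (real (N - k) + \<nu> + 1 / (2 * \<beta>)) l *
         elem_sym N (k - l) (\<lambda>i. (renormalized \<beta> X t \<omega> i)\<^sup>2))) = G"
  proof (intro ext)
    fix t \<omega>
    have e: "elem_sym N q (\<lambda>i. (renormalized \<beta> X t \<omega> i)\<^sup>2) = (1 / \<beta>) ^ q * esym {1..N} q (\<lambda>i. (X t \<omega> i)\<^sup>2)" for q
      using assms(3) esym_scale[of "{1..N}" q "1 / \<beta>" "\<lambda>i. (X t \<omega> i)\<^sup>2"]
      by (simp add: elem_sym_eq_esym renormalized_def power_divide)
    have "{..k} = insert 0 {1..k}" by auto
    then have "G t \<omega> = c 0 t * esym {1..N} k (\<lambda>i. (X t \<omega> i)\<^sup>2) +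
        (\<Sum>l=1..k. c l t * esym {1..N} (k - l) (\<lambda>i. (X t \<omega> i)\<^sup>2))"
      unfolding G_def by simp
    then show "elem_sym N k (\<lambda>i. (renormalized \<beta> X t \<omega> i)\<^sup>2) +
      (\<Sum>l=1..k. (- 2 * t) ^ l * real ((N - k + l) choose l) *
         pochhammer (real (N - k) + \<nu> + 1 / (2 * \<beta>)) l *
         elem_sym N (k - l) (\<lambda>i. (renormalized \<beta> X t \<omega> i)\<^sup>2)) = G t \<omega>"
      unfolding e p_def[symmetric] c_def d_def by (simp add: mult_ac)
  qed
  show ?thesis
    unfolding eq
  proof (rule martingaleI)
    fix t :: real assume t: "0 \<le> t"
    show "G t \<in> borel_measurable (canonical_filtration M N B t)"
      unfolding G_def[abs_def]
      by (intro borel_measurable_sum borel_measurable_times borel_measurable_const borel_measurable_esym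
          borel_measurable_power adapted t)
    show "integrable M (G t)"
      unfolding G_def[abs_def]
      by (intro all_moments_integrable all_moments_sum all_moments_mult all_moments_const esym_X_all_moments t)
  next
    fix s t F assume "0 \<le> s" "s \<le> t" and F: "F \<in> sets (canonical_filtration M N B s)"
    then show "expectation (\<lambda>\<omega>. indicator F \<omega> * G t \<omega>) = expectation (\<lambda>\<omega>. indicator F \<omega> * G s \<omega>)"
      unfolding G_def
    proof (intro expectation_space_time_harmonic[where c' = c'])
      show "(c l has_real_derivative c' l u) (at u)" for l u
        unfolding c_def c'_def by (auto intro!: derivative_eq_intros)
      show "continuous_on UNIV (c' l)" for l unfolding c'_def[abs_def] by (intro continuous_intros)
      show "c' 0 u = 0" for u by (simp add: c'_def)
      show "c' (Suc l) u = - (generator_coeff N \<nu> \<beta> (k - l) + (real N - real (k - l) + 1)) * c l u" if "l < k" for l u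
      proof -
        have "c' (Suc l) u = - (2 * real (Suc l) * d (Suc l)) * (- 2 * u) ^ l"
          by (simp add: c'_def algebra_simps)
        also have "\<dots> = - (generator_coeff N \<nu> \<beta> (k - l) + (real N - real (k - l) + 1)) * c l u"
          unfolding d_Suc[OF that] c_def by (simp add: algebra_simps)
        finally show ?thesis .
      qed
    qed
  qed
qed

end
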